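(* Let $H$ and $U$ be two complex Hilbert spaces. Let $A_0:D(A_0)\subset H\longrightarrow H$ be the generator of a $C_0$-semigroup on $H$ and let $B\in\mathcal{L}(U,D(A_0^* )')$ be an admissible control operator for $A_0$. Let $K\in\mathcal{L}(H)$ and let $A_K=A_0+K$ with $D(A_K)=D(A_0)$ (then $A_K$ generates a $C_0$-semigroup on $H$ and $B$ is also admissible for $A_K$). Assume that: (i) there exists $T_0>0$ such that $(A_0,B)$ is exactly controllable in time $T_0$; (ii) $K$ is compact; (iii) $(A_K,B)$ satisfies the Fattorini-Hautus test: $\ker(\lambda-A_K^* )\cap\ker B^*=\{0\}$ for all $\lambda\in\mathbb{C}$. Then $(A_K,B)$ is exactly controllable in time $T$ for every $T>T_0$.
   Context: Let $H,U$ be Hilbert spaces, $A:D(A)\subset H\to H$ the generator of a $C_0$-semigroup $(S_A(t))_{t\ge 0}$ on $H$, and $B\in\mathcal{L}(U,D(A^* )')$, where $D(A^* )$ carries the graph norm and $D(A^* )'$ is its dual with respect to the pivot space $H$ (so $D(A^* )\subset H\subset D(A^* )'$, and $S_A(t)$ extends to a $C_0$-semigroup on $D(A^* )'$). The adjoint of $B$ is $B^*\in\mathcal{L}(D(A^* ),U)$. For $T\ge 0$ the input map $\Phi_T\in\mathcal{L}(L^2(0,+\infty;U),D(A^* )')$ of $(A,B)$ is $\Phi_T u=\int_0^T S_A(T-s)Bu(s)\,ds$. The operator $B$ is admissible for $A$ if $\mathrm{Im}\,\Phi_T\subset H$ for some (equivalently all) $T>0$; then $\Phi_T\in\mathcal{L}(L^2(0,+\infty;U),H)$.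 For $B$ admissible, the system $\frac{d}{dt}y=Ay+Bu$ on $(0,T)$, $y(0)=y^0\in H$, with $u\in L^2(0,T;U)$, has the unique solution $y\in C^0([0,T];H)$ given by $y(t)=S_A(t)y^0+\Phi_t u$. $(A,B)$ is exactly controllable in time $T>0$ if for every $y^0,y^1\in H$ there is $u\in L^2(0,T;U)$ with $y(T)=y^1$. Note $D(A_K^* )=D(A_0^* )$. *)

theory Defs
  imports "HOL-Analysis.Analysis"
begin

section \<open>Complex Hilbert spaces\<close>

text \<open>
  The inner product is linear in its first and antilinear in its second argument. The underlying
  real Hilbert space carries the real inner product \<open>Re (cinner x y)\<close>, so that the norm, the
  topology and completeness are those of the library classes.
\<close>

class complex_hilbert = real_inner + complete_space +
  fixes scaleC :: "complex \<Rightarrow> 'a \<Rightarrow> 'a"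
    and cinner :: "'a \<Rightarrow> 'a \<Rightarrow> complex"
  assumes scaleC_add_right: "scaleC c (x + y) = scaleC c x + scaleC c y"
    and scaleC_add_left: "scaleC (c + d) x = scaleC c x + scaleC d x"
    and scaleC_scaleC: "scaleC c (scaleC d x) = scaleC (c * d) x"
    and scaleR_scaleC: "scaleR r x = scaleC (complex_of_real r) x"
    and cinner_add_left: "cinner (x + y) z = cinner x z + cinner y z"
    and cinner_scaleC_left: "cinner (scaleC c x) y = c * cinner x y"
    and cinner_commute: "cinner x y = cnj (cinner y x)"
    and Re_cinner: "Re (cinner x y) = inner x y"

lemma cinner_self: "cinner x x = complex_of_real ((norm (x::'a::complex_hilbert))\<^sup>2)"
proof (rule complex_eqI)
  show "Re (cinner x x) = Re (complex_of_real ((norm x)\<^sup>2))"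
    by (simp add: Re_cinner power2_norm_eq_inner)
  have "Im (cinner x x) = Im (cnj (cinner x x))"
    using cinner_commute[of x x] by simp
  then show "Im (cinner x x) = Im (complex_of_real ((norm x)\<^sup>2))"
    by simp
qed

instantiation complex :: complex_hilbert
begin

definition "scaleC_complex c (x::complex) = c * x"
definition "cinner_complex x (y::complex) = x * cnj y"

instance
  by standard
    (auto simp: scaleC_complex_def cinner_complex_def inner_complex_def algebra_simps
      scaleR_conv_of_real)

end

definition bounded_clinear :: "('a::complex_hilbert \<Rightarrow> 'b::complex_hilbert) \<Rightarrow> bool" where
  "bounded_clinear f \<longleftrightarrow>
     bounded_linear f \<and> (\<forall>c x. f (scaleC c x) = scaleC c (f x))"

definition compact_operator :: "('a::complex_hilbert \<Rightarrow> 'b::complex_hilbert) \<Rightarrow> bool" where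
  "compact_operator K \<longleftrightarrow> bounded_clinear K \<and> compact (closure (K ` cball 0 1))"

section \<open>Unbounded operators, adjoints, semigroups\<close>

text \<open>
  An unbounded operator is a partial map: its domain is \<open>dom A\<close>, its value at
  \<open>x \<in> dom A\<close> is \<open>the (A x)\<close>, and equality of operators includes equality of domains.
\<close>

type_synonym ('a, 'b) unbounded_op = "'a \<Rightarrow> 'b option"

definition kernel :: "('a, 'b::zero) unbounded_op \<Rightarrow> 'a set" where
  "kernel A = {x. A x = Some 0}"

text \<open>\<open>A + K\<close> with domain \<open>dom A\<close>.\<close>

definition perturb ::
    "('h, 'h) unbounded_op \<Rightarrow> ('h \<Rightarrow> 'h) \<Rightarrow> ('h::complex_hilbert, 'h) unbounded_op" where
  "perturb A K = (\<lambda>x. map_option (\<lambda>y. y + K x) (A x))"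

text \<open>\<open>\<lambda> - A\<close> with domain \<open>dom A\<close>.\<close>

definition shifted :: "complex \<Rightarrow> ('h, 'h) unbounded_op \<Rightarrow> ('h::complex_hilbert, 'h) unbounded_op" where
  "shifted l A = (\<lambda>x. map_option (\<lambda>y. scaleC l x - y) (A x))"

text \<open>The vector \<open>y\<close> below is unique when \<open>dom A\<close> is dense, as for semigroup generators.\<close>

definition adjoint_op ::
    "('h, 'h) unbounded_op \<Rightarrow> ('h::complex_hilbert, 'h) unbounded_op" where
  "adjoint_op A = (\<lambda>f.
     if \<exists>y. \<forall>x\<in>dom A. cinner (the (A x)) f = cinner x y
     then Some (THE y. \<forall>x\<in>dom A. cinner (the (A x)) f = cinner x y)
     else None)"

definition bounded_adjoint :: "('h \<Rightarrow> 'h) \<Rightarrow> 'h \<Rightarrow> 'h::complex_hilbert" where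
  "bounded_adjoint S = (\<lambda>f. THE y. \<forall>x. cinner (S x) f = cinner x y)"

text \<open>Only the values at times \<open>t \<ge> 0\<close> are meaningful.\<close>

definition C0_semigroup :: "(real \<Rightarrow> 'h \<Rightarrow> 'h::complex_hilbert) \<Rightarrow> bool" where
  "C0_semigroup S \<longleftrightarrow>
     (\<forall>t\<ge>0. bounded_clinear (S t)) \<and>
     (\<forall>x. S 0 x = x) \<and>
     (\<forall>s\<ge>0. \<forall>t\<ge>0. \<forall>x. S (s + t) x = S s (S t x)) \<and>
     (\<forall>x. ((\<lambda>t. S t x) \<longlongrightarrow> x) (at_right 0))"

definition generator ::
    "(real \<Rightarrow> 'h \<Rightarrow> 'h) \<Rightarrow> ('h::complex_hilbert, 'h) unbounded_op" where
  "generator S = (\<lambda>x.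
     if \<exists>y. ((\<lambda>t. (S t x - x) /\<^sub>R t) \<longlongrightarrow> y) (at_right 0)
     then Some (Lim (at_right 0) (\<lambda>t. (S t x - x) /\<^sub>R t))
     else None)"

definition generates_C0_semigroup :: "('h::complex_hilbert, 'h) unbounded_op \<Rightarrow> bool" where
  "generates_C0_semigroup A \<longleftrightarrow> (\<exists>S. C0_semigroup S \<and> generator S = A)"

text \<open>The semigroup \<open>S\<^sub>A\<close>; a generator determines it uniquely at all times \<open>t \<ge> 0\<close>.\<close>

definition semigroup_of ::
    "('h::complex_hilbert, 'h) unbounded_op \<Rightarrow> real \<Rightarrow> 'h \<Rightarrow> 'h" where
  "semigroup_of A = (SOME S. C0_semigroup S \<and> generator S = A)"

section \<open>The dual of \<open>D(A\<^sup>*)\<close> with respect to the pivot space\<close>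

text \<open>
  The elements of \<open>D(A\<^sup>*)'\<close> are the \<^emph>\<open>antilinear\<close> functionals on \<open>D(A\<^sup>*)\<close> that are bounded for the
  graph norm, extended by \<open>0\<close> outside \<open>D(A\<^sup>*)\<close> so that each has exactly one representation as a
  HOL function. With antilinear functionals, the embedding of the pivot space is linear.
\<close>

definition graph_norm :: "('h::complex_hilbert, 'h) unbounded_op \<Rightarrow> 'h \<Rightarrow> real" where
  "graph_norm A x = sqrt ((norm x)\<^sup>2 + (norm (the (A x)))\<^sup>2)"

definition dual_adjoint_domain ::
    "('h::complex_hilbert, 'h) unbounded_op \<Rightarrow> ('h \<Rightarrow> complex) set" where
  "dual_adjoint_domain A = {f.
     (\<forall>x\<in>dom (adjoint_op A). \<forall>y\<in>dom (adjoint_op A). f (x + y) = f x + f y) \<and>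
     (\<forall>c. \<forall>x\<in>dom (adjoint_op A). f (scaleC c x) = cnj c * f x) \<and>
     (\<exists>C. \<forall>x\<in>dom (adjoint_op A). cmod (f x) \<le> C * graph_norm (adjoint_op A) x) \<and>
     (\<forall>x. x \<notin> dom (adjoint_op A) \<longrightarrow> f x = 0)}"

definition pivot_embed ::
    "('h::complex_hilbert, 'h) unbounded_op \<Rightarrow> 'h \<Rightarrow> ('h \<Rightarrow> complex)" where
  "pivot_embed A h = (\<lambda>x. if x \<in> dom (adjoint_op A) then cinner h x else 0)"

text \<open>
  The extension of \<open>S\<^sub>A(t)\<close> to \<open>D(A\<^sup>*)'\<close>, given by \<open>\<langle>S\<^sub>A(t) f, x\<rangle> = \<langle>f, S\<^sub>A(t)\<^sup>* x\<rangle>\<close>.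
\<close>

definition semigroup_ext ::
    "('h::complex_hilbert, 'h) unbounded_op \<Rightarrow> real \<Rightarrow> ('h \<Rightarrow> complex) \<Rightarrow> ('h \<Rightarrow> complex)" where
  "semigroup_ext A t f =
     (\<lambda>x. if x \<in> dom (adjoint_op A) then f (bounded_adjoint (semigroup_of A t) x) else 0)"

text \<open>\<open>B \<in> \<L>(U, D(A\<^sup>*)')\<close>.\<close>

definition control_operator ::
    "('h::complex_hilbert, 'h) unbounded_op \<Rightarrow> ('u::complex_hilbert \<Rightarrow> ('h \<Rightarrow> complex)) \<Rightarrow> bool" where
  "control_operator A B \<longleftrightarrow>
     (\<forall>v. B v \<in> dual_adjoint_domain A) \<and>
     (\<forall>v w x. B (v + w) x = B v x + B w x) \<and>
     (\<forall>c v x. B (scaleC c v) x = c * B v x) \<and>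
     (\<exists>C. \<forall>v. \<forall>x\<in>dom (adjoint_op A). cmod (B v x) \<le> C * norm v * graph_norm (adjoint_op A) x)"

text \<open>\<open>B\<^sup>* \<in> \<L>(D(A\<^sup>*), U)\<close>, given by \<open>\<langle>B v, x\<rangle> = \<langle>v, B\<^sup>* x\<rangle>\<close> for all \<open>v\<close> in \<open>U\<close>.\<close>

definition control_adjoint ::
    "('h::complex_hilbert, 'h) unbounded_op \<Rightarrow> ('u::complex_hilbert \<Rightarrow> ('h \<Rightarrow> complex)) \<Rightarrow>
     ('h, 'u) unbounded_op" where
  "control_adjoint A B = (\<lambda>x.
     if x \<in> dom (adjoint_op A) then Some (THE w. \<forall>v. B v x = cinner v w) else None)"

section \<open>Controls, input map, controllability\<close>

text \<open>
  Strong (Bochner) measurability is spelled out because the spaces are not assumed separable, while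
  the library's Bochner integral needs a second-countable codomain.
\<close>

definition strongly_measurable_on :: "real set \<Rightarrow> (real \<Rightarrow> 'u::real_normed_vector) \<Rightarrow> bool" where
  "strongly_measurable_on I u \<longleftrightarrow>
     (\<exists>s. (\<forall>n::nat. simple_function (lebesgue_on I) (s n)) \<and>
          (AE t in lebesgue_on I. (\<lambda>n. s n t) \<longlonglongrightarrow> u t))"

definition L2 :: "real set \<Rightarrow> (real \<Rightarrow> 'u::real_normed_vector) set" where
  "L2 I = {u. strongly_measurable_on I u \<and> integrable (lebesgue_on I) (\<lambda>t. (norm (u t))\<^sup>2)}"

text \<open>
  \<open>\<Phi>\<^sub>T u = \<integral>\<^sub>0\<^sup>T S\<^sub>A(T - s) B u(s) ds\<close> as an element of \<open>D(A\<^sup>*)'\<close>. The integral of a function with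
  values in this dual space is the functional that sends \<open>x \<in> D(A\<^sup>*)\<close> to the integral of the
  pairings of the integrand with \<open>x\<close>.
\<close>

definition input_map ::
    "('h::complex_hilbert, 'h) unbounded_op \<Rightarrow> ('u::complex_hilbert \<Rightarrow> ('h \<Rightarrow> complex)) \<Rightarrow>
     real \<Rightarrow> (real \<Rightarrow> 'u) \<Rightarrow> ('h \<Rightarrow> complex)" where
  "input_map A B T u =
     (\<lambda>x. integral\<^sup>L (lebesgue_on {0..T}) (\<lambda>s. semigroup_ext A (T - s) (B (u s)) x))"

definition admissible ::
    "('h::complex_hilbert, 'h) unbounded_op \<Rightarrow> ('u::complex_hilbert \<Rightarrow> ('h \<Rightarrow> complex)) \<Rightarrow> bool" where
  "admissible A B \<longleftrightarrow> (\<exists>T>0. input_map A B T ` L2 {0..} \<subseteq> range (pivot_embed A))"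

text \<open>
  The solution \<open>y(t) = S\<^sub>A(t) y\<^sup>0 + \<Phi>\<^sub>t u\<close>, where for admissible \<open>B\<close> the functional \<open>\<Phi>\<^sub>t u\<close> is identified
  with the unique element of \<open>H\<close> representing it.
\<close>

definition solution ::
    "('h::complex_hilbert, 'h) unbounded_op \<Rightarrow> ('u::complex_hilbert \<Rightarrow> ('h \<Rightarrow> complex)) \<Rightarrow>
     'h \<Rightarrow> (real \<Rightarrow> 'u) \<Rightarrow> real \<Rightarrow> 'h" where
  "solution A B y0 u t =
     semigroup_of A t y0 + (THE h. pivot_embed A h = input_map A B t u)"

definition exactly_controllable ::
    "('h::complex_hilbert, 'h) unbounded_op \<Rightarrow> ('u::complex_hilbert \<Rightarrow> ('h \<Rightarrow> complex)) \<Rightarrow>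
     real \<Rightarrow> bool" where
  "exactly_controllable A B T \<longleftrightarrow>
     (\<forall>y0 y1. \<exists>u\<in>L2 {0..T}. solution A B y0 u T = y1)"

definition fattorini_hautus ::
    "('h::complex_hilbert, 'h) unbounded_op \<Rightarrow> ('u::complex_hilbert \<Rightarrow> ('h \<Rightarrow> complex)) \<Rightarrow> bool" where
  "fattorini_hautus A B \<longleftrightarrow>
     (\<forall>l. kernel (shifted l (adjoint_op A)) \<inter> kernel (control_adjoint A B) = {0})"

end

theory Submission
  imports Defs "HOL-Library.Diagonal_Subsequence"
    "HOL-Computational_Algebra.Fundamental_Theorem_Algebra"
begin

text \<open>
  Everything is transferred to the adjoint semigroup, whose generator is \<open>A\<^sup>*\<close>, observed through
  \<open>B\<^sup>*\<close>. Admissibility becomes \<open>\<integral>\<^sub>0\<^sup>T \<parallel>B\<^sup>* S(t)\<^sup>* x\<parallel>\<^sup>2 dt \<le> m \<parallel>x\<parallel>\<^sup>2\<close> on \<open>D(A\<^sup>*)\<close>, by the uniform boundedness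
  principle, and exact controllability becomes the reverse inequality, by uniform boundedness in
  one direction and by minimising a quadratic functional in the other. The Duhamel formula bounds
  the difference between the outputs of the perturbed and the unperturbed system in \<open>L\<^sup>2\<close> by the
  \<open>L\<^sup>2\<close> norm of \<open>K\<^sup>* S\<^sub>K(t)\<^sup>* x\<close>, so that the perturbed system satisfies the observability inequality
  in time \<open>T\<^sub>0\<close> up to a compact term. Its unobservable subspaces \<open>N(T)\<close>, \<open>T \<ge> T\<^sub>0\<close>, therefore have a compact
  unit ball and decrease with \<open>T\<close>, so that \<open>N(a) = N(b)\<close> for some \<open>a < b\<close> in any given interval. Such a
  space is finite dimensional and invariant under the semigroup; if it were nonzero, it would
  contain an eigenvector of \<open>A\<^sub>K\<^sup>*\<close> in the kernel of \<open>B\<^sup>*\<close>, contrary to the Fattorini-Hautus test.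
  Once \<open>N(T) = {0}\<close>, compactness removes the compact term.
\<close>

section \<open>Complex Hilbert spaces\<close>

text \<open>Outputs \<open>C (S t x)\<close> exist only for \<open>x\<close> in the domain, so every
  estimate is stated there, in terms of \<open>energy\<close>, the integral of the squared norm of a
  continuous function; the output map is never extended to the whole space. The domain is not
  complete for the seminorms that arise, and this shapes the functional analysis: Riesz representers
  and uniform boundedness are formulated with sequences, and a control, the L2 limit of outputs,
  takes the place of the missing limit.

  In the Duhamel formula the unperturbed semigroup stands outside and the perturbed orbit inside.
  Admissibility of the former controls the output, while the remainder involves the orbit of the
  very semigroup whose observability is wanted.

  The strict inequality \<open>T > T0\<close> leaves room for a gap \<open>a < b\<close> between
  equal unobservable spaces: the semigroup maps \<open>N(b)\<close> into \<open>N(b - t)\<close>,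
  which lies in \<open>N(a) = N(b)\<close> for \<open>t \<le> b - a\<close>.

  The spaces may be nonseparable, so controls are integrated only through scalar pairings, and
  vector-valued integrals are gauge integrals of continuous functions.\<close>

instance complex_hilbert \<subseteq> banach ..

lemma scaleC_zero_left [simp]: "scaleC 0 x = 0"
  using scaleR_scaleC[of 0 x] by simp

lemma scaleC_zero_right [simp]: "scaleC c 0 = 0"
  using scaleC_add_right[of c 0 0] by simp

lemma scaleC_minus_right: "scaleC c (- x) = - scaleC c x"
  using scaleC_add_right[of c x "- x"] by (simp add: eq_neg_iff_add_eq_0 add.commute)

lemma scaleC_diff_right: "scaleC c (x - y) = scaleC c x - scaleC c y"
  using scaleC_add_right[of c x "- y"] by (simp add: scaleC_minus_right)

lemma scaleC_scaleR: "scaleC c (r *\<^sub>R x) = r *\<^sub>R scaleC c x"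
  by (simp add: scaleR_scaleC scaleC_scaleC mult.commute)

lemma cinner_add_right: "cinner x (y + z) = cinner x y + cinner x z"
  by (metis cinner_add_left cinner_commute complex_cnj_add)

lemma cinner_scaleC_right: "cinner x (scaleC c y) = cnj c * cinner x y"
  by (metis cinner_scaleC_left cinner_commute complex_cnj_mult)

lemma norm_scaleC: "norm (scaleC c x) = cmod c * norm x"
proof -
  have "complex_of_real ((norm (scaleC c x))\<^sup>2) = cinner (scaleC c x) (scaleC c x)"
    by (simp add: cinner_self)
  also have "\<dots> = (c * cnj c) * cinner x x"
    by (simp add: cinner_scaleC_left cinner_scaleC_right)
  also have "\<dots> = complex_of_real ((cmod c * norm x)\<^sup>2)"
    unfolding complex_norm_square[symmetric] cinner_self by (simp add: power_mult_distrib)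
  finally have "(norm (scaleC c x))\<^sup>2 = (cmod c * norm x)\<^sup>2"
    using of_real_eq_iff by blast
  then show ?thesis by simp
qed

lemma bounded_linear_scaleC: "bounded_linear (scaleC c)"
  by (rule bounded_linear_intro[where K="cmod c"])
    (auto simp: scaleC_add_right scaleC_scaleR norm_scaleC)

text \<open>Multiplying \<open>x\<close> by a unimodular scalar makes the inner product real and
  nonnegative, and the real Cauchy-Schwarz inequality applies to the rotated vector.\<close>

lemma norm_cinner_le: "cmod (cinner x y) \<le> norm x * norm y"
proof (cases "cinner x y = 0")
  case False
  let ?c = "cnj (sgn (cinner x y))"
  have "cnj (sgn z) * z = of_real (cmod z)" if "z \<noteq> 0" for z
    using that complex_norm_square[of z]
    by (simp add: sgn_div_norm field_simps power2_eq_square scaleR_conv_of_real)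
  then have "cmod (cinner x y) = Re (?c * cinner x y)"
    using False by simp
  also have "\<dots> = inner (scaleC ?c x) y"
    by (simp add: cinner_scaleC_left flip: Re_cinner)
  also have "\<dots> \<le> norm (scaleC ?c x) * norm y"
    by (rule norm_cauchy_schwarz)
  also have "\<dots> = norm x * norm y"
    using False by (simp add: norm_scaleC norm_sgn)
  finally show ?thesis .
qed simp

interpretation cinner: bounded_bilinear cinner
proof
  show "\<exists>K. \<forall>a b. cmod (cinner a b) \<le> norm a * norm b * K"
    by (intro exI[of _ 1]) (simp add: norm_cinner_le)
qed (simp_all add: cinner_add_left cinner_add_right scaleR_scaleC cinner_scaleC_left
    cinner_scaleC_right scaleC_complex_def)

lemma Im_cinner: "Im (cinner x y) = inner x (scaleC \<i> y)"
  by (simp add: cinner_scaleC_right flip: Re_cinner)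

lemma cinner_eqI: "(\<And>x. cinner x y = cinner x z) \<Longrightarrow> y = z"
  by (metis Re_cinner inner_commute vector_eq_rdot)

lemma bounded_clinearD:
  assumes "bounded_clinear f"
  shows "bounded_linear f" "f (scaleC c x) = scaleC c (f x)"
  using assms by (auto simp: bounded_clinear_def)


section \<open>Semi-inner products, the Riesz theorem and uniform boundedness\<close>

text \<open>The form is only semidefinite and its domain a mere subspace, because the locale serves
  for \<open>inner\<close> and for the Gramian form of the outputs on \<open>Da\<close>, for which
  neither definiteness nor completeness is at hand.\<close>

locale semi_inner =
  fixes D :: "'a::real_vector set" and b :: "'a \<Rightarrow> 'a \<Rightarrow> real"
  assumes sub: "subspace D"
    and sym: "\<lbrakk>x \<in> D; y \<in> D\<rbrakk> \<Longrightarrow> b x y = b y x"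
    and add: "\<lbrakk>x \<in> D; y \<in> D; z \<in> D\<rbrakk> \<Longrightarrow> b (x + y) z = b x z + b y z"
    and scale: "\<lbrakk>x \<in> D; z \<in> D\<rbrakk> \<Longrightarrow> b (r *\<^sub>R x) z = r * b x z"
    and pos: "x \<in> D \<Longrightarrow> 0 \<le> b x x"
begin

lemma diff: "\<lbrakk>x \<in> D; y \<in> D; z \<in> D\<rbrakk> \<Longrightarrow> b (x - y) z = b x z - b y z"
  using add[of x "- 1 *\<^sub>R y" z] scale[of y z "- 1"] subspace_scale[OF sub, of y "- 1"] by simp

lemma quadratic_expansion:
  assumes "x \<in> D" "w \<in> D"
  shows "b (x + t *\<^sub>R w) (x + t *\<^sub>R w) = b x x + 2 * t * b x w + t\<^sup>2 * b w w"
proof -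
  have tw: "t *\<^sub>R w \<in> D" "x + t *\<^sub>R w \<in> D"
    using assms sub subspace_scale subspace_add by blast+
  have *: "b y (x + t *\<^sub>R w) = b y x + t * b y w" if "y \<in> D" for y
    using that assms tw add[of x "t *\<^sub>R w" y] scale[of w y t] sym[of y] by simp
  show ?thesis
    using assms tw *[of x] *[of w] add[of x "t *\<^sub>R w" "x + t *\<^sub>R w"] scale[of w "x + t *\<^sub>R w" t]
      sym[of w x] by (simp add: algebra_simps power2_eq_square)
qed

text \<open>A quadratic polynomial in \<open>t\<close> that stays above \<open>- e\<close> has
  nonpositive discriminant; its value at the minimiser \<open>- \<beta> / q\<close> says so. For
  \<open>q = 0\<close> the polynomial is linear, hence bounded below only if
  \<open>\<beta> = 0\<close>.\<close>

lemma quadratic_bound: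
  fixes \<beta> q e :: real
  assumes "0 \<le> q" "\<And>t. t * \<beta> + t\<^sup>2 / 2 * q \<ge> - e"
  shows "\<beta>\<^sup>2 \<le> 2 * e * q"
proof (cases "q = 0")
  case True
  have "\<beta> = 0"
  proof (rule ccontr)
    assume "\<beta> \<noteq> 0"
    then show False
      using assms(2)[of "- (e + 1) / \<beta>"] True by simp
  qed
  then show ?thesis using True by simp
next
  case False
  then have "q > 0" using assms(1) by simp
  have "- e \<le> (- \<beta> / q) * \<beta> + (- \<beta> / q)\<^sup>2 / 2 * q"
    by (rule assms(2))
  also have "\<dots> = - (\<beta>\<^sup>2 / (2 * q))"
    using \<open>q > 0\<close> by (simp add: field_simps power2_eq_square)
  finally show ?thesis
    using \<open>q > 0\<close> by (simp add: field_simps)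
qed

lemma Cauchy_Schwarz:
  assumes "x \<in> D" "y \<in> D"
  shows "(b x y)\<^sup>2 \<le> b x x * b y y"
proof -
  have "t * b x y + t\<^sup>2 / 2 * b y y \<ge> - (b x x / 2)" for t
    using quadratic_expansion[OF assms, of t] pos[of "x + t *\<^sub>R y"] assms sub
    by (simp add: subspace_add subspace_scale)
  from quadratic_bound[OF pos[OF assms(2)] this] show ?thesis by simp
qed

text \<open>The sequence minimises \<open>b x x / 2 - f x\<close>; since \<open>D\<close> need not be complete for \<open>b\<close>, it
  represents \<open>f\<close> only in the limit.\<close>

lemma riesz_sequence:
  assumes f_add: "\<And>x y. x \<in> D \<Longrightarrow> y \<in> D \<Longrightarrow> f (x + y) = f x + f y"
    and f_scale: "\<And>r x. x \<in> D \<Longrightarrow> f (r *\<^sub>R x) = r * f x"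
    and bound: "\<And>x. x \<in> D \<Longrightarrow> (f x)\<^sup>2 \<le> C * b x x"
  obtains x where "\<And>n. x n \<in> D"
    and "\<And>n w. w \<in> D \<Longrightarrow> \<bar>b (x n) w - f w\<bar> \<le> (1/2)^n * sqrt (b w w)"
proof -
  define J where "J x = b x x / 2 - f x" for x
  have am_gm: "s * t \<le> ((s + t) / 2)\<^sup>2" for s t :: real
    using zero_le_power2[of "s - t"] by (simp add: power2_eq_square field_simps)
  have J_ge: "- (\<bar>C\<bar> / 2) \<le> J x" if "x \<in> D" for x
  proof -
    have "(f x)\<^sup>2 \<le> \<bar>C\<bar> * b x x"
      using bound[OF that] pos[OF that] by (meson abs_ge_self mult_right_mono order_trans)
    also have "\<dots> \<le> ((\<bar>C\<bar> + b x x) / 2)\<^sup>2"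
      using am_gm .
    finally have "f x \<le> (\<bar>C\<bar> + b x x) / 2"
      by (rule power2_le_imp_le) (use pos[OF that] in simp)
    then show ?thesis by (simp add: J_def field_simps)
  qed
  have bdd: "bdd_below (J ` D)"
    using J_ge by (intro bdd_belowI2) auto
  define d where "d = Inf (J ` D)"
  have "0 \<in> D" using sub subspace_0 by blast
  \<comment> \<open>The tolerance is chosen so that \<open>quadratic_bound\<close> with
    \<open>e = (1/4)^n / 2\<close> leaves the factor \<open>(1/2)^n\<close> after taking a square
    root.\<close>
  have "\<exists>x\<in>D. J x < d + (1/4)^n / 2" for n
  proof -
    have "Inf (J ` D) < d + (1/4)^n / 2" by (simp add: d_def)
    then show ?thesis
      using \<open>0 \<in> D\<close> bdd by (subst (asm) cInf_less_iff) auto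
  qed
  then obtain x where x: "\<And>n. x n \<in> D" "\<And>n. J (x n) < d + (1/4)^n / 2"
    by metis
  have "\<bar>b (x n) w - f w\<bar> \<le> (1/2)^n * sqrt (b w w)" if w: "w \<in> D" for n w
  proof -
    have "t * (b (x n) w - f w) + t\<^sup>2 / 2 * b w w \<ge> - ((1/4)^n / 2)" for t
    proof -
      have tw: "t *\<^sub>R w \<in> D" "x n + t *\<^sub>R w \<in> D"
        using w x sub subspace_scale subspace_add by blast+
      have "d \<le> J (x n + t *\<^sub>R w)"
        unfolding d_def using bdd tw by (intro cInf_lower) auto
      also have "\<dots> = J (x n) + (t * (b (x n) w - f w) + t\<^sup>2 / 2 * b w w)"
        using quadratic_expansion[OF x(1) w, of n t] f_add[OF x(1) tw(1)] f_scale[OF w]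
        by (simp add: J_def algebra_simps)
      finally show ?thesis using x(2)[of n] by linarith
    qed
    from quadratic_bound[OF pos[OF w] this]
    have "(b (x n) w - f w)\<^sup>2 \<le> (1/4)^n * b w w" by simp
    then have "sqrt ((b (x n) w - f w)\<^sup>2) \<le> sqrt ((1/4)^n * b w w)"
      using real_sqrt_le_iff by blast
    moreover have "sqrt ((1/4)^n) = (1/2)^n"
      by (simp add: real_sqrt_power real_sqrt_divide)
    ultimately show ?thesis by (simp add: real_sqrt_mult)
  qed
  then show ?thesis using that x(1) by blast
qed

text \<open>The approximate representation is tested with the difference \<open>x n - x m\<close>
  itself, and one factor of its seminorm cancels.\<close>

lemma riesz_sequence_Cauchy:
  assumes x: "\<And>n. x n \<in> D" "\<And>n w. w \<in> D \<Longrightarrow> \<bar>b (x n) w - f w\<bar> \<le> (1/2)^n * sqrt (b w w)"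
  shows "sqrt (b (x n - x m) (x n - x m)) \<le> (1/2)^n + (1/2)^m"
proof -
  let ?w = "x n - x m"
  have w: "?w \<in> D" using x(1) sub subspace_diff by blast
  let ?s = "sqrt (b ?w ?w)"
  have "?s * ?s = b (x n) ?w - b (x m) ?w"
    using pos[OF w] diff[OF x(1) x(1) w, of n m] by simp
  also have "\<dots> \<le> ((1/2)^n + (1/2)^m) * ?s"
    using x(2)[OF w, of n] x(2)[OF w, of m] by (simp add: algebra_simps)
  finally have "?s * ?s \<le> ((1/2)^n + (1/2)^m) * ?s" .
  then show ?thesis
  proof (cases "?s = 0")
    case False
    then have "?s > 0" using pos[OF w] by simp
    with \<open>?s * ?s \<le> ((1/2)^n + (1/2)^m) * ?s\<close> show ?thesis
      by (rule mult_right_le_imp_le)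
  qed simp
qed

end

lemma semi_inner_inner: "subspace D \<Longrightarrow> semi_inner D inner"
  by unfold_locales (auto simp: inner_commute inner_add_right)

text \<open>For the norm, the approximate representers form a Cauchy sequence in the complete
  ambient space, and the limit lies in \<open>closure D\<close>. Locating the representer there is
  what yields a projection theorem for subspaces that are not closed.\<close>

lemma riesz_on_subspace:
  fixes f :: "'a::{real_inner,banach} \<Rightarrow> real"
  assumes D: "subspace D"
    and "\<And>x y. x \<in> D \<Longrightarrow> y \<in> D \<Longrightarrow> f (x + y) = f x + f y"
    and "\<And>r x. x \<in> D \<Longrightarrow> f (r *\<^sub>R x) = r * f x"
    and bound: "\<And>x. x \<in> D \<Longrightarrow> \<bar>f x\<bar> \<le> C * norm x"
  shows "\<exists>h\<in>closure D. \<forall>w\<in>D. inner h w = f w"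
proof -
  interpret semi_inner D inner by (rule semi_inner_inner[OF D])
  have "(f x)\<^sup>2 \<le> C\<^sup>2 * inner x x" if "x \<in> D" for x
    using power_mono[OF bound[OF that] abs_ge_zero, of 2]
    by (simp add: power_mult_distrib power2_norm_eq_inner)
  with riesz_sequence[of f "C\<^sup>2"] assms(2,3)
  obtain x where x: "\<And>n. x n \<in> D"
    "\<And>n w. w \<in> D \<Longrightarrow> \<bar>inner (x n) w - f w\<bar> \<le> (1/2)^n * sqrt (inner w w)"
    by metis
  have xC: "norm (x n - x m) \<le> (1/2)^n + (1/2)^m" for n m
    using riesz_sequence_Cauchy[OF x, of n m] by (simp add: norm_eq_sqrt_inner)
  have "Cauchy x"
  proof (rule metric_CauchyI)
    fix e :: real assume "e > 0"
    then obtain N where N: "(1/2)^N < e / 2"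
      using real_arch_pow_inv[of "e/2" "1/2"] by auto
    have "dist (x m) (x n) < e" if "m \<ge> N" "n \<ge> N" for m n
    proof -
      have "(1/2)^m \<le> (1/2::real)^N" "(1/2)^n \<le> (1/2::real)^N"
        using that by (simp_all add: power_decreasing)
      then show ?thesis
        using xC[of m n] N unfolding dist_norm by linarith
    qed
    then show "\<exists>M. \<forall>m\<ge>M. \<forall>n\<ge>M. dist (x m) (x n) < e" by blast
  qed
  then obtain h where h: "x \<longlonglongrightarrow> h"
    using Cauchy_convergent convergent_def by blast
  have "inner h w = f w" if "w \<in> D" for w
  proof -
    have "(\<lambda>n. (1/2)^n * sqrt (inner w w)) \<longlonglongrightarrow> 0"
      by (intro tendsto_mult_left_zero LIMSEQ_realpow_zero) auto
    then have "(\<lambda>n. inner (x n) w - f w) \<longlonglongrightarrow> 0"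
      by (rule Lim_null_comparison[rotated]) (use x(2)[OF that] in auto)
    moreover have "(\<lambda>n. inner (x n) w - f w) \<longlonglongrightarrow> inner h w - f w"
      by (intro tendsto_intros h)
    ultimately show ?thesis
      using LIMSEQ_unique by fastforce
  qed
  moreover have "h \<in> closure D"
    using h x(1) closure_sequential by blast
  ultimately show ?thesis by blast
qed

text \<open>The projection is the representer of \<open>inner y\<close> on \<open>D\<close>.\<close>

lemma projection_exists:
  fixes y :: "'a::{real_inner,banach}"
  assumes "subspace D"
  shows "\<exists>p\<in>closure D. \<forall>w\<in>D. inner (y - p) w = 0"
proof -
  have "\<exists>h\<in>closure D. \<forall>w\<in>D. inner h w = inner y w"
    by (rule riesz_on_subspace[OF assms, where C="norm y"])
      (auto simp: inner_add_right Cauchy_Schwarz_ineq2)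
  then show ?thesis by (metis eq_iff_diff_eq_0 inner_diff_left)
qed

lemma orthogonal_closure:
  fixes z :: "'a::real_inner"
  assumes "\<And>w. w \<in> D \<Longrightarrow> inner z w = 0" "p \<in> closure D"
  shows "inner z p = 0"
proof -
  have "closed {p. inner z p = 0}"
    by (intro closed_Collect_eq continuous_intros)
  then have "closure D \<subseteq> {p. inner z p = 0}"
    using assms by (intro closure_minimal) auto
  then show ?thesis using assms by blast
qed

lemma dense_subspaceI:
  fixes D :: "'a::{real_inner,banach} set"
  assumes "subspace D" "\<And>z. (\<And>x. x \<in> D \<Longrightarrow> inner z x = 0) \<Longrightarrow> z = 0"
  shows "closure D = UNIV"
proof -
  have "y \<in> closure D" for y
  proof -
    obtain p where "p \<in> closure D" "\<forall>w\<in>D. inner (y - p) w = 0"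
      using projection_exists[OF assms(1)] by blast
    then show ?thesis using assms(2)[of "y - p"] by auto
  qed
  then show ?thesis by blast
qed

text \<open>An antilinear functional is determined by its real part, since the real part of its
  value at \<open>scaleC \<i> x\<close> is the imaginary part of its value at \<open>x\<close>; so a
  real representation on \<open>D\<close> suffices.\<close>

lemma cinner_representation:
  fixes f :: "'h::complex_hilbert \<Rightarrow> complex"
  assumes "subspace D" and D: "\<And>c x. x \<in> D \<Longrightarrow> scaleC c x \<in> D"
    and add: "\<And>x y. x \<in> D \<Longrightarrow> y \<in> D \<Longrightarrow> f (x + y) = f x + f y"
    and scale: "\<And>c x. x \<in> D \<Longrightarrow> f (scaleC c x) = cnj c * f x"
    and bound: "\<And>x. x \<in> D \<Longrightarrow> cmod (f x) \<le> C * norm x"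
  shows "\<exists>h. \<forall>x\<in>D. f x = cinner h x"
proof -
  have "\<exists>h\<in>closure D. \<forall>w\<in>D. inner h w = Re (f w)"
  proof (rule riesz_on_subspace[OF assms(1)])
    show "Re (f (r *\<^sub>R x)) = r * Re (f x)" if "x \<in> D" for r x
      using scale[OF that, of r] by (simp add: scaleR_scaleC)
    show "\<bar>Re (f x)\<bar> \<le> C * norm x" if "x \<in> D" for x
      using bound[OF that] abs_Re_le_cmod order_trans by blast
  qed (simp add: add)
  then obtain h where h: "\<And>w. w \<in> D \<Longrightarrow> inner h w = Re (f w)" by blast
  have "f x = cinner h x" if "x \<in> D" for x
    using h[OF that] h[OF D[OF that, of \<i>]] scale[OF that, of \<i>]
    by (intro complex_eqI) (simp_all add: Re_cinner Im_cinner)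
  then show ?thesis by blast
qed

lemma riesz_representation:
  fixes f :: "'h::complex_hilbert \<Rightarrow> complex"
  assumes "bounded_clinear f"
  shows "\<exists>y. \<forall>x. f x = cinner x y"
proof -
  have lin: "bounded_linear f" and sc: "\<And>c x. f (scaleC c x) = c * f x"
    using assms by (auto simp: bounded_clinear_def scaleC_complex_def)
  obtain C where C: "\<And>x. cmod (f x) \<le> norm x * C"
    using bounded_linear.bounded[OF lin] by blast
  have "\<exists>h. \<forall>x\<in>UNIV. cnj (f x) = cinner h x"
  proof (rule cinner_representation)
    show "cmod (cnj (f x)) \<le> C * norm x" for x using C[of x] by (simp add: mult.commute)
    show "cnj (f (x + y)) = cnj (f x) + cnj (f y)" for x y
      using bounded_linear.linear[OF lin] by (simp add: linear_add)
  qed (auto simp: sc)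
  then show ?thesis by (metis cinner_commute complex_cnj_cnj UNIV_I)
qed

text \<open>This is Sokal's proof of the uniform boundedness principle. Completeness enters only through
  the last assumption, so that the lemma also applies to \<open>p\<close>-Cauchy sequences whose limits lie
  outside \<open>D\<close>.\<close>

lemma uniform_boundedness_seminorms:
  fixes p :: "'a::real_vector \<Rightarrow> real" and F :: "('a \<Rightarrow> real) set"
  assumes D: "subspace D"
    and p_nonneg: "\<And>x. x \<in> D \<Longrightarrow> 0 \<le> p x"
    and p_scale: "\<And>r x. x \<in> D \<Longrightarrow> p (r *\<^sub>R x) = \<bar>r\<bar> * p x"
    and F_add: "\<And>f x y. \<lbrakk>f \<in> F; x \<in> D; y \<in> D\<rbrakk> \<Longrightarrow> f (x + y) \<le> f x + f y"
    and F_scale: "\<And>f r x. \<lbrakk>f \<in> F; x \<in> D\<rbrakk> \<Longrightarrow> f (r *\<^sub>R x) = \<bar>r\<bar> * f x"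
    and F_bound: "\<And>f. f \<in> F \<Longrightarrow> \<exists>c. \<forall>x\<in>D. f x \<le> c * p x"
    and Cauchy: "\<And>z. \<lbrakk>\<And>n. z n \<in> D; \<And>n. p (z (Suc n) - z n) \<le> (1/3)^n\<rbrakk> \<Longrightarrow>
      \<exists>M. \<forall>f\<in>F. \<forall>\<^sub>F n in sequentially. f (z n) \<le> M"
  shows "\<exists>M. \<forall>f\<in>F. \<forall>x\<in>D. f x \<le> M * p x"
proof (rule ccontr)
  assume contra: "\<not> ?thesis"
  \<comment> \<open>\<open>L f\<close> is the operator norm of \<open>f\<close> relative to
    \<open>p\<close>. A common bound for it would prove the claim, so it exceeds any prescribed
    number for some \<open>f\<close>.\<close>
  define L where "L f = Inf {c. 0 \<le> c \<and> (\<forall>x\<in>D. f x \<le> c * p x)}" for f :: "'a \<Rightarrow> real"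
  have f_nonneg: "0 \<le> f x" if "f \<in> F" "x \<in> D" for f x
    using F_add[OF that(1) that(2), of "- 1 *\<^sub>R x"] F_scale[OF that, of "- 1"] F_scale[OF that, of 0]
      subspace_scale[OF D that(2), of "- 1"] by simp
  have ne: "{c. 0 \<le> c \<and> (\<forall>x\<in>D. f x \<le> c * p x)} \<noteq> {}" if f: "f \<in> F" for f
  proof -
    obtain c where "\<forall>x\<in>D. f x \<le> c * p x" using F_bound[OF f] by blast
    then have "\<forall>x\<in>D. f x \<le> \<bar>c\<bar> * p x"
      using p_nonneg by (meson abs_ge_self mult_right_mono order_trans)
    then show ?thesis by (auto intro: exI[of _ "\<bar>c\<bar>"])
  qed
  have L_nonneg: "0 \<le> L f" if "f \<in> F" for f
    unfolding L_def using ne[OF that] by (intro cInf_greatest) auto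
  have L: "f x \<le> L f * p x" if f: "f \<in> F" "x \<in> D" for f x
  proof (cases "p x = 0")
    case True
    then show ?thesis using F_bound[OF f(1)] f(2) by fastforce
  next
    case False
    then have "p x > 0" using p_nonneg[OF f(2)] by simp
    have "f x / p x \<le> L f"
      unfolding L_def using ne[OF f(1)] f(2) \<open>p x > 0\<close>
      by (intro cInf_greatest) (auto simp: field_simps)
    then show ?thesis using \<open>p x > 0\<close> by (simp add: field_simps)
  qed
  \<comment> \<open>Vectors of size at most \<open>(1/3)^n\<close> on which \<open>f\<close> nearly
    attains its norm. A quarter of \<open>(1/3)^n * L f\<close> will survive all later steps, so the
    growth \<open>n * 4 * 3^n\<close> of the norms leaves at least \<open>n\<close>.\<close>
  have "\<exists>f x. f \<in> F \<and> x \<in> D \<and> p x \<le> (1/3)^n \<and> 3/4 * (1/3)^n * L f \<le> f x \<and> real n * 4 * 3^n \<le> L f"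
    for n
  proof -
    obtain f where f: "f \<in> F" "L f > real n * 4 * 3^n"
    proof (rule ccontr)
      assume "\<not> thesis"
      then have "\<And>f. f \<in> F \<Longrightarrow> L f \<le> real n * 4 * 3^n" using that by force
      then have "\<forall>f\<in>F. \<forall>x\<in>D. f x \<le> (real n * 4 * 3^n) * p x"
        using L p_nonneg by (meson mult_right_mono order_trans)
      then show False using contra by blast
    qed
    have Lpos: "L f > 0" using f(2) by (rule le_less_trans[rotated]) simp
    have "\<not> (\<forall>x\<in>D. f x \<le> 3/4 * L f * p x)"
    proof
      assume "\<forall>x\<in>D. f x \<le> 3/4 * L f * p x"
      then have "L f \<le> 3/4 * L f"
        using Lpos unfolding L_def[of f] by (intro cInf_lower) (auto simp flip: L_def)
      then show False using Lpos by simp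
    qed
    then obtain x where x: "x \<in> D" "f x > 3/4 * L f * p x" by force
    have "p x \<noteq> 0" using x L[OF f(1) x(1)] by auto
    then have px: "p x > 0" using p_nonneg[OF x(1)] by simp
    let ?r = "(1/3)^n / p x"
    have "?r *\<^sub>R x \<in> D" using x(1) D subspace_scale by blast
    moreover have "p (?r *\<^sub>R x) \<le> (1/3)^n" using p_scale[OF x(1)] px by simp
    moreover have "3/4 * (1/3)^n * L f \<le> f (?r *\<^sub>R x)"
    proof -
      have "3/4 * (1/3)^n * L f = ?r * (3/4 * L f * p x)" using px by simp
      also have "\<dots> \<le> ?r * f x"
        using x(2) px by (intro mult_left_mono) auto
      also have "\<dots> = f (?r *\<^sub>R x)" using F_scale[OF f(1) x(1), of ?r] px by simp
      finally show ?thesis .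
    qed
    ultimately show ?thesis using f by (metis less_imp_le)
  qed
  then obtain f x where fx: "\<And>n. f n \<in> F" "\<And>n. x n \<in> D" "\<And>n. p (x n) \<le> (1/3)^n"
    "\<And>n. 3/4 * (1/3)^n * L (f n) \<le> f n (x n)" "\<And>n. real n * 4 * 3^n \<le> L (f n)"
    by metis
  \<comment> \<open>The sign of each increment is chosen so that \<open>f n\<close> does not fall
    below \<open>f n (x n)\<close> at the new point. One of the two signs works, because
    \<open>2 * x n\<close> is the difference of the two candidates.\<close>
  define z where "z = rec_nat 0 (\<lambda>n y. if f n (y + x n) \<ge> f n (x n) then y + x n else y - x n)"
  have z_Suc: "z (Suc n) = (if f n (z n + x n) \<ge> f n (x n) then z n + x n else z n - x n)" for n
    by (simp add: z_def)
  have zD: "z n \<in> D" for n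
    by (induction n) (use D fx(2) in \<open>auto simp: z_Suc z_def subspace_0 subspace_add subspace_diff\<close>)
  have neg: "g (- y) = g y" if "g \<in> F" "y \<in> D" for g y
    using F_scale[OF that, of "- 1"] by simp
  have p_neg: "p (- y) = p y" if "y \<in> D" for y
    using p_scale[OF that, of "- 1"] by simp
  have "\<exists>M. \<forall>f\<in>F. \<forall>\<^sub>F n in sequentially. f (z n) \<le> M"
    by (rule Cauchy[OF zD]) (use fx p_neg in \<open>auto simp: z_Suc\<close>)
  then obtain M where M: "\<And>f. f \<in> F \<Longrightarrow> \<forall>\<^sub>F n in sequentially. f (z n) \<le> M" by blast
  have z_Suc_ge: "f n (z (Suc n)) \<ge> f n (x n)" for n
  proof (cases "f n (z n + x n) \<ge> f n (x n)")
    case False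
    have "2 * f n (x n) = f n ((z n + x n) + - (z n - x n))"
      using F_scale[OF fx(1,2), of n 2 n] by (simp add: scaleR_2)
    also have "\<dots> \<le> f n (z n + x n) + f n (- (z n - x n))"
      using D fx zD by (intro F_add) (auto simp: subspace_add subspace_diff subspace_neg)
    also have "f n (- (z n - x n)) = f n (z n - x n)"
      using D fx zD by (intro neg) (auto simp: subspace_diff)
    finally show ?thesis using False by (simp add: z_Suc)
  qed (simp add: z_Suc)
  have z_step: "f n (z (Suc m)) \<ge> f n (z m) - L (f n) * (1/3)^m" for n m
  proof -
    define y where "y = z m - z (Suc m)"
    have y: "y = x m \<or> y = - x m" by (auto simp: y_def z_Suc)
    then have yD: "y \<in> D" using fx D by (auto simp: subspace_neg)
    have "f n (z m) = f n (z (Suc m) + y)" by (simp add: y_def)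
    also have "\<dots> \<le> f n (z (Suc m)) + f n y"
      by (rule F_add[OF fx(1) zD yD])
    also have "f n y \<le> L (f n) * p y" by (rule L[OF fx(1) yD])
    also have "\<dots> \<le> L (f n) * (1/3)^m"
      using y fx p_neg L_nonneg[OF fx(1)] by (intro mult_left_mono) auto
    finally show ?thesis by simp
  qed
  \<comment> \<open>The steps after \<open>Suc n\<close> cost at most a geometric tail:
    \<open>3/2 * (1/3)^m\<close> is the sum of \<open>(1/3)^k\<close> over \<open>k \<ge> m\<close>.
    At \<open>m = Suc n\<close> this is half of \<open>(1/3)^n\<close>, which together with the
    quarter makes up the initial \<open>3/4\<close>.\<close>
  have ge: "f n (z m) \<ge> L (f n) * ((1/3)^n / 4 + 3/2 * (1/3)^m)" if "Suc n \<le> m" for n m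
    using that
  proof (induction m rule: dec_induct)
    case base
    then show ?case using z_Suc_ge[of n] fx(4)[of n] by (simp add: algebra_simps)
  next
    case (step m)
    then show ?case using z_step[of n m] by (simp add: algebra_simps)
  qed
  have "real n \<le> M" for n
  proof -
    have "\<forall>\<^sub>F m in sequentially. Suc n \<le> m \<and> f n (z m) \<le> M"
      using M[OF fx(1)] eventually_ge_at_top by (rule eventually_conj[rotated])
    then obtain m where m: "Suc n \<le> m" "f n (z m) \<le> M"
      using eventually_happens' sequentially_bot by blast
    have "real n = (real n * 4 * 3^n) * ((1/3)^n / 4)"
      by (simp add: power_one_over)
    also have "\<dots> \<le> L (f n) * ((1/3)^n / 4)"
      using fx(5) by (intro mult_right_mono) auto
    also have "\<dots> \<le> L (f n) * ((1/3)^n / 4 + 3/2 * (1/3)^m)"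
      using L_nonneg[OF fx(1)] by (intro mult_left_mono) auto
    finally show ?thesis using ge[OF m(1)] m(2) by linarith
  qed
  then show False
    using reals_Archimedean2[of M] by (meson not_le)
qed

section \<open>Weak convergence and compact operators\<close>

text \<open>The diagonal procedure only has to run over the pairings with the countably many vectors
  \<open>x k\<close>: boundedness carries convergence over to their closed span, and vectors
  orthogonal to it pair to zero with the whole sequence. Nonseparable spaces are thereby
  covered.\<close>

lemma bounded_weakly_convergent_subseq:
  fixes x :: "nat \<Rightarrow> 'a::{real_inner,banach}"
  assumes M: "\<And>n. norm (x n) \<le> M"
  obtains l r where "strict_mono (r :: nat \<Rightarrow> nat)" "\<And>y. (\<lambda>n. inner (x (r n)) y) \<longlonglongrightarrow> inner l y"
proof -
  interpret subseqs "\<lambda>k s. convergent (\<lambda>n. inner (x (s n)) (x k))"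
  proof
    fix k and s :: "nat \<Rightarrow> nat"
    have "bounded (range (\<lambda>n. inner (x (s n)) (x k)))"
      by (rule boundedI[where B="M * norm (x k)"])
        (auto intro!: order_trans[OF Cauchy_Schwarz_ineq2] mult_right_mono M)
    then obtain l r where "strict_mono r" "((\<lambda>n. inner (x (s n)) (x k)) \<circ> r) \<longlonglongrightarrow> l"
      using bounded_imp_convergent_subsequence by blast
    then show "\<exists>r'. strict_mono r' \<and> convergent (\<lambda>n. inner (x ((s \<circ> r') n)) (x k))"
      by (auto simp: convergent_def comp_def)
  qed
  define r where "r = diagseq"
  have r: "strict_mono r" by (simp add: r_def subseq_diagseq)
  define D where "D = span (range x)"
  have "convergent (\<lambda>n. inner (x (r n)) (x k))" for k
  proof -
    have "convergent (\<lambda>n. inner (x ((diagseq \<circ> ((+) (Suc k))) n)) (x k))"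
    proof (rule diagseq_holds)
      fix q s :: "nat \<Rightarrow> nat" and n
      assume "strict_mono q" "convergent (\<lambda>m. inner (x (s m)) (x n))"
      then show "convergent (\<lambda>m. inner (x ((s \<circ> q) m)) (x n))"
        using convergent_subseq_convergent[of "\<lambda>m. inner (x (s m)) (x n)" q] by (simp add: comp_def)
    qed
    then have "convergent (\<lambda>n. inner (x (r (n + Suc k))) (x k))"
      by (simp add: r_def comp_def add.commute)
    then show ?thesis using convergent_ignore_initial_segment by blast
  qed
  note convk = this
  have conv: "convergent (\<lambda>n. inner (x (r n)) w)" if "w \<in> D" for w
    using that[unfolded D_def]
  proof (induction rule: span_induct_alt)
    case base
    show ?case by (simp add: convergent_const)
  next
    case (step c y z)
    then obtain k where "y = x k" by blast
    with step convk[of k] show ?case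
      by (auto simp: inner_add_right intro!: convergent_add convergent_mult convergent_const)
  qed
  have x_bound: "\<bar>inner (x (r n)) w\<bar> \<le> M * norm w" for n w
    by (intro order_trans[OF Cauchy_Schwarz_ineq2] mult_right_mono M) simp
  define f where "f w = lim (\<lambda>n. inner (x (r n)) w)" for w
  have f: "(\<lambda>n. inner (x (r n)) w) \<longlonglongrightarrow> f w" if "w \<in> D" for w
    using conv[OF that] unfolding f_def convergent_LIMSEQ_iff .
  have D: "subspace D" by (simp add: D_def)
  have "\<exists>h\<in>closure D. \<forall>w\<in>D. inner h w = f w"
  proof (rule riesz_on_subspace[OF D])
    fix v w assume vw: "v \<in> D" "w \<in> D"
    have "(\<lambda>n. inner (x (r n)) (v + w)) \<longlonglongrightarrow> f v + f w"
      unfolding inner_add_right by (intro tendsto_add f vw)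
    then show "f (v + w) = f v + f w"
      using f[of "v + w"] vw D subspace_add LIMSEQ_unique by blast
  next
    fix c :: real and w assume w: "w \<in> D"
    have "(\<lambda>n. inner (x (r n)) (c *\<^sub>R w)) \<longlonglongrightarrow> c * f w"
      unfolding inner_scaleR_right by (intro tendsto_mult_left f w)
    then show "f (c *\<^sub>R w) = c * f w"
      using f[of "c *\<^sub>R w"] w D subspace_scale LIMSEQ_unique by blast
  next
    fix w assume w: "w \<in> D"
    show "\<bar>f w\<bar> \<le> M * norm w"
      by (rule LIMSEQ_le_const2[OF tendsto_rabs[OF f[OF w]]]) (use x_bound in auto)
  qed
  then obtain l where l: "l \<in> closure D" "\<And>w. w \<in> D \<Longrightarrow> inner l w = f w" by blast
  have wk: "(\<lambda>n. inner (x (r n)) y) \<longlonglongrightarrow> inner l y" for y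
  proof -
    \<comment> \<open>All \<open>x n\<close> and the limit lie in \<open>closure D\<close>, so
      \<open>y\<close> may be replaced by its projection, which elements of \<open>D\<close>
      approximate.\<close>
    obtain p where p: "p \<in> closure D" "\<And>w. w \<in> D \<Longrightarrow> inner (y - p) w = 0"
      using projection_exists[OF D] by blast
    have perp: "inner z y = inner z p" if "z \<in> closure D" for z
      using orthogonal_closure[OF p(2) that] by (metis eq_iff_diff_eq_0 inner_commute inner_diff_left)
    have xD: "x n \<in> closure D" for n
      using closure_subset[of D] span_base[of "x n" "range x"] by (auto simp: D_def)
    have "(\<lambda>n. inner (x (r n)) p) \<longlonglongrightarrow> inner l p"
    proof (rule LIMSEQ_I)
      fix e :: real assume e: "e > 0"
      define d where "d = e / (2 * (\<bar>M\<bar> + norm l + 1))"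
      have d: "d > 0" using e by (simp add: d_def add_nonneg_pos)
      obtain w where w: "w \<in> D" "norm (w - p) < d"
        using p(1) d unfolding closure_approachable dist_norm by blast
      obtain N where N: "\<And>n. n \<ge> N \<Longrightarrow> \<bar>inner (x (r n)) w - inner l w\<bar> < e / 2"
        using LIMSEQ_D[OF f[OF w(1)], of "e/2"] e l(2)[OF w(1)] by auto
      have "norm (inner (x (r n)) p - inner l p) < e" if "n \<ge> N" for n
      proof -
        have "inner (x (r n)) p - inner l p =
            (inner (x (r n)) w - inner l w) - inner (x (r n)) (w - p) + inner l (w - p)"
          by (simp add: inner_diff_right)
        then have "\<bar>inner (x (r n)) p - inner l p\<bar> \<le>
            \<bar>inner (x (r n)) w - inner l w\<bar> + \<bar>inner (x (r n)) (w - p)\<bar> + \<bar>inner l (w - p)\<bar>"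
          by linarith
        also have "\<dots> \<le> \<bar>inner (x (r n)) w - inner l w\<bar> + M * norm (w - p) + norm l * norm (w - p)"
          using x_bound[of n "w - p"] Cauchy_Schwarz_ineq2[of l "w - p"] by linarith
        also have "\<dots> \<le> \<bar>inner (x (r n)) w - inner l w\<bar> + (\<bar>M\<bar> + norm l + 1) * norm (w - p)"
          using mult_right_mono[OF abs_ge_self[of M] norm_ge_zero[of "w - p"]] norm_ge_zero[of "w - p"]
          unfolding distrib_right by linarith
        also have "\<dots> < e / 2 + (\<bar>M\<bar> + norm l + 1) * d"
          using N[OF that] w(2) by (intro add_strict_mono mult_strict_left_mono) (auto simp: add_nonneg_pos)
        also have "(\<bar>M\<bar> + norm l + 1) * d = e / 2"
        proof -
          have "\<bar>M\<bar> + norm l + 1 > 0" by (simp add: add_nonneg_pos)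
          then show ?thesis by (simp add: d_def field_simps)
        qed
        finally show ?thesis by simp
      qed
      then show "\<exists>N. \<forall>n\<ge>N. norm (inner (x (r n)) p - inner l p) < e" by blast
    qed
    then show ?thesis using perp xD l(1) by simp
  qed
  show ?thesis by (rule that[OF r wk])
qed

text \<open>Otherwise a subsequence of the images stays \<open>e\<close> away from
  \<open>K l\<close>. By compactness a further subsequence converges, and moving \<open>K\<close> to
  the other side of the inner product identifies its limit as \<open>K l\<close>.\<close>

lemma compact_operator_weak_to_strong:
  assumes K: "compact_operator K" and M: "\<And>n. norm (x n) \<le> M"
    and wk: "\<And>y. (\<lambda>n. inner (x n) y) \<longlonglongrightarrow> inner l y"
    and adj: "\<And>y. \<exists>z. \<forall>x. inner (K x) y = inner x z"
  shows "(\<lambda>n. K (x n)) \<longlonglongrightarrow> K l"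
proof (rule ccontr)
  assume "\<not> ?thesis"
  then obtain e where e: "e > 0" "\<And>N. \<exists>n\<ge>N. norm (K (x n) - K l) \<ge> e"
    unfolding LIMSEQ_iff by (meson not_le)
  define q where "q = rec_nat (SOME n. norm (K (x n) - K l) \<ge> e)
    (\<lambda>_ k. SOME n. n > k \<and> norm (K (x n) - K l) \<ge> e)"
  have ex: "\<exists>n. n > k \<and> norm (K (x n) - K l) \<ge> e" for k
    using e(2)[of "Suc k"] by (auto simp: Suc_le_eq)
  have q0: "norm (K (x (q 0)) - K l) \<ge> e"
    unfolding q_def using someI_ex[of "\<lambda>n. norm (K (x n) - K l) \<ge> e"] e(2)[of 0] by auto
  have qS: "q (Suc k) > q k \<and> norm (K (x (q (Suc k))) - K l) \<ge> e" for k
    using someI_ex[OF ex[of "q k"]] by (simp add: q_def)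
  have q: "strict_mono q" using qS by (simp add: strict_mono_Suc_iff)
  have qe: "norm (K (x (q k)) - K l) \<ge> e" for k
    using q0 qS by (cases k) auto
  have lin: "bounded_linear K"
    using K by (simp add: compact_operator_def bounded_clinear_def)
  \<comment> \<open>Scaling by \<open>1 / C\<close> moves the sequence into the unit ball; the
    summand \<open>1\<close> keeps \<open>C\<close> positive even for \<open>M = 0\<close>.\<close>
  define C where "C = \<bar>M\<bar> + 1"
  have C: "C > 0" by (simp add: C_def)
  have in_ball: "(1 / C) *\<^sub>R x n \<in> cball 0 1" for n
    using M[of n] C by (simp add: C_def)
  have seq: "seq_compact (closure (K ` cball 0 1))"
    using K by (simp add: compact_operator_def compact_imp_seq_compact)
  have "\<forall>n. K ((1 / C) *\<^sub>R x (q n)) \<in> closure (K ` cball 0 1)"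
    using in_ball closure_subset by blast
  then obtain y r where r: "strict_mono r" "((\<lambda>n. K ((1 / C) *\<^sub>R x (q n))) \<circ> r) \<longlonglongrightarrow> y"
    using seq unfolding seq_compact_def by metis
  have "(\<lambda>n. C *\<^sub>R K ((1 / C) *\<^sub>R x (q (r n)))) \<longlonglongrightarrow> C *\<^sub>R y"
    using r(2) by (intro tendsto_scaleR tendsto_const) (simp add: comp_def)
  then have lim: "(\<lambda>n. K (x (q (r n)))) \<longlonglongrightarrow> C *\<^sub>R y"
    using C by (simp add: linear_cmul[OF bounded_linear.linear[OF lin]])
  have "inner (C *\<^sub>R y) v = inner (K l) v" for v
  proof -
    obtain z where z: "\<And>x. inner (K x) v = inner x z" using adj by blast
    have "(\<lambda>n. inner (K (x (q (r n)))) v) \<longlonglongrightarrow> inner (C *\<^sub>R y) v"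
      by (intro tendsto_inner lim tendsto_const)
    moreover have "(\<lambda>n. inner (x (q (r n))) z) \<longlonglongrightarrow> inner l z"
      using LIMSEQ_subseq_LIMSEQ[OF wk[of z] strict_mono_o[OF q r(1)]] by (simp add: comp_def)
    ultimately show ?thesis using LIMSEQ_unique z by simp
  qed
  then have "C *\<^sub>R y = K l" by (metis inner_commute vector_eq_rdot)
  with lim have "(\<lambda>n. norm (K (x (q (r n))) - K l)) \<longlonglongrightarrow> 0"
    by (simp add: LIM_zero tendsto_norm_zero)
  then have "e \<le> 0"
    by (rule LIMSEQ_le_const) (use qe in auto)
  then show False using e(1) by simp
qed

subsection \<open>Adjoints of bounded operators\<close>

lemma cinner_bounded_adjoint:
  assumes "bounded_clinear S"
  shows "cinner (S x) f = cinner x (bounded_adjoint S f)"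
proof -
  note S = bounded_clinearD[OF assms]
  have "bounded_clinear (\<lambda>x. cinner (S x) f)"
    using S bounded_linear_compose[OF cinner.bounded_linear_left[of f] S(1)]
    by (auto simp: bounded_clinear_def cinner_scaleC_left scaleC_complex_def)
  then obtain y where y: "\<forall>x. cinner (S x) f = cinner x y"
    using riesz_representation by blast
  then have "(THE y. \<forall>x. cinner (S x) f = cinner x y) = y"
    by (intro the_equality) (auto intro: cinner_eqI)
  with y show ?thesis by (simp add: bounded_adjoint_def)
qed

lemma inner_bounded_adjoint:
  "bounded_clinear S \<Longrightarrow> inner (S x) f = inner x (bounded_adjoint S f)"
  by (metis Re_cinner cinner_bounded_adjoint)

lemma norm_bounded_adjoint_le:
  assumes S: "bounded_clinear S" and M: "\<And>x. norm (S x) \<le> M * norm x"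
  shows "norm (bounded_adjoint S f) \<le> M * norm f"
proof -
  let ?y = "bounded_adjoint S f"
  have "norm ?y * norm ?y = inner (S ?y) f"
    unfolding inner_bounded_adjoint[OF S] by (simp flip: power2_norm_eq_inner power2_eq_square)
  also have "\<dots> \<le> norm (S ?y) * norm f" by (rule norm_cauchy_schwarz)
  also have "\<dots> \<le> (M * norm ?y) * norm f" by (intro mult_right_mono M) simp
  finally have *: "norm ?y * norm ?y \<le> (M * norm f) * norm ?y" by (simp add: mult_ac)
  show ?thesis
  proof (cases "?y = 0")
    case True
    have "0 \<le> M * norm f"
      using order_trans[OF norm_ge_zero M[of f]] .
    then show ?thesis using True by simp
  qed (use * in \<open>simp add: mult_le_cancel_right\<close>)
qed

lemma bounded_clinear_bounded_adjoint:
  assumes S: "bounded_clinear S"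
  shows "bounded_clinear (bounded_adjoint S)"
proof -
  let ?A = "bounded_adjoint S"
  obtain M where "\<And>x. norm (S x) \<le> norm x * M"
    using bounded_linear.bounded[OF bounded_clinearD(1)[OF S]] by blast
  then have M: "norm (?A f) \<le> M * norm f" for f
    by (intro norm_bounded_adjoint_le[OF S]) (simp add: mult.commute)
  have add: "?A (f + g) = ?A f + ?A g" for f g
    by (rule cinner_eqI) (simp add: cinner_add_right flip: cinner_bounded_adjoint[OF S])
  have sc: "?A (scaleC c f) = scaleC c (?A f)" for c f
    by (rule cinner_eqI) (simp add: cinner_scaleC_right flip: cinner_bounded_adjoint[OF S])
  have "bounded_linear ?A"
    by (rule bounded_linear_intro[where K=M])
      (use M add sc in \<open>auto simp: scaleR_scaleC mult.commute\<close>)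
  then show ?thesis using sc by (simp add: bounded_clinear_def)
qed

text \<open>Schauder's theorem is not needed, because \<open>\<parallel>K\<^sup>* x\<parallel>\<^sup>2 = \<langle>K K\<^sup>* x, x\<rangle>\<close>.\<close>

lemma compact_operator_adjoint_weak_to_strong:
  assumes K: "compact_operator K" and M: "\<And>n. norm (x n) \<le> M"
    and wk: "\<And>y. (\<lambda>n. inner (x n) y) \<longlonglongrightarrow> inner l y"
  shows "(\<lambda>n. bounded_adjoint K (x n)) \<longlonglongrightarrow> bounded_adjoint K l"
proof -
  have Kc: "bounded_clinear K" using K by (simp add: compact_operator_def)
  let ?A = "bounded_adjoint K"
  have Ac: "bounded_clinear ?A" by (rule bounded_clinear_bounded_adjoint[OF Kc])
  note Alin = bounded_clinearD(1)[OF Ac]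
  obtain C where C: "\<And>x. norm (?A x) \<le> norm x * C" "0 \<le> C"
    using bounded_linear.nonneg_bounded[OF Alin] by blast
  define y where "y n = x n - l" for n
  have y: "norm (y n) \<le> \<bar>M\<bar> + norm l" for n
    using norm_triangle_ineq4[of "x n" l] M[of n] by (simp add: y_def)
  have y0: "(\<lambda>n. inner (y n) v) \<longlonglongrightarrow> 0" for v
    using wk[of v] by (simp add: y_def inner_diff_left LIM_zero)
  \<comment> \<open>The bounded operator \<open>?A\<close> preserves weak convergence, and
    compactness of \<open>K\<close> makes it strong.\<close>
  have "(\<lambda>n. K (?A (y n))) \<longlonglongrightarrow> K 0"
  proof (rule compact_operator_weak_to_strong[OF K, where M="(\<bar>M\<bar> + norm l) * C"])
    show "norm (?A (y n)) \<le> (\<bar>M\<bar> + norm l) * C" for n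
      by (rule order_trans[OF C(1)]) (intro mult_right_mono y C(2))
    show "(\<lambda>n. inner (?A (y n)) v) \<longlonglongrightarrow> inner 0 v" for v
      using y0[of "K v"] inner_bounded_adjoint[OF Kc, of v] by (simp add: inner_commute)
    show "\<exists>z. \<forall>x. inner (K x) v = inner x z" for v
      using inner_bounded_adjoint[OF Kc] by blast
  qed
  then have "(\<lambda>n. K (?A (y n))) \<longlonglongrightarrow> 0"
    by (simp add: linear_0[OF bounded_linear.linear[OF bounded_clinearD(1)[OF Kc]]])
  then have lim: "(\<lambda>n. norm (K (?A (y n))) * (\<bar>M\<bar> + norm l)) \<longlonglongrightarrow> 0"
    by (intro tendsto_mult_left_zero tendsto_norm_zero)
  have le: "(norm (?A (y n)))\<^sup>2 \<le> norm (K (?A (y n))) * (\<bar>M\<bar> + norm l)" for n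
  proof -
    have "(norm (?A (y n)))\<^sup>2 = inner (K (?A (y n))) (y n)"
      by (simp add: inner_bounded_adjoint[OF Kc] power2_norm_eq_inner)
    also have "\<dots> \<le> norm (K (?A (y n))) * norm (y n)" by (rule norm_cauchy_schwarz)
    also have "\<dots> \<le> norm (K (?A (y n))) * (\<bar>M\<bar> + norm l)" by (intro mult_left_mono y) simp
    finally show ?thesis .
  qed
  have "(\<lambda>n. (norm (?A (y n)))\<^sup>2) \<longlonglongrightarrow> 0"
    by (rule Lim_null_comparison[OF _ lim]) (use le in simp)
  then have "(\<lambda>n. ?A (y n)) \<longlonglongrightarrow> 0"
    by (simp add: tendsto_norm_zero_iff)
  then show ?thesis
    by (simp add: y_def linear_diff[OF bounded_linear.linear[OF Alin]] LIM_zero_iff)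
qed


section \<open>Subspaces with compact unit ball\<close>

text \<open>Two members of an orthonormal sequence are at distance \<open>sqrt 2\<close>, so no
  subsequence is Cauchy.\<close>

lemma orthonormal_no_convergent_subseq:
  fixes e :: "nat \<Rightarrow> 'a::real_inner"
  assumes e: "\<And>n. norm (e n) = 1" "\<And>m n. m < n \<Longrightarrow> inner (e m) (e n) = 0"
    and r: "strict_mono (r :: nat \<Rightarrow> nat)"
  shows "\<not> (\<lambda>n. e (r n)) \<longlonglongrightarrow> l"
proof
  assume "(\<lambda>n. e (r n)) \<longlonglongrightarrow> l"
  then have "Cauchy (\<lambda>n. e (r n))" by (rule LIMSEQ_imp_Cauchy)
  then obtain N where N: "\<And>m n. m \<ge> N \<Longrightarrow> n \<ge> N \<Longrightarrow> norm (e (r m) - e (r n)) < 1"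
    using CauchyD[of "\<lambda>n. e (r n)" 1] by auto
  have "r N < r (Suc N)" using r by (simp add: strict_mono_Suc_iff)
  then have "(norm (e (r N) - e (r (Suc N))))\<^sup>2 = 2"
    using e(1)[of "r N"] e(1)[of "r (Suc N)"] e(2)[of "r N" "r (Suc N)"]
    by (simp add: power2_norm_eq_inner inner_diff_left inner_diff_right inner_commute norm_eq_1)
  moreover have "(norm (e (r N) - e (r (Suc N))))\<^sup>2 < 1"
    using N[of N "Suc N"] power_strict_mono[of "norm (e (r N) - e (r (Suc N)))" 1 2] by simp
  ultimately show False by simp
qed

text \<open>A Gram-Schmidt step: \<open>c\<close> is the part of the new vector orthogonal to the
  old span. Finiteness of \<open>B\<close> takes the place of completeness.\<close>

lemma span_finite_projection:
  fixes a :: "'a::real_inner"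
  assumes "finite B"
  shows "\<exists>p\<in>span B. \<forall>x\<in>span B. inner (a - p) x = 0"
  using assms
proof (induction B arbitrary: a)
  case (insert b B)
  obtain p where p: "p \<in> span B" "\<And>x. x \<in> span B \<Longrightarrow> inner (a - p) x = 0"
    using insert.IH[of a] by blast
  obtain q where q: "q \<in> span B" "\<And>x. x \<in> span B \<Longrightarrow> inner (b - q) x = 0"
    using insert.IH[of b] by blast
  define c where "c = b - q"
  \<comment> \<open>For \<open>c = 0\<close> the quotient is \<open>0\<close> by convention and
    \<open>p' = p\<close>, which is right because the span has not grown.\<close>
  define p' where "p' = p + (inner (a - p) c / inner c c) *\<^sub>R c"
  have mono: "span B \<subseteq> span (insert b B)" by (intro span_mono) auto
  have "c \<in> span (insert b B)"
    using q(1) mono by (auto simp: c_def intro: span_diff span_base)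
  then have "p' \<in> span (insert b B)"
    using p(1) mono by (auto simp: p'_def intro: span_add span_scale)
  moreover have "inner (a - p') x = 0" if x: "x \<in> span (insert b B)" for x
  proof -
    obtain k where k: "x - k *\<^sub>R b \<in> span B" using x span_breakdown_eq by blast
    define w where "w = x - k *\<^sub>R b + k *\<^sub>R q"
    have w: "w \<in> span B" using k q(1) by (auto simp: w_def intro: span_add span_scale)
    have "x = w + k *\<^sub>R c" by (simp add: w_def c_def algebra_simps)
    moreover have "inner (a - p') w = 0"
      using p(2)[OF w] q(2)[OF w] by (simp add: p'_def c_def inner_diff_left inner_add_left)
    moreover have "inner (a - p') c = 0"
      by (cases "c = 0") (simp_all add: p'_def inner_diff_left inner_add_left)
    ultimately show ?thesis by (simp add: inner_add_right)
  qed
  ultimately show ?case by blast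
qed (auto intro: bexI[of _ 0])

text \<open>Riesz's characterisation of finite dimension. In the absence of a finite spanning set,
  every finite family in \<open>V\<close> leaves a unit vector of \<open>V\<close> orthogonal to it,
  and an orthonormal sequence results.\<close>

lemma sequentially_compact_ball_imp_finite_dim:
  fixes V :: "'a::real_inner set"
  assumes V: "subspace V"
    and cpt: "\<And>x. (\<And>n. x n \<in> V) \<Longrightarrow> (\<And>n. norm (x n) \<le> 1) \<Longrightarrow>
      \<exists>l r. strict_mono (r :: nat \<Rightarrow> nat) \<and> (\<lambda>n. x (r n)) \<longlonglongrightarrow> l"
  shows "\<exists>B. finite B \<and> B \<subseteq> V \<and> V \<subseteq> span B"
proof (rule ccontr)
  assume contra: "\<not> ?thesis"
  define P where "P e n v \<longleftrightarrow> v \<in> V \<and> norm v = 1 \<and> (\<forall>m<n. inner (e m) v = 0)"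
    for e :: "nat \<Rightarrow> 'a" and n :: nat and v
  \<comment> \<open>Each choice depends on all earlier vectors, hence the course-of-values form of
    dependent choice.\<close>
  have "\<exists>e. \<forall>n. P e n (e n)"
  proof (rule dependent_wellorder_choice)
    fix n :: nat and e :: "nat \<Rightarrow> 'a"
    assume "\<And>m. m < n \<Longrightarrow> P e m (e m)"
    then have sub: "e ` {..<n} \<subseteq> V" by (auto simp: P_def)
    moreover have "finite (e ` {..<n})" by simp
    ultimately have "\<not> V \<subseteq> span (e ` {..<n})" using contra by metis
    then obtain a where a: "a \<in> V" "a \<notin> span (e ` {..<n})" by blast
    obtain p where p: "p \<in> span (e ` {..<n})" "\<And>x. x \<in> span (e ` {..<n}) \<Longrightarrow> inner (a - p) x = 0"
      using span_finite_projection[of "e ` {..<n}" a] by blast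
    have "p \<in> V" using p(1) sub V span_minimal by blast
    have ne: "a - p \<noteq> 0" using a p by auto
    have "P e n ((1 / norm (a - p)) *\<^sub>R (a - p))"
      unfolding P_def
    proof (intro conjI allI impI)
      show "(1 / norm (a - p)) *\<^sub>R (a - p) \<in> V"
        using V a \<open>p \<in> V\<close> by (intro subspace_scale subspace_diff)
      show "norm ((1 / norm (a - p)) *\<^sub>R (a - p)) = 1" using ne by simp
      show "inner (e m) ((1 / norm (a - p)) *\<^sub>R (a - p)) = 0" if "m < n" for m
        using p(2)[of "e m"] that by (simp add: span_base inner_commute)
    qed
    then show "\<exists>v. P e n v" by blast
  qed (auto simp: P_def)
  then obtain e where "\<And>n. P e n (e n)" by blast
  then have e: "e n \<in> V" "norm (e n) = 1" "m < n \<Longrightarrow> inner (e m) (e n) = 0" for m n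
    by (auto simp: P_def)
  have "\<exists>l r. strict_mono (r :: nat \<Rightarrow> nat) \<and> (\<lambda>n. e (r n)) \<longlonglongrightarrow> l"
    by (rule cpt) (use e in auto)
  then show False
    using orthonormal_no_convergent_subseq[of e] e by blast
qed

text \<open>Finite-dimensional subspaces are closed: the residual of the projection onto
  \<open>W\<close> is orthogonal to \<open>closure W\<close>, to which it belongs. Later this puts a
  finite-dimensional unobservable space inside the domain of the generator.\<close>

lemma dense_subspace_of_finite_dim:
  fixes W :: "'a::real_inner set"
  assumes "subspace W" "V \<subseteq> closure W" "W \<subseteq> span B" "finite B"
  shows "V \<subseteq> W"
proof
  fix v assume v: "v \<in> V"
  obtain C where C: "C \<subseteq> W" "independent C" "W \<subseteq> span C"
    using maximal_independent_subset by blast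
  have "finite C"
    using independent_span_bound[OF assms(4) C(2)] C(1) assms(3) by blast
  obtain p where p: "p \<in> span C" "\<And>x. x \<in> span C \<Longrightarrow> inner (v - p) x = 0"
    using span_finite_projection[OF \<open>finite C\<close>] by blast
  have "p \<in> W" using p(1) C(1) assms(1) span_minimal by blast
  have perp: "inner (v - p) w = 0" if "w \<in> closure W" for w
    by (rule orthogonal_closure[OF _ that]) (use p C in blast)
  have "v \<in> closure W" "p \<in> closure W"
    using v assms(2) \<open>p \<in> W\<close> closure_subset by blast+
  then have "inner (v - p) (v - p) = 0"
    using perp by (simp add: inner_diff_right[of "v - p" v p])
  then show "v \<in> W" using \<open>p \<in> W\<close> by simp
qed

text \<open>More than \<open>card B\<close> vectors in the span of \<open>B\<close> are dependent.
  Dependence is a notion for sets, so equal vectors with different indices are treated apart, with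
  coefficients \<open>1\<close> and \<open>- 1\<close>.\<close>

lemma linear_dependence_powers:
  fixes z :: "nat \<Rightarrow> 'a::real_vector"
  assumes "finite B" "\<And>n. z n \<in> span B"
  shows "\<exists>N c. (\<exists>i\<le>N. c i \<noteq> (0::real)) \<and> (\<Sum>i\<le>N. c i *\<^sub>R z i) = 0"
proof -
  define N where "N = card B"
  show ?thesis
  proof (cases "inj_on z {..N}")
    case True
    have "dependent (z ` {..N})"
    proof (rule ccontr)
      assume "\<not> dependent (z ` {..N})"
      then have "card (z ` {..N}) \<le> card B"
        using independent_span_bound[OF assms(1)] assms(2) by blast
      then show False using True by (simp add: card_image N_def)
    qed
    then obtain u where u: "\<exists>v\<in>z ` {..N}. u v \<noteq> 0" "(\<Sum>v\<in>z ` {..N}. u v *\<^sub>R v) = 0"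
      using dependent_finite[of "z ` {..N}"] by auto
    then have "(\<Sum>i\<le>N. u (z i) *\<^sub>R z i) = 0"
      by (simp add: sum.reindex[OF True])
    then show ?thesis using u(1) by (intro exI[of _ N] exI[of _ "\<lambda>i. u (z i)"]) auto
  next
    case False
    then obtain i j where ij: "i \<le> N" "j \<le> N" "i \<noteq> j" "z i = z j"
      by (auto simp: inj_on_def)
    let ?c = "\<lambda>k. (if k = i then 1 else 0) - (if k = j then 1 else 0 :: real)"
    have "(\<Sum>k\<le>N. ?c k *\<^sub>R z k) = (\<Sum>k\<le>N. (if k = i then z k else 0) - (if k = j then z k else 0))"
      by (intro sum.cong) auto
    also have "\<dots> = (\<Sum>k\<le>N. if k = i then z k else 0) - (\<Sum>k\<le>N. if k = j then z k else 0)"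
      by (rule sum_subtractf)
    also have "\<dots> = 0" using ij by simp
    finally show ?thesis using ij by (intro exI[of _ N] exI[of _ ?c]) auto
  qed
qed

text \<open>Among the polynomials that annihilate \<open>z0\<close> under \<open>g\<close>,
  \<open>p\<close> has minimal degree. It has a complex root \<open>l\<close>, and if
  \<open>p = (X - l) * q\<close>, then minimality makes \<open>q(g) z0\<close> nonzero, hence an
  eigenvector. The span is a real one, so the annihilating polynomial to start from has real
  coefficients.\<close>

lemma eigenvector_exists:
  fixes V :: "'h::complex_hilbert set"
  assumes V: "subspace V" "\<And>c x. x \<in> V \<Longrightarrow> scaleC c x \<in> V" "finite B" "V \<subseteq> span B"
    and g: "\<And>x. x \<in> V \<Longrightarrow> g x \<in> V"
    and g_add: "\<And>x y. x \<in> V \<Longrightarrow> y \<in> V \<Longrightarrow> g (x + y) = g x + g y"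
    and g_scale: "\<And>c x. x \<in> V \<Longrightarrow> g (scaleC c x) = scaleC c (g x)"
    and ne: "z0 \<in> V" "z0 \<noteq> 0"
  shows "\<exists>z\<in>V. \<exists>l. z \<noteq> 0 \<and> g z = scaleC l z"
proof -
  define z where "z n = (g ^^ n) z0" for n
  have zV: "z n \<in> V" for n by (induction n) (simp_all add: z_def ne g)
  obtain N c where c: "\<exists>i\<le>N. c i \<noteq> (0::real)" "(\<Sum>i\<le>N. c i *\<^sub>R z i) = 0"
    using linear_dependence_powers[OF V(3), of z] zV V(4) by blast
  \<comment> \<open>\<open>app p\<close> is \<open>p(g) z0\<close> as long as
    \<open>degree p \<le> N\<close>.\<close>
  define app where "app p = (\<Sum>i\<le>N. scaleC (coeff p i) (z i))" for p
  have sumV: "(\<Sum>i\<le>n. scaleC (a i) (z i)) \<in> V" for n and a :: "nat \<Rightarrow> complex"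
    using zV V by (intro subspace_sum) auto
  have g_sum: "g (\<Sum>i\<le>n. scaleC (a i) (z i)) = (\<Sum>i\<le>n. scaleC (a i) (z (Suc i)))"
    for n and a :: "nat \<Rightarrow> complex"
  proof (induction n)
    case (Suc n)
    have "g (\<Sum>i\<le>Suc n. scaleC (a i) (z i)) = g ((\<Sum>i\<le>n. scaleC (a i) (z i)) + scaleC (a (Suc n)) (z (Suc n)))"
      by simp
    also have "\<dots> = g (\<Sum>i\<le>n. scaleC (a i) (z i)) + scaleC (a (Suc n)) (g (z (Suc n)))"
      using g_add[OF sumV V(2)[OF zV]] g_scale[OF zV] by simp
    finally show ?case using Suc by (simp add: z_def)
  qed (simp add: g_scale zV, simp add: z_def)
  define Q where "Q p \<longleftrightarrow> p \<noteq> 0 \<and> degree p \<le> N \<and> app p = 0" for p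
  have "Q (\<Sum>i\<le>N. monom (complex_of_real (c i)) i)"
  proof -
    let ?p = "\<Sum>i\<le>N. monom (complex_of_real (c i)) i"
    have cf: "coeff ?p i = (if i \<le> N then complex_of_real (c i) else 0)" for i
      by (simp add: coeff_sum)
    have "?p \<noteq> 0"
    proof
      assume 0: "?p = 0"
      obtain i where "i \<le> N" "c i \<noteq> 0" using c(1) by blast
      then show False using cf[of i] unfolding 0 by simp
    qed
    moreover have "degree ?p \<le> N" by (rule degree_le) (simp add: cf)
    moreover have "app ?p = 0"
      using c(2) by (simp add: app_def cf flip: scaleR_scaleC)
    ultimately show ?thesis by (simp add: Q_def)
  qed
  then obtain p where p: "Q p" "\<And>q. Q q \<Longrightarrow> degree p \<le> degree q"
    using ex_has_least_nat[of Q _ degree] by blast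
  have "degree p \<noteq> 0"
  proof
    assume "degree p = 0"
    then obtain a where a: "p = [:a:]" by (rule degree_eq_zeroE)
    have "app p = (\<Sum>i\<le>N. if i = 0 then scaleC a z0 else 0)"
      unfolding app_def a by (intro sum.cong refl) (auto simp: z_def coeff_pCons split: nat.split)
    also have "\<dots> = scaleC a z0" by simp
    finally have "norm (scaleC a z0) = 0" using p(1) by (simp add: Q_def)
    then show False using p(1) ne a by (simp add: norm_scaleC Q_def)
  qed
  then have "\<not> constant (poly p)"
    by (simp add: constant_degree)
  then obtain l where "poly p l = 0"
    using fundamental_theorem_of_algebra by blast
  then obtain q where q: "p = [:- l, 1:] * q"
    using poly_eq_0_iff_dvd by (metis dvdE)
  have q0: "q \<noteq> 0" using p(1) q by (auto simp: Q_def)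
  have deg: "degree p = Suc (degree q)"
    unfolding q using degree_mult_eq[of "[:- l, 1:]" q] q0 by (simp del: mult_pCons_left)
  then have degN: "degree q < N" using p(1) by (simp add: Q_def)
  have "\<not> Q q" using p(2)[of q] deg by auto
  then have ne': "app q \<noteq> 0" using q0 degN by (simp add: Q_def)
  have "coeff p i = coeff (pCons 0 q) i - l * coeff q i" for i
    by (simp add: q)
  then have "app p = (\<Sum>i\<le>N. scaleC (coeff (pCons 0 q) i) (z i)) - (\<Sum>i\<le>N. scaleC (l * coeff q i) (z i))"
    unfolding app_def sum_subtractf[symmetric]
    by (intro sum.cong refl) (metis add_diff_cancel diff_add_cancel scaleC_add_left)
  also have "(\<Sum>i\<le>N. scaleC (l * coeff q i) (z i)) = scaleC l (app q)"
    unfolding app_def linear_sum[OF bounded_linear.linear[OF bounded_linear_scaleC]]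
    by (simp add: scaleC_scaleC)
  \<comment> \<open>Multiplication by \<open>X\<close> amounts to an application of
    \<open>g\<close>; no coefficient is cut off at \<open>N\<close> because
    \<open>degree q < N\<close>.\<close>
  also have "(\<Sum>i\<le>N. scaleC (coeff (pCons 0 q) i) (z i)) = g (app q)"
  proof -
    obtain N' where N': "N = Suc N'" using degN by (cases N) auto
    have "(\<Sum>i\<le>N. scaleC (coeff (pCons 0 q) i) (z i)) = (\<Sum>i\<le>N'. scaleC (coeff q i) (z (Suc i)))"
      unfolding N' by (subst sum.atMost_Suc_shift) simp
    also have "\<dots> = (\<Sum>i\<le>N. scaleC (coeff q i) (z (Suc i)))"
      using degN by (simp add: N' coeff_eq_0)
    finally show ?thesis by (simp add: app_def g_sum)
  qed
  finally have "g (app q) = scaleC l (app q)" using p(1) by (simp add: Q_def)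
  then show ?thesis using ne' sumV unfolding app_def by blast
qed

section \<open>Strongly continuous semigroups\<close>

text \<open>Helps to meet the last assumption of \<open>uniform_boundedness_seminorms\<close> when
  \<open>p\<close> is the norm of a Banach space.\<close>

lemma convergent_geometric_steps:
  fixes z :: "nat \<Rightarrow> 'a::banach"
  assumes "\<And>n. norm (z (Suc n) - z n) \<le> (1/3)^n"
  shows "convergent z"
proof -
  have "summable (\<lambda>n. z (Suc n) - z n)"
    by (rule summable_comparison_test'[where N=0 and g="\<lambda>n. (1/3)^n"]) (use assms in auto)
  then have "(\<lambda>n. (\<Sum>k<n. z (Suc k) - z k)) \<longlonglongrightarrow> (\<Sum>k. z (Suc k) - z k)"
    by (rule summable_LIMSEQ)
  then have "(\<lambda>n. (z n - z 0) + z 0) \<longlonglongrightarrow> (\<Sum>k. z (Suc k) - z k) + z 0"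
    unfolding sum_lessThan_telescope by (intro tendsto_add tendsto_const)
  then show ?thesis by (auto simp: convergent_def)
qed

lemma power_over_fact_tendsto_0: "(\<lambda>n. x ^ n / fact n) \<longlonglongrightarrow> (0::real)"
  using summable_LIMSEQ_zero[OF summable_exp[of x]] by (simp add: field_simps)

text \<open>Connects the difference quotients that define generators with the derivatives of the
  fundamental theorem of calculus.\<close>

lemma has_vector_derivative_iff_quotient:
  fixes f :: "real \<Rightarrow> 'a::real_normed_vector"
  shows "(f has_vector_derivative v) (at x within X) \<longleftrightarrow>
    ((\<lambda>y. (f y - f x) /\<^sub>R (y - x)) \<longlongrightarrow> v) (at x within X)"
proof -
  let ?q = "\<lambda>y. (f y - f x) /\<^sub>R (y - x)"
  have eq: "norm ((f y - (f x + (y - x) *\<^sub>R v)) /\<^sub>R norm (y - x)) = norm (?q y - v)" if "y \<noteq> x" for y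
  proof -
    have "?q y - v = (f y - (f x + (y - x) *\<^sub>R v)) /\<^sub>R (y - x)"
      using that by (simp add: scaleR_diff_right scaleR_add_right)
    then show ?thesis by simp
  qed
  have "(f has_vector_derivative v) (at x within X) \<longleftrightarrow>
      ((\<lambda>y. norm ((f y - (f x + (y - x) *\<^sub>R v)) /\<^sub>R norm (y - x))) \<longlongrightarrow> 0) (at x within X)"
    unfolding has_vector_derivative_def has_derivative_within tendsto_norm_zero_iff
    by (simp add: bounded_linear_scaleR_left inverse_eq_divide)
  also have "\<dots> \<longleftrightarrow> ((\<lambda>y. norm (?q y - v)) \<longlongrightarrow> 0) (at x within X)"
    by (rule Lim_cong_within) (use eq in auto)
  also have "\<dots> \<longleftrightarrow> (?q \<longlongrightarrow> v) (at x within X)"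
    by (simp add: tendsto_norm_zero_iff LIM_zero_iff)
  finally show ?thesis .
qed

locale c0_semigroup =
  fixes S :: "real \<Rightarrow> 'h::complex_hilbert \<Rightarrow> 'h"
  assumes C0: "C0_semigroup S"
begin

abbreviation "D \<equiv> dom (generator S)"
abbreviation "G x \<equiv> the (generator S x)"

lemma clin: "t \<ge> 0 \<Longrightarrow> bounded_clinear (S t)"
  and S_0 [simp]: "S 0 x = x"
  and S_add: "s \<ge> 0 \<Longrightarrow> t \<ge> 0 \<Longrightarrow> S (s + t) x = S s (S t x)"
  and tendsto_0: "((\<lambda>t. S t x) \<longlongrightarrow> x) (at_right 0)"
  using C0 by (auto simp: C0_semigroup_def)

lemma lin: "t \<ge> 0 \<Longrightarrow> bounded_linear (S t)"
  using clin bounded_clinearD by blast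

lemma plus: "t \<ge> 0 \<Longrightarrow> S t (x + y) = S t x + S t y"
  and minus: "t \<ge> 0 \<Longrightarrow> S t (x - y) = S t x - S t y"
  and zero: "t \<ge> 0 \<Longrightarrow> S t 0 = 0"
  and scaleR: "t \<ge> 0 \<Longrightarrow> S t (r *\<^sub>R x) = r *\<^sub>R S t x"
  and scaleC: "t \<ge> 0 \<Longrightarrow> S t (scaleC c x) = scaleC c (S t x)"
  using lin[THEN bounded_linear.linear] clin
  by (simp_all add: linear_add linear_diff linear_0 linear_cmul bounded_clinear_def)

lemma tendsto_0_sequence:
  assumes "\<And>n. t n \<ge> 0" "t \<longlonglongrightarrow> 0"
  shows "(\<lambda>n. S (t n) x) \<longlonglongrightarrow> x"
proof -
  have "continuous (at 0 within {0..}) (\<lambda>t. S t x)"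
    using tendsto_0 by (simp add: continuous_within at_within_Ici_at_right)
  then show ?thesis
    using assms unfolding continuous_within_sequentially by (auto simp: comp_def)
qed

text \<open>Strong continuity at zero bounds every single orbit along a sequence \<open>t n\<close>
  tending to \<open>0\<close>; uniform boundedness makes the bound independent of the vector,
  against the choice of \<open>t n\<close>.\<close>

lemma initial_bound: "\<exists>\<delta>>0. \<exists>M\<ge>1. \<forall>t\<in>{0..\<delta>}. \<forall>x. norm (S t x) \<le> M * norm x"
proof (rule ccontr)
  assume contra: "\<not> ?thesis"
  have "\<exists>t. t \<in> {0..1 / real (Suc n)} \<and> (\<exists>x. norm (S t x) > real (Suc n) * norm x)" for n
  proof -
    have "1 / real (Suc n) > 0" "real (Suc n) \<ge> 1" by auto
    then show ?thesis using contra by (meson not_le)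
  qed
  then obtain t where t: "\<And>n. t n \<in> {0..1 / real (Suc n)}"
    "\<And>n. \<exists>x. norm (S (t n) x) > real (Suc n) * norm x" by metis
  have t0: "t n \<ge> 0" for n using t(1)[of n] by simp
  have "t \<longlonglongrightarrow> 0"
    by (rule tendsto_sandwich[OF _ _ tendsto_const lim_1_over_n[THEN LIMSEQ_Suc]])
      (use t in auto)
  note lim = tendsto_0_sequence[OF t0 this]
  have "\<exists>M. \<forall>f\<in>range (\<lambda>n x. norm (S (t n) x)). \<forall>x\<in>UNIV. f x \<le> M * norm x"
  proof (rule uniform_boundedness_seminorms)
    fix z :: "nat \<Rightarrow> 'h" assume "\<And>n. norm (z (Suc n) - z n) \<le> (1/3)^n"
    then obtain l where l: "z \<longlonglongrightarrow> l"
      using convergent_geometric_steps convergent_def by blast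
    obtain C where C: "\<And>n. norm (S (t n) l) \<le> C"
      using convergent_imp_Bseq[OF convergentI[OF lim[of l]]] unfolding Bseq_def by blast
    have "\<forall>\<^sub>F k in sequentially. norm (S (t n) (z k)) \<le> C + 1" for n
    proof -
      have "(\<lambda>k. norm (S (t n) (z k))) \<longlonglongrightarrow> norm (S (t n) l)"
        using t0 by (intro tendsto_norm bounded_linear.tendsto[OF lin] l)
      moreover have "norm (S (t n) l) < C + 1" using C[of n] by simp
      ultimately have "\<forall>\<^sub>F k in sequentially. norm (S (t n) (z k)) < C + 1"
        by (rule order_tendstoD)
      then show ?thesis by (rule eventually_mono) simp
    qed
    then show "\<exists>M. \<forall>f\<in>range (\<lambda>n x. norm (S (t n) x)). \<forall>\<^sub>F k in sequentially. f (z k) \<le> M"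
      by (intro exI[of _ "C + 1"]) auto
  next
    show "\<exists>c. \<forall>x\<in>UNIV. f x \<le> c * norm x" if f: "f \<in> range (\<lambda>n x. norm (S (t n) x))" for f
    proof -
      obtain n where n: "f = (\<lambda>x. norm (S (t n) x))" using f by blast
      obtain c where "\<And>x. norm (S (t n) x) \<le> norm x * c"
        using bounded_linear.bounded[OF lin[OF t0]] by blast
      then show ?thesis by (auto simp: n mult.commute intro: exI[of _ c])
    qed
  qed (use t0 in \<open>auto simp: plus scaleR norm_triangle_ineq\<close>)
  then obtain M where M: "\<And>n x. norm (S (t n) x) \<le> M * norm x" by auto
  obtain n where n: "M \<le> real n" using real_arch_simple by blast
  obtain x where x: "norm (S (t n) x) > real (Suc n) * norm x" using t(2) by blast
  have "norm (S (t n) x) \<le> real (Suc n) * norm x"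
    by (rule order_trans[OF M]) (use n in \<open>auto intro: mult_right_mono\<close>)
  then show False using x by simp
qed

text \<open>The semigroup law extends the bound from \<open>{0..\<delta>}\<close> to any compact
  interval by powers of \<open>M\<close>; \<open>M \<ge> 1\<close> keeps these increasing.\<close>

lemma local_bound: obtains M where "M \<ge> 1" "\<And>t x. 0 \<le> t \<Longrightarrow> t \<le> \<tau> \<Longrightarrow> norm (S t x) \<le> M * norm x"
proof -
  obtain \<delta> M where dM: "\<delta> > 0" "M \<ge> 1" "\<And>t x. 0 \<le> t \<Longrightarrow> t \<le> \<delta> \<Longrightarrow> norm (S t x) \<le> M * norm x"
    using initial_bound by auto
  have *: "norm (S t x) \<le> M ^ Suc n * norm x" if "0 \<le> t" "t \<le> real (Suc n) * \<delta>" for n t x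
    using that
  proof (induction n arbitrary: t)
    case (Suc n)
    show ?case
    proof (cases "t \<le> \<delta>")
      case True
      have "M \<le> M ^ Suc (Suc n)" using self_le_power[OF dM(2), of "Suc (Suc n)"] by simp
      then show ?thesis
        using dM(3)[OF Suc.prems(1) True, of x] by (meson mult_right_mono norm_ge_zero order_trans)
    next
      case False
      have "S t x = S \<delta> (S (t - \<delta>) x)"
        using S_add[of \<delta> "t - \<delta>" x] False dM(1) by simp
      then have "norm (S t x) \<le> M * norm (S (t - \<delta>) x)"
        using dM(1,3) by simp
      also have "\<dots> \<le> M * (M ^ Suc n * norm x)"
        using Suc dM False by (intro mult_left_mono Suc.IH) (auto simp: algebra_simps)
      finally show ?thesis by simp
    qed
  qed (use dM in simp)
  obtain n where n: "\<tau> / \<delta> \<le> real n" using real_arch_simple by blast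
  then have "\<tau> \<le> real n * \<delta>" using dM(1) by (simp add: field_simps)
  then have "\<tau> \<le> real (Suc n) * \<delta>" using dM(1) by (simp add: algebra_simps)
  with * have "norm (S t x) \<le> M ^ Suc n * norm x" if "0 \<le> t" "t \<le> \<tau>" for t x
    using that by (meson order_trans)
  moreover have "M ^ Suc n \<ge> 1" using dM(2) by (rule one_le_power)
  ultimately show thesis by (intro that)
qed

text \<open>Only right continuity at zero is given. Factoring out the smaller of the two times
  reduces both one-sided limits to it, uniformly by the local bound.\<close>

lemma tendsto_orbit:
  assumes "t \<ge> 0"
  shows "((\<lambda>s. S s x) \<longlongrightarrow> S t x) (at t within {0..})"
proof -
  obtain M where M: "M \<ge> 1" "\<And>r y. 0 \<le> r \<Longrightarrow> r \<le> t + 1 \<Longrightarrow> norm (S r y) \<le> M * norm y"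
    using local_bound[of "t + 1"] by metis
  have le: "norm (S s x - S t x) \<le> M * norm (S \<bar>s - t\<bar> x - x)" if "0 \<le> s" "s \<le> t + 1" for s
  proof -
    define m where "m = min s t"
    have "0 \<le> m" "m \<le> t + 1" using that assms by (auto simp: m_def)
    moreover have "norm (S s x - S t x) = norm (S m (S \<bar>s - t\<bar> x - x))"
    proof (cases "s \<le> t")
      case True
      then have "S t x = S s (S (t - s) x)" using S_add[of s "t - s"] that by simp
      with True that show ?thesis by (simp add: m_def minus norm_minus_commute)
    next
      case False
      then have "S s x = S t (S (s - t) x)" using S_add[of t "s - t"] assms by simp
      with False assms show ?thesis by (simp add: m_def minus)
    qed
    ultimately show ?thesis using M(2) by simp
  qed
  have "((\<lambda>s. S \<bar>s - t\<bar> x) \<longlongrightarrow> x) (at t within {0..})"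
  proof (rule filterlim_compose[OF tendsto_0])
    have "((\<lambda>s. \<bar>s - t\<bar>) \<longlongrightarrow> \<bar>t - t\<bar>) (at t within {0..})"
      by (intro tendsto_intros)
    moreover have "\<forall>\<^sub>F s in at t within {0..}. \<bar>s - t\<bar> \<in> {0<..}"
      by (auto simp: eventually_at_filter)
    ultimately show "filterlim (\<lambda>s. \<bar>s - t\<bar>) (at_right 0) (at t within {0..})"
      by (simp add: filterlim_at eventually_mono)
  qed
  then have lim: "((\<lambda>s. M * norm (S \<bar>s - t\<bar> x - x)) \<longlongrightarrow> 0) (at t within {0..})"
    by (intro tendsto_mult_right_zero tendsto_norm_zero LIM_zero)
  have "\<forall>\<^sub>F s in at t within {0..}. s < t + 1"
    by (rule order_tendstoD(2)[OF tendsto_ident_at]) simp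
  moreover have "\<forall>\<^sub>F s in at t within {0..}. 0 \<le> s"
    by (auto simp: eventually_at_filter)
  ultimately have "\<forall>\<^sub>F s in at t within {0..}. norm (S s x - S t x) \<le> M * norm (S \<bar>s - t\<bar> x - x)"
    by eventually_elim (use le in auto)
  then have "((\<lambda>s. S s x - S t x) \<longlongrightarrow> 0) (at t within {0..})"
    by (rule Lim_null_comparison[OF _ lim])
  then show ?thesis by (simp add: LIM_zero_iff)
qed

lemma continuous_on_orbit: "continuous_on {0..} (\<lambda>s. S s x)"
  using tendsto_orbit by (auto simp: continuous_on_def)

lemma tendsto_S:
  assumes f: "(f \<longlongrightarrow> t) F" and g: "(g \<longlongrightarrow> x) F" and pos: "\<forall>\<^sub>F a in F. f a \<ge> 0" and t: "t \<ge> 0"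
  shows "((\<lambda>a. S (f a) (g a)) \<longlongrightarrow> S t x) F"
proof -
  obtain M where M: "M \<ge> 1" "\<And>r y. 0 \<le> r \<Longrightarrow> r \<le> t + 1 \<Longrightarrow> norm (S r y) \<le> M * norm y"
    using local_bound[of "t + 1"] by metis
  have 1: "((\<lambda>a. S (f a) x) \<longlongrightarrow> S t x) F"
    using continuous_on_tendsto_compose[OF continuous_on_orbit f, of x] t pos by simp
  have lim: "((\<lambda>a. M * norm (g a - x)) \<longlongrightarrow> 0) F"
    using g by (intro tendsto_mult_right_zero tendsto_norm_zero LIM_zero)
  have "\<forall>\<^sub>F a in F. f a < t + 1"
    by (rule order_tendstoD(2)[OF f]) simp
  with pos have "\<forall>\<^sub>F a in F. norm (S (f a) (g a - x)) \<le> M * norm (g a - x)"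
    by eventually_elim (use M in auto)
  then have "((\<lambda>a. S (f a) (g a - x)) \<longlongrightarrow> 0) F"
    by (rule Lim_null_comparison[OF _ lim])
  from tendsto_add[OF this 1] have *: "((\<lambda>a. S (f a) (g a - x) + S (f a) x) \<longlongrightarrow> S t x) F"
    by simp
  have "\<forall>\<^sub>F a in F. S (f a) (g a - x) + S (f a) x = S (f a) (g a)"
    using pos by eventually_elim (simp add: minus)
  from Lim_transform_eventually[OF * this] show ?thesis .
qed

lemma continuous_on_S [continuous_intros]:
  assumes "continuous_on X f" "continuous_on X g" "\<And>a. a \<in> X \<Longrightarrow> f a \<ge> 0"
  shows "continuous_on X (\<lambda>a. S (f a) (g a))"
  unfolding continuous_on_def
proof
  fix a assume "a \<in> X"
  with assms show "((\<lambda>a. S (f a) (g a)) \<longlongrightarrow> S (f a) (g a)) (at a within X)"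
    by (intro tendsto_S) (auto simp: continuous_on_def eventually_at_filter)
qed

lemma integrable_S [intro]:
  fixes f :: "real \<Rightarrow> real"
  assumes "continuous_on {a..b} f" "continuous_on {a..b} g" "\<And>s. s \<in> {a..b} \<Longrightarrow> f s \<ge> 0"
  shows "(\<lambda>s. S (f s) (g s)) integrable_on {a..b}"
  by (rule integrable_continuous_interval) (intro continuous_intros assms)

subsection \<open>The generator\<close>

lemma generator_iff:
  "generator S x = Some y \<longleftrightarrow> ((\<lambda>t. (S t x - x) /\<^sub>R t) \<longlongrightarrow> y) (at_right 0)"
  unfolding generator_def
  by (auto intro!: tendsto_Lim dest: tendsto_Lim[OF trivial_limit_at_right_real])

lemma generatorI:
  assumes "((\<lambda>t. (S t x - x) /\<^sub>R t) \<longlongrightarrow> y) (at_right 0)"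
  shows "x \<in> D" "G x = y"
  using assms[folded generator_iff] by auto

lemma generator_tendsto:
  assumes "x \<in> D"
  shows "((\<lambda>t. (S t x - x) /\<^sub>R t) \<longlongrightarrow> G x) (at_right 0)"
  using assms generator_iff[of x "G x"] by auto

lemma eventually_at_right_pos: "\<forall>\<^sub>F t in at_right (0::real). 0 < t"
  by (simp add: eventually_at_filter)

lemma generator_add:
  assumes "x \<in> D" "y \<in> D"
  shows "x + y \<in> D" "G (x + y) = G x + G y"
proof -
  have "((\<lambda>t. (S t x - x) /\<^sub>R t + (S t y - y) /\<^sub>R t) \<longlongrightarrow> G x + G y) (at_right 0)"
    by (intro tendsto_add generator_tendsto assms)
  moreover have "\<forall>\<^sub>F t in at_right 0.
      (S t x - x) /\<^sub>R t + (S t y - y) /\<^sub>R t = (S t (x + y) - (x + y)) /\<^sub>R t"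
    using eventually_at_right_pos
    by eventually_elim (simp add: plus scaleR_add_right scaleR_diff_right)
  ultimately have "((\<lambda>t. (S t (x + y) - (x + y)) /\<^sub>R t) \<longlongrightarrow> G x + G y) (at_right 0)"
    by (rule Lim_transform_eventually)
  then show "x + y \<in> D" "G (x + y) = G x + G y" by (auto dest: generatorI)
qed

lemma generator_scaleC:
  assumes "x \<in> D"
  shows "scaleC c x \<in> D" "G (scaleC c x) = scaleC c (G x)"
proof -
  have "((\<lambda>t. scaleC c ((S t x - x) /\<^sub>R t)) \<longlongrightarrow> scaleC c (G x)) (at_right 0)"
    by (intro bounded_linear.tendsto[OF bounded_linear_scaleC] generator_tendsto assms)
  moreover have "\<forall>\<^sub>F t in at_right 0.
      scaleC c ((S t x - x) /\<^sub>R t) = (S t (scaleC c x) - scaleC c x) /\<^sub>R t"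
    using eventually_at_right_pos
    by eventually_elim (simp add: scaleC scaleC_scaleR scaleC_diff_right)
  ultimately have "((\<lambda>t. (S t (scaleC c x) - scaleC c x) /\<^sub>R t) \<longlongrightarrow> scaleC c (G x)) (at_right 0)"
    by (rule Lim_transform_eventually)
  then show "scaleC c x \<in> D" "G (scaleC c x) = scaleC c (G x)" by (auto dest: generatorI)
qed

lemma generator_scaleR:
  assumes "x \<in> D"
  shows "r *\<^sub>R x \<in> D" "G (r *\<^sub>R x) = r *\<^sub>R G x"
  using generator_scaleC[OF assms, of "of_real r"] by (simp_all add: scaleR_scaleC)

lemma generator_diff:
  assumes "x \<in> D" "y \<in> D"
  shows "x - y \<in> D" "G (x - y) = G x - G y"
  using generator_add[OF assms(1) generator_scaleR(1)[OF assms(2), of "- 1"]]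
    generator_scaleR[OF assms(2), of "- 1"] by auto

lemma subspace_D: "subspace D"
proof (rule subspaceI)
  show "0 \<in> D"
    by (rule generatorI(1)[of _ 0], rule Lim_transform_eventually[OF tendsto_const])
      (use eventually_at_right_pos in eventually_elim, simp add: zero)
qed (use generator_add generator_scaleR in auto)

lemma generator_S:
  assumes "x \<in> D" "t \<ge> 0"
  shows "S t x \<in> D" "G (S t x) = S t (G x)"
proof -
  have "((\<lambda>h. S t ((S h x - x) /\<^sub>R h)) \<longlongrightarrow> S t (G x)) (at_right 0)"
    by (intro bounded_linear.tendsto[OF lin] generator_tendsto assms)
  moreover have "\<forall>\<^sub>F h in at_right 0. S t ((S h x - x) /\<^sub>R h) = (S h (S t x) - S t x) /\<^sub>R h"
    using eventually_at_right_pos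
  proof eventually_elim
    case (elim h)
    have "S t (S h x) = S h (S t x)"
      using S_add[of t h x] S_add[of h t x] elim assms by (simp add: add.commute)
    with assms show ?case by (simp add: minus scaleR)
  qed
  ultimately have "((\<lambda>h. (S h (S t x) - S t x) /\<^sub>R h) \<longlongrightarrow> S t (G x)) (at_right 0)"
    by (rule Lim_transform_eventually)
  then show "S t x \<in> D" "G (S t x) = S t (G x)" by (auto dest: generatorI)
qed

subsection \<open>Orbit integrals\<close>

text \<open>Its values lie in the domain of the generator, which makes it the smoothing device of
  the whole development.\<close>

definition "orbit_integral t x = integral {0..t} (\<lambda>s. S s x)"

lemma integral_S:
  fixes f :: "real \<Rightarrow> 'h"
  assumes "r \<ge> 0" "f integrable_on X"
  shows "S r (integral X f) = integral X (\<lambda>s. S r (f s))"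
  using integral_linear[OF assms(2) lin[OF assms(1)]] by (simp add: comp_def)

lemma integrable_orbit: "a \<ge> 0 \<Longrightarrow> (\<lambda>s. S s x) integrable_on {a..b}"
  by (intro integrable_S continuous_intros) auto

lemma norm_orbit_integral_le:
  assumes "0 \<le> t" "t \<le> \<tau>" "\<And>s y. 0 \<le> s \<Longrightarrow> s \<le> \<tau> \<Longrightarrow> norm (S s y) \<le> M * norm y"
  shows "norm (orbit_integral t x) \<le> M * t * norm x"
proof -
  have "norm (orbit_integral t x) \<le> (M * norm x) * (t - 0)"
    unfolding orbit_integral_def
    by (rule integral_bound) (use assms in \<open>auto intro!: continuous_intros\<close>)
  then show ?thesis by (simp add: mult_ac)
qed

lemma orbit_integral_add: "orbit_integral t (x + y) = orbit_integral t x + orbit_integral t y"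
proof -
  have "orbit_integral t (x + y) = integral {0..t} (\<lambda>s. S s x + S s y)"
    unfolding orbit_integral_def by (intro integral_cong) (simp add: plus)
  then show ?thesis
    by (simp add: orbit_integral_def integral_add integrable_orbit)
qed

lemma orbit_integral_scaleC: "orbit_integral t (scaleC c x) = scaleC c (orbit_integral t x)"
proof -
  have "orbit_integral t (scaleC c x) = integral {0..t} (scaleC c \<circ> (\<lambda>s. S s x))"
    unfolding orbit_integral_def by (intro integral_cong) (simp add: scaleC)
  then show ?thesis
    by (simp add: orbit_integral_def integral_linear integrable_orbit bounded_linear_scaleC)
qed

lemma orbit_integral_scaleR: "orbit_integral t (r *\<^sub>R x) = r *\<^sub>R orbit_integral t x"
  by (simp add: scaleR_scaleC orbit_integral_scaleC)

lemma orbit_integral_diff: "orbit_integral t (x - y) = orbit_integral t x - orbit_integral t y"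
  using orbit_integral_add[of t x "- 1 *\<^sub>R y"] orbit_integral_scaleR[of t "- 1" y] by simp

lemma orbit_integral_S: "r \<ge> 0 \<Longrightarrow> orbit_integral t (S r x) = S r (orbit_integral t x)"
  unfolding orbit_integral_def
  by (subst integral_S)
    (auto intro!: integral_cong integrable_orbit simp flip: S_add simp: add.commute)

lemma orbit_integral_shift:
  assumes "r \<ge> 0"
  shows "S r (orbit_integral t x) = integral {r..t + r} (\<lambda>s. S s x)"
proof -
  have "S r (orbit_integral t x) = integral {0..t} (\<lambda>s. S (s + r) x)"
    unfolding orbit_integral_def
    by (subst integral_S) (use assms in \<open>auto intro!: integral_cong integrable_orbit simp: S_add[symmetric] add.commute\<close>)
  also have "\<dots> = integral {r..t + r} (\<lambda>s. S s x)"
    using integral_shift_real_ivl[of r r "t + r" "\<lambda>s. S s x"] by simp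
  finally show ?thesis .
qed

text \<open>Both sides equal the integral over \<open>{0..t + r}\<close> minus those over
  \<open>{0..r}\<close> and \<open>{0..t}\<close>, an expression symmetric in \<open>r\<close> and
  \<open>t\<close>.\<close>

lemma orbit_integral_difference:
  assumes "r \<ge> 0" "t \<ge> 0"
  shows "S r (orbit_integral t x) - orbit_integral t x = S t (orbit_integral r x) - orbit_integral r x"
proof -
  have "integral {0..r} (\<lambda>s. S s x) + integral {r..t + r} (\<lambda>s. S s x) = integral {0..t + r} (\<lambda>s. S s x)"
    using assms Henstock_Kurzweil_Integration.integral_combine[of 0 r "t + r" "\<lambda>s. S s x"] integrable_orbit by simp
  moreover have "integral {0..t} (\<lambda>s. S s x) + integral {t..r + t} (\<lambda>s. S s x) = integral {0..t + r} (\<lambda>s. S s x)"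
    using assms Henstock_Kurzweil_Integration.integral_combine[of 0 t "t + r" "\<lambda>s. S s x"] integrable_orbit
    by (simp add: add.commute)
  ultimately show ?thesis
    unfolding orbit_integral_shift[OF assms(1)] orbit_integral_shift[OF assms(2)]
    by (simp add: orbit_integral_def algebra_simps)
qed

lemma average_tendsto: "((\<lambda>h. orbit_integral h x /\<^sub>R h) \<longlongrightarrow> x) (at_right 0)"
proof -
  have "((\<lambda>u. integral {0..u} (\<lambda>s. S s x)) has_vector_derivative S 0 x) (at 0 within {0..1})"
    by (rule integral_has_vector_derivative) (auto intro!: continuous_intros)
  then have "((\<lambda>h. (orbit_integral h x - orbit_integral 0 x) /\<^sub>R (h - 0)) \<longlongrightarrow> x) (at 0 within {0..1})"
    unfolding has_vector_derivative_iff_quotient orbit_integral_def[symmetric] by simp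
  moreover have "at 0 within {0..1} = at_right (0::real)"
    by (rule at_within_Icc_at_right) simp
  ultimately show ?thesis by (simp add: orbit_integral_def)
qed

text \<open>Divided by the increment, the identity \<open>orbit_integral_difference\<close> turns
  the difference quotient of the orbit integral into averages over short times, which
  converge.\<close>

lemma generator_orbit_integral:
  assumes "t \<ge> 0"
  shows "orbit_integral t x \<in> D" "G (orbit_integral t x) = S t x - x"
proof -
  have "((\<lambda>h. S t (orbit_integral h x /\<^sub>R h) - orbit_integral h x /\<^sub>R h) \<longlongrightarrow> S t x - x) (at_right 0)"
    by (intro tendsto_diff bounded_linear.tendsto[OF lin] average_tendsto assms)
  moreover have "\<forall>\<^sub>F h in at_right 0. S t (orbit_integral h x /\<^sub>R h) - orbit_integral h x /\<^sub>R h
      = (S h (orbit_integral t x) - orbit_integral t x) /\<^sub>R h"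
    using eventually_at_right_pos
    by eventually_elim
      (simp add: orbit_integral_difference assms scaleR flip: scaleR_diff_right)
  ultimately have "((\<lambda>h. (S h (orbit_integral t x) - orbit_integral t x) /\<^sub>R h) \<longlongrightarrow> S t x - x) (at_right 0)"
    by (rule Lim_transform_eventually)
  then show "orbit_integral t x \<in> D" "G (orbit_integral t x) = S t x - x"
    by (auto dest: generatorI)
qed

text \<open>\<open>orbit_integral t\<close> is bounded and commutes with the semigroup, so it may be
  applied to the difference quotients of \<open>x\<close>.\<close>

lemma orbit_integral_generator:
  assumes "x \<in> D" "t \<ge> 0"
  shows "orbit_integral t (G x) = S t x - x"
proof -
  obtain M where M: "M \<ge> 1" "\<And>s y. 0 \<le> s \<Longrightarrow> s \<le> t \<Longrightarrow> norm (S s y) \<le> M * norm y"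
    using local_bound[of t] by metis
  have bl: "bounded_linear (orbit_integral t)"
    by (rule bounded_linear_intro[where K="M * t"])
      (use norm_orbit_integral_le[OF assms(2) order_refl M(2)] in
        \<open>auto simp: orbit_integral_add orbit_integral_scaleR mult_ac\<close>)
  have "((\<lambda>h. orbit_integral t ((S h x - x) /\<^sub>R h)) \<longlongrightarrow> orbit_integral t (G x)) (at_right 0)"
    by (intro bounded_linear.tendsto[OF bl] generator_tendsto assms)
  moreover have "\<forall>\<^sub>F h in at_right 0. orbit_integral t ((S h x - x) /\<^sub>R h)
      = (S h (orbit_integral t x) - orbit_integral t x) /\<^sub>R h"
    using eventually_at_right_pos
    by eventually_elim (simp add: orbit_integral_scaleR orbit_integral_diff orbit_integral_S)
  ultimately have "((\<lambda>h. (S h (orbit_integral t x) - orbit_integral t x) /\<^sub>R h) \<longlongrightarrow> orbit_integral t (G x)) (at_right 0)"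
    by (rule Lim_transform_eventually)
  from generatorI(2)[OF this] generator_orbit_integral(2)[OF assms(2), of x] show ?thesis by simp
qed

lemma closure_D: "closure D = UNIV"
proof -
  have "x \<in> closure D" for x
  proof -
    have "(\<lambda>n. orbit_integral (1 / Suc n) x /\<^sub>R (1 / Suc n)) \<longlonglongrightarrow> x"
      by (rule filterlim_compose[OF average_tendsto])
        (auto simp: filterlim_at simp del: of_nat_Suc intro!: lim_1_over_n[THEN LIMSEQ_Suc])
    moreover have "orbit_integral (1 / Suc n) x /\<^sub>R (1 / Suc n) \<in> D" for n
      by (rule generator_scaleR(1), rule generator_orbit_integral(1)) simp
    ultimately show ?thesis unfolding closure_sequential
      by (intro exI[of _ "\<lambda>n. orbit_integral (1 / Suc n) x /\<^sub>R (1 / Suc n)"]) simp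
  qed
  then show ?thesis by blast
qed

lemma has_vector_derivative_orbit:
  assumes "x \<in> D" "s \<in> {0..t}"
  shows "((\<lambda>s. S s x) has_vector_derivative S s (G x)) (at s within {0..t})"
proof -
  have "((\<lambda>u. x + integral {0..u} (\<lambda>s. S s (G x))) has_vector_derivative (0 + S s (G x))) (at s within {0..t})"
    by (intro has_vector_derivative_add has_vector_derivative_const integral_has_vector_derivative)
      (use assms in \<open>auto intro!: continuous_intros\<close>)
  then have "((\<lambda>u. x + integral {0..u} (\<lambda>s. S s (G x))) has_vector_derivative S s (G x)) (at s within {0..t})"
    by simp
  then show ?thesis
    by (rule has_vector_derivative_transform[rotated 2])
      (use assms orbit_integral_generator in \<open>auto simp: orbit_integral_def\<close>)
qed

end

subsection \<open>Bounded perturbations\<close>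

lemma option_eqI: "(\<And>y. a = Some y \<longleftrightarrow> b = Some y) \<Longrightarrow> a = b"
  by (metis not_Some_eq)

lemma dom_perturb [simp]: "dom (perturb A K) = dom A"
  by (auto simp: perturb_def)

lemma perturb_eq_Some: "perturb A K x = Some y \<longleftrightarrow> A x = Some (y - K x)"
  by (cases "A x") (auto simp: perturb_def eq_diff_eq)

lemma the_perturb: "x \<in> dom A \<Longrightarrow> the (perturb A K x) = the (A x) + K x"
  by (auto simp: perturb_def)

context c0_semigroup
begin

text \<open>The path \<open>s \<mapsto> S (t - s) (T s x)\<close> leads from \<open>S t x\<close> to
  \<open>T t x\<close>, and the formula integrates its derivative.\<close>

lemma duhamel:
  assumes T: "c0_semigroup T" and gen: "generator T = perturb (generator S) K"
    and K: "bounded_linear K" and x: "x \<in> D" and t: "t \<ge> 0"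
  shows "T t x = S t x + integral {0..t} (\<lambda>s. S (t - s) (K (T s x)))"
proof -
  interpret T: c0_semigroup T by (rule T)
  have dom_T: "dom (generator T) = D" by (simp add: gen)
  have "((\<lambda>s. S (t - s) (T s x)) has_vector_derivative S (t - s) (K (T s x))) (at s within {0..t})"
    if s: "s \<in> {0..t}" for s
    unfolding has_vector_derivative_iff_quotient
  proof -
    let ?F = "at s within {0..t}"
    define w where "w = T s x"
    have w: "w \<in> D" using T.generator_S(1)[of x s] x s by (simp add: dom_T w_def)
    have "((\<lambda>y. (T y x - T s x) /\<^sub>R (y - s)) \<longlongrightarrow> T s (T.G x)) ?F"
      using T.has_vector_derivative_orbit[of x s t] x s
      by (simp add: has_vector_derivative_iff_quotient dom_T)
    moreover have "T s (T.G x) = G w + K w"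
      using T.generator_S(2)[of x s] x s the_perturb[OF w, of K] by (simp add: gen w_def)
    ultimately have 1: "((\<lambda>y. S (t - y) ((T y x - T s x) /\<^sub>R (y - s))) \<longlongrightarrow> S (t - s) (G w + K w)) ?F"
      using s by (intro tendsto_S) (auto intro!: tendsto_intros simp: eventually_at_filter)
    have "((\<lambda>r. S r w) has_vector_derivative S (t - s) (G w)) (at (t - s) within (\<lambda>y. t - y) ` {0..t})"
      by (rule has_vector_derivative_within_subset[OF has_vector_derivative_orbit[OF w, where t=t]])
        (use s in auto)
    moreover have "((\<lambda>y. t - y) has_vector_derivative - 1) ?F"
      by (auto intro!: derivative_eq_intros)
    ultimately have "(((\<lambda>r. S r w) \<circ> (\<lambda>y. t - y)) has_vector_derivative (- 1) *\<^sub>R S (t - s) (G w)) ?F"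
      by (intro vector_diff_chain_within)
    then have 2: "((\<lambda>y. (S (t - y) w - S (t - s) w) /\<^sub>R (y - s)) \<longlongrightarrow> - S (t - s) (G w)) ?F"
      by (simp add: has_vector_derivative_iff_quotient comp_def)
    have "((\<lambda>y. S (t - y) ((T y x - T s x) /\<^sub>R (y - s)) + (S (t - y) w - S (t - s) w) /\<^sub>R (y - s))
        \<longlongrightarrow> S (t - s) (K w)) ?F"
      using tendsto_add[OF 1 2] s by (simp add: plus)
    moreover have "\<forall>\<^sub>F y in ?F. S (t - y) ((T y x - T s x) /\<^sub>R (y - s)) + (S (t - y) w - S (t - s) w) /\<^sub>R (y - s)
        = (S (t - y) (T y x) - S (t - s) (T s x)) /\<^sub>R (y - s)"
      by (auto simp: eventually_at_filter w_def scaleR minus scaleR_diff_right)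
    ultimately show "((\<lambda>y. (S (t - y) (T y x) - S (t - s) (T s x)) /\<^sub>R (y - s)) \<longlongrightarrow> S (t - s) (K (T s x))) ?F"
      unfolding w_def by (rule Lim_transform_eventually)
  qed
  from fundamental_theorem_of_calculus[OF t this]
  show ?thesis by (simp add: has_integral_iff)
qed

end

locale perturbed_semigroup = c0_semigroup S for S :: "real \<Rightarrow> 'h::complex_hilbert \<Rightarrow> 'h" +
  fixes K :: "'h \<Rightarrow> 'h"
  assumes K: "bounded_clinear K"
begin

lemmas K_lin = bounded_clinearD(1)[OF K]
lemmas K_linear = bounded_linear.linear[OF K_lin]
lemmas K_scaleC = bounded_clinearD(2)[OF K]

lemma continuous_on_K [continuous_intros]: "continuous_on X g \<Longrightarrow> continuous_on X (\<lambda>a. K (g a))"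
  by (rule bounded_linear.continuous_on[OF K_lin])

section \<open>Volterra equations with a bounded perturbation\<close>

definition "volterra g t = integral {0..t} (\<lambda>s. S (t - s) (K (g s)))"

lemma volterra_integrable:
  assumes "continuous_on {0..} g" "b \<le> t" "0 \<le> a"
  shows "(\<lambda>s. S (t - s) (K (g s))) integrable_on {a..b}"
  by (intro integrable_S continuous_intros continuous_on_subset[OF assms(1)]) (use assms in auto)

lemma volterra_add:
  assumes "continuous_on {0..} g" "continuous_on {0..} h"
  shows "volterra (\<lambda>s. g s + h s) t = volterra g t + volterra h t"
proof -
  have "volterra (\<lambda>s. g s + h s) t = integral {0..t} (\<lambda>s. S (t - s) (K (g s)) + S (t - s) (K (h s)))"
    unfolding volterra_def by (intro integral_cong) (simp add: plus linear_add[OF K_linear])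
  then show ?thesis
    unfolding volterra_def using integral_add[OF volterra_integrable volterra_integrable] assms
    by simp
qed

lemma volterra_scaleC:
  assumes "continuous_on {0..} g"
  shows "volterra (\<lambda>s. scaleC c (g s)) t = scaleC c (volterra g t)"
proof -
  have "volterra (\<lambda>s. scaleC c (g s)) t = integral {0..t} (scaleC c \<circ> (\<lambda>s. S (t - s) (K (g s))))"
    unfolding volterra_def by (intro integral_cong) (simp add: scaleC K_scaleC)
  also have "\<dots> = scaleC c (volterra g t)"
    unfolding volterra_def
    by (rule integral_linear[OF volterra_integrable bounded_linear_scaleC]) (use assms in auto)
  finally show ?thesis .
qed

lemma volterra_diff:
  assumes "continuous_on {0..} g" "continuous_on {0..} h"
  shows "volterra (\<lambda>s. g s - h s) t = volterra g t - volterra h t"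
proof -
  have "continuous_on {0..} (\<lambda>s. scaleC (- 1) (h s))"
    by (rule bounded_linear.continuous_on[OF bounded_linear_scaleC assms(2)])
  moreover have "scaleC (- 1) y = - y" for y :: 'h
    using scaleR_scaleC[of "- 1" y] by simp
  ultimately show ?thesis
    using volterra_add[OF assms(1), of "\<lambda>s. scaleC (- 1) (h s)" t] volterra_scaleC[OF assms(2), of "- 1" t]
    by simp
qed

text \<open>The convolution divided by \<open>t\<close>, rescaled to the fixed interval
  \<open>{0..1}\<close>. Continuity becomes a matter of parameter integrals, and the value
  \<open>K (g 0)\<close> at \<open>t = 0\<close> is meaningful, unlike that of the quotient.\<close>

definition "volterra_mean g t = integral {0..1} (\<lambda>\<sigma>. S (t - t * \<sigma>) (K (g (t * \<sigma>))))"

lemma volterra_eq_mean: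
  assumes g: "continuous_on {0..} g" and t: "t \<ge> 0"
  shows "volterra g t = t *\<^sub>R volterra_mean g t"
proof (cases "t = 0")
  case False
  then have "t > 0" using t by simp
  have "((\<lambda>s. S (t - s) (K (g s))) has_integral volterra g t) {0..t}"
    unfolding volterra_def using volterra_integrable[OF g] by (intro integrable_integral) simp
  from has_integral_stretch_real[OF this False]
  have "((\<lambda>\<sigma>. S (t - t * \<sigma>) (K (g (t * \<sigma>)))) has_integral (1 / t) *\<^sub>R volterra g t) ((\<lambda>x. x / t) ` {0..t})"
    using \<open>t > 0\<close> by simp
  moreover have "(\<lambda>x. x / t) ` {0..t} = {0..1}"
    using \<open>t > 0\<close> image_divide_atLeastAtMost[of t 0 t] by simp
  ultimately have "volterra_mean g t = (1 / t) *\<^sub>R volterra g t"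
    unfolding volterra_mean_def by (simp add: integral_unique)
  then show ?thesis using False by simp
qed (simp add: volterra_def)

lemma continuous_on_volterra_mean:
  assumes g: "continuous_on {0..} g"
  shows "continuous_on {0..} (volterra_mean g)"
proof -
  have "continuous_on {0..} (\<lambda>t. integral (cbox 0 1) (\<lambda>\<sigma>. S (t - t * \<sigma>) (K (g (t * \<sigma>)))))"
  proof (rule integral_continuous_on_param)
    show "continuous_on ({0..} \<times> cbox 0 1) (\<lambda>(t, \<sigma>). S (t - t * \<sigma>) (K (g (t * \<sigma>))))"
      unfolding case_prod_unfold
      by (intro continuous_intros continuous_on_compose2[OF g])
        (auto simp: mult_left_le)
  qed
  then show ?thesis by (simp add: volterra_mean_def[abs_def])
qed

lemma continuous_on_volterra:
  assumes g: "continuous_on {0..} g"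
  shows "continuous_on {0..} (volterra g)"
proof -
  have "continuous_on {0..} (\<lambda>t. t *\<^sub>R volterra_mean g t)"
    by (intro continuous_intros continuous_on_volterra_mean g)
  then show ?thesis by (rule continuous_on_eq) (simp add: volterra_eq_mean[OF g])
qed

lemma volterra_mean_0: "volterra_mean g 0 = K (g 0)"
  by (simp add: volterra_mean_def)

text \<open>Each convolution raises the power of \<open>t\<close> by one and gains a factor of the
  factorial, which drives both uniqueness and the convergence of the series.\<close>

lemma volterra_bound:
  assumes g: "continuous_on {0..} g" and t: "0 \<le> t" "t \<le> \<tau>"
    and M: "\<And>s y. 0 \<le> s \<Longrightarrow> s \<le> \<tau> \<Longrightarrow> norm (S s y) \<le> M * norm y" "M \<ge> 0"
    and k: "\<And>y. norm (K y) \<le> k * norm y" "k \<ge> 0"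
    and c: "\<And>s. 0 \<le> s \<Longrightarrow> s \<le> \<tau> \<Longrightarrow> norm (g s) \<le> c * (s ^ n / fact n)"
  shows "norm (volterra g t) \<le> (M * k * c) * (t ^ Suc n / fact (Suc n))"
proof -
  have "((\<lambda>s. (M * k * c) * (s ^ n / fact n)) has_integral
      (M * k * c) * (t ^ Suc n / fact (Suc n)) - (M * k * c) * (0 ^ Suc n / fact (Suc n))) {0..t}"
  proof (rule fundamental_theorem_of_calculus[OF t(1)])
    fix s :: real
    have "((\<lambda>s. (M * k * c) * (s ^ Suc n / fact (Suc n))) has_real_derivative (M * k * c) * (s ^ n / fact n)) (at s within {0..t})"
      by (rule derivative_eq_intros refl | simp)+
    then show "((\<lambda>s. (M * k * c) * (s ^ Suc n / fact (Suc n))) has_vector_derivative (M * k * c) * (s ^ n / fact n)) (at s within {0..t})"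
      by (simp add: has_real_derivative_iff_has_vector_derivative)
  qed
  then have int: "((\<lambda>s. (M * k * c) * (s ^ n / fact n)) has_integral (M * k * c) * (t ^ Suc n / fact (Suc n))) {0..t}"
    by simp
  have "norm (volterra g t) \<le> integral {0..t} (\<lambda>s. (M * k * c) * (s ^ n / fact n))"
    unfolding volterra_def
  proof (rule integral_norm_bound_integral)
    fix s assume s: "s \<in> {0..t}"
    have "norm (S (t - s) (K (g s))) \<le> M * norm (K (g s))"
      using s t by (intro M(1)) auto
    also have "\<dots> \<le> M * (k * (c * (s ^ n / fact n)))"
      using s t by (intro mult_left_mono M(2) order_trans[OF k(1)] c k(2)) auto
    finally show "norm (S (t - s) (K (g s))) \<le> (M * k * c) * (s ^ n / fact n)"
      by (simp add: mult_ac)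
  qed (use int volterra_integrable[OF g] in \<open>auto simp: has_integral_iff\<close>)
  also have "\<dots> = (M * k * c) * (t ^ Suc n / fact (Suc n))"
    using int by (rule integral_unique)
  finally show ?thesis .
qed

lemma bounds:
  obtains M k where "M \<ge> 0" "\<And>s y. 0 \<le> s \<Longrightarrow> s \<le> \<tau> \<Longrightarrow> norm (S s y) \<le> M * norm y"
    "k \<ge> 0" "\<And>y. norm (K y) \<le> k * norm y"
proof -
  obtain M where "M \<ge> 1" "\<And>s y. 0 \<le> s \<Longrightarrow> s \<le> \<tau> \<Longrightarrow> norm (S s y) \<le> M * norm y"
    using local_bound[of \<tau>] by metis
  moreover obtain k where "k \<ge> 0" "\<And>y. norm (K y) \<le> norm y * k"
    using bounded_linear.nonneg_bounded[OF K_lin] by metis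
  ultimately show thesis by (intro that[of M k]) (auto simp: mult.commute)
qed

text \<open>The difference of two solutions is a fixed point of \<open>volterra\<close>, so the
  bound can be iterated indefinitely and tends to zero.\<close>

lemma volterra_unique:
  assumes y: "continuous_on {0..} y" "\<And>t. t \<ge> 0 \<Longrightarrow> y t = a t + volterra y t"
    and z: "continuous_on {0..} z" "\<And>t. t \<ge> 0 \<Longrightarrow> z t = a t + volterra z t"
    and t: "t \<ge> 0"
  shows "y t = z t"
proof -
  define w where "w s = y s - z s" for s
  have w: "continuous_on {0..} w" unfolding w_def by (intro continuous_intros y z)
  have w_eq: "w s = volterra w s" if "s \<ge> 0" for s
    using volterra_diff[OF y(1) z(1), of s] y(2)[OF that] z(2)[OF that] by (simp add: w_def[abs_def])
  obtain M k where Mk: "M \<ge> 0" "\<And>s y. 0 \<le> s \<Longrightarrow> s \<le> t \<Longrightarrow> norm (S s y) \<le> M * norm y"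
    "k \<ge> 0" "\<And>y. norm (K y) \<le> k * norm y" using bounds[of t] by metis
  have "compact (w ` {0..t})"
    by (intro compact_continuous_image continuous_on_subset[OF w]) auto
  then obtain c where c: "\<And>s. s \<in> {0..t} \<Longrightarrow> norm (w s) \<le> c"
    using compact_imp_bounded bounded_iff by (metis imageI)
  have "norm (w s) \<le> (c * (M * k) ^ n) * (s ^ n / fact n)" if "0 \<le> s" "s \<le> t" for n s
    using that
  proof (induction n arbitrary: s)
    case (Suc n)
    have "norm (volterra w s) \<le> (M * k * (c * (M * k) ^ n)) * (s ^ Suc n / fact (Suc n))"
      by (rule volterra_bound[OF w Suc.prems Mk(2,1,4,3) Suc.IH])
    then show ?case using w_eq[OF Suc.prems(1)] by (simp add: mult_ac)
  qed (use c in auto)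
  from this[OF t order_refl] have "norm (w t) \<le> c * ((M * k * t) ^ n / fact n)" for n
    by (simp add: power_mult_distrib mult_ac)
  moreover have "(\<lambda>n. c * ((M * k * t) ^ n / fact n)) \<longlonglongrightarrow> 0"
    by (intro tendsto_mult_right_zero power_over_fact_tendsto_0)
  ultimately have "norm (w t) \<le> 0"
    by (intro LIMSEQ_le_const[where X="\<lambda>n. c * ((M * k * t) ^ n / fact n)"]) auto
  then show ?thesis by (simp add: w_def)
qed

section \<open>The perturbed semigroup as a Dyson series\<close>

primrec dyson :: "nat \<Rightarrow> 'h \<Rightarrow> real \<Rightarrow> 'h" where
  "dyson 0 x = (\<lambda>t. S t x)"
| "dyson (Suc n) x = volterra (dyson n x)"

definition "V t x = (\<Sum>n. dyson n x t)"

lemma continuous_on_dyson: "continuous_on {0..} (dyson n x)"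
  by (induction n) (auto intro: continuous_on_orbit continuous_on_volterra)

lemma dyson_bound:
  assumes M: "\<And>s y. 0 \<le> s \<Longrightarrow> s \<le> \<tau> \<Longrightarrow> norm (S s y) \<le> M * norm y" "M \<ge> 0"
    and k: "\<And>y. norm (K y) \<le> k * norm y" "k \<ge> 0" and t: "0 \<le> t" "t \<le> \<tau>"
  shows "norm (dyson n x t) \<le> (M * norm x * (M * k) ^ n) * (t ^ n / fact n)"
  using t
proof (induction n arbitrary: t)
  case (Suc n)
  have "norm (volterra (dyson n x) t) \<le> (M * k * (M * norm x * (M * k) ^ n)) * (t ^ Suc n / fact (Suc n))"
    by (rule volterra_bound[OF continuous_on_dyson Suc.prems M k Suc.IH])
  then show ?case by (simp add: mult_ac)
qed (use M in simp)

lemma dyson_bound':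
  assumes M: "\<And>s y. 0 \<le> s \<Longrightarrow> s \<le> \<tau> \<Longrightarrow> norm (S s y) \<le> M * norm y" "M \<ge> 0"
    and k: "\<And>y. norm (K y) \<le> k * norm y" "k \<ge> 0" and t: "0 \<le> t" "t \<le> \<tau>"
  shows "norm (dyson n x t) \<le> M * norm x * ((M * k * \<tau>) ^ n / fact n)"
proof -
  have "norm (dyson n x t) \<le> (M * norm x * (M * k) ^ n) * (t ^ n / fact n)"
    by (rule dyson_bound[OF assms])
  also have "\<dots> \<le> (M * norm x * (M * k) ^ n) * (\<tau> ^ n / fact n)"
    using t M(2) k(2) by (intro mult_left_mono divide_right_mono power_mono) auto
  finally show ?thesis by (simp add: power_mult_distrib mult_ac)
qed

lemma summable_exp': "summable (\<lambda>n. c * (x ^ n / fact n))" for c x :: real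
  using summable_mult[OF summable_exp[of x], of c] by (simp add: field_simps)

lemma V_uniform_limit:
  "uniform_limit {0..\<tau>} (\<lambda>n t. \<Sum>i<n. dyson i x t) (\<lambda>t. V t x) sequentially"
proof -
  obtain M k where Mk: "M \<ge> 0" "\<And>s y. 0 \<le> s \<Longrightarrow> s \<le> \<tau> \<Longrightarrow> norm (S s y) \<le> M * norm y"
    "k \<ge> 0" "\<And>y. norm (K y) \<le> k * norm y" using bounds[of \<tau>] by metis
  show ?thesis unfolding V_def
    by (rule Weierstrass_m_test[OF _ summable_exp'[of "M * norm x" "M * k * \<tau>"]])
      (use dyson_bound'[OF Mk(2,1,4,3)] in auto)
qed

text \<open>The series converges uniformly on compact intervals; continuity at \<open>t\<close> is
  read off from \<open>{0..t + 1}\<close>, a neighbourhood of \<open>t\<close> within the half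
  line.\<close>

lemma continuous_on_V: "continuous_on {0..} (\<lambda>t. V t x)"
proof -
  have "continuous_on {0..\<tau>} (\<lambda>t. V t x)" for \<tau>
    by (rule uniform_limit_theorem[OF _ V_uniform_limit])
      (auto intro!: always_eventually continuous_intros continuous_on_subset[OF continuous_on_dyson])
  then have "continuous (at t within {0..}) (\<lambda>t. V t x)" if "t \<ge> 0" for t
  proof -
    have "continuous (at t within {0..t+1}) (\<lambda>t. V t x)"
      using \<open>\<And>\<tau>. continuous_on {0..\<tau>} (\<lambda>t. V t x)\<close> that
      by (auto simp: continuous_on_eq_continuous_within)
    moreover have "at t within {0..t+1} = at t within {0..}"
      by (rule at_within_nhd[of t "{..<t+1}"]) auto
    ultimately show ?thesis by (simp add: continuous_within)
  qed
  then show ?thesis by (auto simp: continuous_on_eq_continuous_within)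
qed

text \<open>Partial sums satisfy the equation with an index shift, and uniform convergence on
  \<open>{0..t}\<close> allows the limit under the integral.\<close>

lemma V_volterra:
  assumes t: "t \<ge> 0"
  shows "V t x = S t x + volterra (\<lambda>s. V s x) t"
proof -
  obtain M k where Mk: "M \<ge> 0" "\<And>s y. 0 \<le> s \<Longrightarrow> s \<le> t \<Longrightarrow> norm (S s y) \<le> M * norm y"
    "k \<ge> 0" "\<And>y. norm (K y) \<le> k * norm y" using bounds[of t] by metis
  define P where "P n s = (\<Sum>i<n. dyson i x s)" for n s
  have P: "continuous_on {0..} (P n)" for n
    unfolding P_def by (intro continuous_intros continuous_on_dyson)
  have P_V: "(\<lambda>n. P n s) \<longlonglongrightarrow> V s x" if "0 \<le> s" for s
    using tendsto_uniform_limitI[OF V_uniform_limit[of x s]] that by (simp add: P_def)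
  have P_Suc: "P (Suc n) t = S t x + volterra (P n) t" for n
  proof (induction n)
    case (Suc n)
    have "P (Suc n) = (\<lambda>s. P n s + dyson n x s)" by (auto simp: P_def)
    then have "volterra (P (Suc n)) t = volterra (P n) t + dyson (Suc n) x t"
      by (simp add: volterra_add P continuous_on_dyson)
    moreover have "P (Suc (Suc n)) t = P (Suc n) t + dyson (Suc n) x t"
      by (simp add: P_def)
    ultimately show ?case using Suc by simp
  next
    case 0
    have "integral {0..t} (\<lambda>s. S (t - s) 0) = 0"
      using integral_cong[of "{0..t}" "\<lambda>s. S (t - s) 0" "\<lambda>s. 0"] by (simp add: zero)
    then show ?case by (simp add: P_def volterra_def linear_0[OF K_linear])
  qed
  have "(\<lambda>n. volterra (P n) t) \<longlonglongrightarrow> volterra (\<lambda>s. V s x) t"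
  proof (rule LIMSEQ_I)
    fix e :: real assume e: "e > 0"
    define d where "d = e / (M * k * t + 1)"
    have pos: "M * k * t + 1 > 0" using Mk t by (simp add: add_nonneg_pos)
    have d: "d > 0" using e pos by (simp add: d_def)
    obtain N where N: "\<And>n s. n \<ge> N \<Longrightarrow> s \<in> {0..t} \<Longrightarrow> dist (P n s) (V s x) < d"
      using uniform_limitD[OF V_uniform_limit[of x t] d] unfolding eventually_sequentially P_def
      by blast
    have "norm (volterra (P n) t - volterra (\<lambda>s. V s x) t) < e" if n: "n \<ge> N" for n
    proof -
      have "norm (volterra (\<lambda>s. P n s - V s x) t) \<le> (M * k * d) * (t ^ Suc 0 / fact (Suc 0))"
        by (rule volterra_bound[OF _ t order_refl Mk(2,1,4,3)])
          (use N[OF n] P continuous_on_V in \<open>auto intro!: continuous_intros less_imp_le simp: dist_norm\<close>)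
      also have "\<dots> < (M * k * t + 1) * d" using d by (simp add: algebra_simps)
      also have "\<dots> = e" using pos by (simp add: d_def)
      finally show ?thesis by (simp add: volterra_diff P continuous_on_V)
    qed
    then show "\<exists>N. \<forall>n\<ge>N. norm (volterra (P n) t - volterra (\<lambda>s. V s x) t) < e" by blast
  qed
  then have "(\<lambda>n. P (Suc n) t) \<longlonglongrightarrow> S t x + volterra (\<lambda>s. V s x) t"
    unfolding P_Suc by (intro tendsto_intros)
  moreover have "(\<lambda>n. P (Suc n) t) \<longlonglongrightarrow> V t x"
    using P_V[OF t] by (rule LIMSEQ_Suc)
  ultimately show ?thesis using LIMSEQ_unique by blast
qed

lemma V_0: "V 0 x = x"
  using V_volterra[of 0 x] by (simp add: volterra_def)

text \<open>Linearity and the semigroup law of \<open>V\<close> are obtained from here: in each case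
  both sides solve the same Volterra equation.\<close>

lemma V_unique:
  assumes "continuous_on {0..} y" "\<And>t. t \<ge> 0 \<Longrightarrow> y t = S t x + volterra y t" "t \<ge> 0"
  shows "V t x = y t"
  by (rule volterra_unique[OF continuous_on_V V_volterra assms])

lemma V_add: "t \<ge> 0 \<Longrightarrow> V t (x + y) = V t x + V t y"
  by (rule V_unique)
    (auto intro!: continuous_intros continuous_on_V
      simp: volterra_add continuous_on_V plus V_volterra[of _ x] V_volterra[of _ y])

lemma V_scaleC: "t \<ge> 0 \<Longrightarrow> V t (scaleC c x) = scaleC c (V t x)"
  by (rule V_unique)
    (auto intro!: bounded_linear.continuous_on[OF bounded_linear_scaleC] continuous_on_V
      simp: volterra_scaleC continuous_on_V scaleC V_volterra[of _ x] scaleC_add_right)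

lemma bounded_clinear_V:
  assumes t: "t \<ge> 0"
  shows "bounded_clinear (V t)"
proof -
  obtain M k where Mk: "M \<ge> 0" "\<And>s y. 0 \<le> s \<Longrightarrow> s \<le> t \<Longrightarrow> norm (S s y) \<le> M * norm y"
    "k \<ge> 0" "\<And>y. norm (K y) \<le> k * norm y" using bounds[of t] by metis
  define C where "C = (\<Sum>n. (M * k * t) ^ n / fact n)"
  have "norm (V t x) \<le> norm x * (M * C)" for x
  proof -
    have "norm (V t x) \<le> (\<Sum>n. M * norm x * ((M * k * t) ^ n / fact n))"
      unfolding V_def
      by (rule norm_suminf_le[OF _ summable_exp']) (rule dyson_bound'[OF Mk(2,1,4,3) t order_refl])
    also have "\<dots> = M * norm x * C"
      unfolding C_def by (rule suminf_mult) (use summable_exp'[of 1 "M * k * t"] in simp)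
    finally show ?thesis by (simp add: mult_ac)
  qed
  then have "bounded_linear (V t)"
    by (intro bounded_linear_intro[where K="M * C"])
      (use t in \<open>auto simp: V_add V_scaleC scaleR_scaleC\<close>)
  then show ?thesis using V_scaleC[OF t] by (simp add: bounded_clinear_def)
qed

text \<open>The shifted orbit solves the equation started at \<open>V r x\<close>: when the
  convolution is split at \<open>r\<close>, its first part, moved by \<open>S t\<close>, goes into
  the initial value.\<close>

lemma V_semigroup:
  assumes r: "r \<ge> 0" and t: "t \<ge> 0"
  shows "V (t + r) x = V t (V r x)"
proof (rule V_unique[symmetric, OF _ _ t])
  show "continuous_on {0..} (\<lambda>t. V (t + r) x)"
    by (rule continuous_on_compose2[OF continuous_on_V]) (use r in \<open>auto intro!: continuous_intros\<close>)
  fix t :: real assume t: "t \<ge> 0"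
  let ?F = "\<lambda>s. S (t + r - s) (K (V s x))"
  have int: "?F integrable_on {a..b}" if "0 \<le> a" "b \<le> t + r" for a b
    by (rule volterra_integrable[OF continuous_on_V]) (use that in auto)
  have "volterra (\<lambda>s. V s x) (t + r) = integral {0..r} ?F + integral {r..t + r} ?F"
    unfolding volterra_def
    by (rule Henstock_Kurzweil_Integration.integral_combine[symmetric]) (use r t int in auto)
  also have "integral {0..r} ?F = S t (volterra (\<lambda>s. V s x) r)"
  proof -
    have "integral {0..r} ?F = integral {0..r} (\<lambda>s. S t (S (r - s) (K (V s x))))"
      using r t by (intro integral_cong) (simp flip: S_add add: algebra_simps)
    then show ?thesis
      using integral_S[OF t volterra_integrable[OF continuous_on_V, of r r 0]]
      by (simp add: volterra_def)
  qed
  also have "integral {r..t + r} ?F = volterra (\<lambda>s. V (s + r) x) t"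
    using integral_shift_real_ivl[of r r "t + r" ?F] by (simp add: volterra_def)
  finally have "V (t + r) x = S (t + r) x + (S t (volterra (\<lambda>s. V s x) r) + volterra (\<lambda>s. V (s + r) x) t)"
    using V_volterra[of "t + r" x] r t by simp
  also have "S (t + r) x + (S t (volterra (\<lambda>s. V s x) r) + volterra (\<lambda>s. V (s + r) x) t)
      = S t (V r x) + volterra (\<lambda>s. V (s + r) x) t"
    using V_volterra[OF r, of x] r t by (simp add: S_add plus)
  finally show "V (t + r) x = S t (V r x) + volterra (\<lambda>s. V (s + r) x) t" .
qed

lemma C0_V: "C0_semigroup V"
proof -
  have "((\<lambda>t. V t x) \<longlongrightarrow> x) (at_right 0)" for x
  proof -
    have "((\<lambda>t. V t x) \<longlongrightarrow> V 0 x) (at 0 within {0..})"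
      using continuous_on_V by (auto simp: continuous_on_def)
    then show ?thesis by (simp add: V_0 at_within_Ici_at_right)
  qed
  then show ?thesis
    unfolding C0_semigroup_def using bounded_clinear_V V_0 V_semigroup by auto
qed

text \<open>The two difference quotients differ by \<open>volterra_mean\<close>, which converges to
  \<open>K x\<close> for every \<open>x\<close>. Hence one converges exactly when the other does,
  and the domains agree as well.\<close>

lemma generator_V: "generator V = perturb (generator S) K"
proof
  interpret V: c0_semigroup V by unfold_locales (rule C0_V)
  fix x
  have mean: "(volterra_mean (\<lambda>s. V s x) \<longlongrightarrow> K x) (at_right 0)"
  proof -
    have "(volterra_mean (\<lambda>s. V s x) \<longlongrightarrow> volterra_mean (\<lambda>s. V s x) 0) (at 0 within {0..})"
      using continuous_on_volterra_mean[OF continuous_on_V] by (auto simp: continuous_on_def)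
    then show ?thesis by (simp add: volterra_mean_0 V_0 at_within_Ici_at_right)
  qed
  have eq: "(V t x - x) /\<^sub>R t = (S t x - x) /\<^sub>R t + volterra_mean (\<lambda>s. V s x) t" if "t > 0" for t
    using V_volterra[of t x] volterra_eq_mean[OF continuous_on_V, of t x] that
    by (simp add: scaleR_diff_right scaleR_add_right)
  have "((\<lambda>t. (V t x - x) /\<^sub>R t) \<longlongrightarrow> y) (at_right 0) \<longleftrightarrow>
      ((\<lambda>t. (S t x - x) /\<^sub>R t) \<longlongrightarrow> y - K x) (at_right 0)" for y
  proof
    assume "((\<lambda>t. (V t x - x) /\<^sub>R t) \<longlongrightarrow> y) (at_right 0)"
    from tendsto_diff[OF this mean]
    show "((\<lambda>t. (S t x - x) /\<^sub>R t) \<longlongrightarrow> y - K x) (at_right 0)"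
      by (rule Lim_transform_eventually)
        (use eventually_at_right_pos in eventually_elim, simp add: eq)
  next
    assume "((\<lambda>t. (S t x - x) /\<^sub>R t) \<longlongrightarrow> y - K x) (at_right 0)"
    from tendsto_add[OF this mean]
    have "((\<lambda>t. (S t x - x) /\<^sub>R t + volterra_mean (\<lambda>s. V s x) t) \<longlongrightarrow> y) (at_right 0)" by simp
    then show "((\<lambda>t. (V t x - x) /\<^sub>R t) \<longlongrightarrow> y) (at_right 0)"
      by (rule Lim_transform_eventually)
        (use eventually_at_right_pos in eventually_elim, simp add: eq)
  qed
  then have iff: "generator V x = Some y \<longleftrightarrow> generator S x = Some (y - K x)" for y
    by (simp only: generator_iff V.generator_iff)
  show "generator V x = perturb (generator S) K x"
    by (intro option_eqI) (simp only: perturb_eq_Some iff)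
qed

end

lemma generates_perturb:
  assumes "generates_C0_semigroup A" "bounded_clinear K"
  shows "generates_C0_semigroup (perturb A K)"
proof -
  obtain S where S: "C0_semigroup S" "generator S = A"
    using assms(1) by (auto simp: generates_C0_semigroup_def)
  interpret perturbed_semigroup S K by unfold_locales (use S assms in auto)
  show ?thesis using C0_V generator_V S by (auto simp: generates_C0_semigroup_def)
qed

subsection \<open>The adjoint semigroup\<close>

text \<open>By density at most one \<open>y\<close> fits, so the definite description in
  \<open>adjoint_op\<close> can be used in both directions.\<close>

lemma adjoint_op_iff:
  assumes dense: "closure (dom A) = UNIV"
  shows "adjoint_op A f = Some y \<longleftrightarrow> (\<forall>x\<in>dom A. cinner (the (A x)) f = cinner x y)"
proof -
  have uniq: "y = z" if "\<forall>x\<in>dom A. cinner (the (A x)) f = cinner x y"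
    "\<forall>x\<in>dom A. cinner (the (A x)) f = cinner x z" for y z
  proof -
    have "inner (y - z) x = 0" if "x \<in> dom A" for x
      using \<open>\<forall>x\<in>dom A. cinner (the (A x)) f = cinner x y\<close> \<open>\<forall>x\<in>dom A. cinner (the (A x)) f = cinner x z\<close> that
      by (metis Re_cinner eq_iff_diff_eq_0 inner_commute inner_diff_left)
    then have "inner (y - z) (y - z) = 0"
      using orthogonal_closure[of "dom A" "y - z" "y - z"] dense by blast
    then show ?thesis by simp
  qed
  show ?thesis
  proof
    assume *: "adjoint_op A f = Some y"
    then have ex: "\<exists>y. \<forall>x\<in>dom A. cinner (the (A x)) f = cinner x y"
      unfolding adjoint_op_def by (metis option.distinct(1))
    then have y: "(THE y. \<forall>x\<in>dom A. cinner (the (A x)) f = cinner x y) = y"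
      using * by (simp add: adjoint_op_def)
    have "\<exists>!y. \<forall>x\<in>dom A. cinner (the (A x)) f = cinner x y"
      by (rule ex_ex1I[OF ex uniq])
    from theI'[OF this] show "\<forall>x\<in>dom A. cinner (the (A x)) f = cinner x y"
      unfolding y .
  next
    assume *: "\<forall>x\<in>dom A. cinner (the (A x)) f = cinner x y"
    then have "(THE y. \<forall>x\<in>dom A. cinner (the (A x)) f = cinner x y) = y"
      using uniq by (intro the_equality) auto
    then show "adjoint_op A f = Some y"
      using * unfolding adjoint_op_def by auto
  qed
qed

lemma adjoint_perturb:
  assumes dense: "closure (dom A) = UNIV" and K: "bounded_clinear K"
  shows "adjoint_op (perturb A K) = perturb (adjoint_op A) (bounded_adjoint K)"
proof
  fix f
  have "adjoint_op (perturb A K) f = Some y \<longleftrightarrow> adjoint_op A f = Some (y - bounded_adjoint K f)" for y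
    using dense
    by (simp add: adjoint_op_iff the_perturb cinner_add_left cinner.diff_right
        cinner_bounded_adjoint[OF K] eq_diff_eq)
  then show "adjoint_op (perturb A K) f = perturb (adjoint_op A) (bounded_adjoint K) f"
    by (intro option_eqI) (simp only: perturb_eq_Some)
qed

context c0_semigroup
begin

lemma bounded_clinear_orbit_integral:
  assumes "t \<ge> 0"
  shows "bounded_clinear (orbit_integral t)"
proof -
  obtain M where M: "M \<ge> 1" "\<And>s y. 0 \<le> s \<Longrightarrow> s \<le> t \<Longrightarrow> norm (S s y) \<le> M * norm y"
    using local_bound[of t] by metis
  have "bounded_linear (orbit_integral t)"
    by (rule bounded_linear_intro[where K="M * t"])
      (use norm_orbit_integral_le[OF assms order_refl M(2)] in
        \<open>auto simp: orbit_integral_add orbit_integral_scaleR mult_ac\<close>)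
  then show ?thesis by (simp add: bounded_clinear_def orbit_integral_scaleC)
qed

abbreviation "Sa t \<equiv> bounded_adjoint (S t)"
abbreviation "Da \<equiv> dom (adjoint_op (generator S))"

lemma adjoint_iff: "adjoint_op (generator S) f = Some y \<longleftrightarrow> (\<forall>x\<in>D. cinner (G x) f = cinner x y)"
  by (rule adjoint_op_iff[OF closure_D])

lemma adjoint_D:
  assumes "f \<in> Da" "x \<in> D"
  shows "cinner (G x) f = cinner x (the (adjoint_op (generator S) f))"
  using assms adjoint_iff[of f "the (adjoint_op (generator S) f)"] by auto

lemma subspace_Da: "subspace Da"
proof (rule subspaceI)
  show "0 \<in> Da" using adjoint_iff[of 0 0] by (auto simp: cinner.zero_right)
  fix x y assume "x \<in> Da" "y \<in> Da"
  then have "adjoint_op (generator S) (x + y) =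
      Some (the (adjoint_op (generator S) x) + the (adjoint_op (generator S) y))"
    by (simp add: adjoint_iff adjoint_D cinner_add_right)
  then show "x + y \<in> Da" by auto
next
  fix r x assume "x \<in> Da"
  then have "adjoint_op (generator S) (r *\<^sub>R x) = Some (r *\<^sub>R the (adjoint_op (generator S) x))"
    by (simp add: adjoint_iff adjoint_D cinner.scaleR_right)
  then show "r *\<^sub>R x \<in> Da" by auto
qed

text \<open>A stock of elements of \<open>Da\<close> that is available before the adjoint semigroup
  is known to be strongly continuous.\<close>

lemma adjoint_orbit_integral_in_Da:
  assumes "t \<ge> 0"
  shows "bounded_adjoint (orbit_integral t) f \<in> Da"
proof -
  have "adjoint_op (generator S) (bounded_adjoint (orbit_integral t) f) = Some (Sa t f - f)"
    using assms
    by (simp add: adjoint_iff orbit_integral_generator cinner.diff_left cinner.diff_right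
        cinner_bounded_adjoint[OF clin] flip: cinner_bounded_adjoint[OF bounded_clinear_orbit_integral])
  then show ?thesis by auto
qed

text \<open>A vector orthogonal to \<open>Da\<close> has vanishing orbit integrals, yet it is the
  limit of its averages.\<close>

lemma closure_Da: "closure Da = UNIV"
proof (rule dense_subspaceI[OF subspace_Da])
  fix z assume z: "\<And>x. x \<in> Da \<Longrightarrow> inner z x = 0"
  have "orbit_integral h z = 0" if "h > 0" for h
  proof -
    have "inner (orbit_integral h z) f = 0" for f
      using z[OF adjoint_orbit_integral_in_Da[of h f]] that
        inner_bounded_adjoint[OF bounded_clinear_orbit_integral, of h z f] by simp
    then show ?thesis using inner_eq_zero_iff by blast
  qed
  then have "\<forall>\<^sub>F h in at_right 0. orbit_integral h z /\<^sub>R h = 0"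
    using eventually_at_right_pos by (auto elim: eventually_mono)
  with average_tendsto[of z] have "((\<lambda>h. 0) \<longlongrightarrow> z) (at_right (0::real))"
    by (rule Lim_transform_eventually)
  then show "z = 0" by (simp add: tendsto_const_iff)
qed

lemma adjoint_orbit_eq:
  assumes "adjoint_op (generator S) f = Some y" "t \<ge> 0"
  shows "cinner h (Sa t f - f) = cinner (orbit_integral t h) y"
proof -
  have "cinner (G (orbit_integral t h)) f = cinner (orbit_integral t h) y"
    using assms generator_orbit_integral(1)[OF assms(2)] unfolding adjoint_iff by blast
  then show ?thesis
    using assms(2)
    by (simp add: generator_orbit_integral cinner.diff_left cinner.diff_right cinner_bounded_adjoint[OF clin])
qed

text \<open>On \<open>Da\<close> the adjoint orbit moves at most linearly in \<open>t\<close>, as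
  seen by testing \<open>adjoint_orbit_eq\<close> with the displacement itself. Density of
  \<open>Da\<close> and the local bound, which adjoints inherit, extend continuity to all
  vectors.\<close>

lemma C0_adjoint: "C0_semigroup Sa"
proof -
  obtain M where M: "M \<ge> 1" "\<And>s y. 0 \<le> s \<Longrightarrow> s \<le> 1 \<Longrightarrow> norm (S s y) \<le> M * norm y"
    using local_bound[of 1] by metis
  have Ma: "norm (Sa s y) \<le> M * norm y" if "0 \<le> s" "s \<le> 1" for s y
    using that M by (intro norm_bounded_adjoint_le clin) auto
  have Da_bound: "norm (Sa t w - w) \<le> t * (M * norm (the (adjoint_op (generator S) w)))"
    if w: "w \<in> Da" and t: "0 \<le> t" "t \<le> 1" for w t
  proof -
    let ?v = "Sa t w - w" and ?y = "the (adjoint_op (generator S) w)"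
    have "norm ?v * norm ?v = Re (cinner ?v ?v)"
      by (simp add: cinner_self power2_eq_square)
    also have "\<dots> = Re (cinner (orbit_integral t ?v) ?y)"
      using adjoint_orbit_eq[of w ?y t ?v] w t by (simp add: domIff)
    also have "\<dots> \<le> norm (orbit_integral t ?v) * norm ?y"
      by (intro order_trans[OF complex_Re_le_cmod norm_cinner_le])
    also have "\<dots> \<le> (M * t * norm ?v) * norm ?y"
      using t M by (intro mult_right_mono norm_orbit_integral_le) auto
    finally have "norm ?v * norm ?v \<le> (t * (M * norm ?y)) * norm ?v" by (simp add: mult_ac)
    then show ?thesis
      using t M(1) by (cases "?v = 0") (auto simp: mult_le_cancel_right)
  qed
  have "((\<lambda>t. Sa t x) \<longlongrightarrow> x) (at_right 0)" for x
  proof (rule tendstoI)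
    fix e :: real assume e: "e > 0"
    have "e / (2 * (M + 1)) > 0" using e M by simp
    then obtain w where w: "w \<in> Da" "dist w x < e / (2 * (M + 1))"
      using closure_Da closure_approachable by (metis UNIV_I)
    let ?C = "M * norm (the (adjoint_op (generator S) w))"
    have "((\<lambda>t. t * ?C) \<longlongrightarrow> 0) (at_right 0)"
      by (intro tendsto_mult_left_zero tendsto_ident_at)
    then have "\<forall>\<^sub>F t in at_right 0. t * ?C < e / 2"
      by (rule order_tendstoD) (use e in simp)
    moreover have "\<forall>\<^sub>F t in at_right (0::real). t < 1"
      by (rule order_tendstoD(2)[OF tendsto_ident_at]) simp
    ultimately show "\<forall>\<^sub>F t in at_right 0. dist (Sa t x) x < e"
      using eventually_at_right_pos
    proof eventually_elim
      case (elim t)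
      have eq: "Sa t x - x = (Sa t w - w) + (w - x) - Sa t (w - x)"
        using linear_diff[OF bounded_linear.linear[OF bounded_clinearD(1)[OF bounded_clinear_bounded_adjoint[OF clin]]], of t w x] elim
        by simp
      have "norm (Sa t x - x) \<le> norm (Sa t w - w) + norm (w - x) + norm (Sa t (w - x))"
        using norm_triangle_ineq4[of "(Sa t w - w) + (w - x)" "Sa t (w - x)"]
          norm_triangle_ineq[of "Sa t w - w" "w - x"] unfolding eq by linarith
      also have "\<dots> \<le> t * ?C + norm (w - x) + M * norm (w - x)"
        using elim w by (intro add_mono Da_bound Ma order_refl) auto
      also have "\<dots> = t * ?C + (M + 1) * norm (w - x)" by (simp add: algebra_simps)
      also have "\<dots> < e / 2 + (M + 1) * (e / (2 * (M + 1)))"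
        using elim w(2) M(1) by (intro add_strict_mono mult_strict_left_mono) (auto simp: dist_norm)
      also have "\<dots> = e" using M(1) by (simp add: field_simps)
      finally show ?case by (simp add: dist_norm)
    qed
  qed
  moreover have "Sa 0 x = x" for x
    by (rule cinner_eqI) (simp flip: cinner_bounded_adjoint[OF clin])
  moreover have "Sa (s + t) x = Sa s (Sa t x)" if "s \<ge> 0" "t \<ge> 0" for s t x
    by (rule cinner_eqI)
      (use that S_add[of t s] in \<open>simp flip: cinner_bounded_adjoint[OF clin] add: add.commute\<close>)
  ultimately show ?thesis
    unfolding C0_semigroup_def using bounded_clinear_bounded_adjoint[OF clin] by blast
qed

text \<open>Differentiating the pairing shows that the generator is a restriction of the adjoint.
  Conversely, \<open>Sa t x - x\<close> is the orbit integral of the value \<open>y\<close> of the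
  adjoint at \<open>x\<close>, and its averages converge to \<open>y\<close>.\<close>

lemma generator_adjoint: "generator Sa = adjoint_op (generator S)"
proof -
  interpret adj: c0_semigroup Sa by unfold_locales (rule C0_adjoint)
  have "generator Sa x = Some y \<longleftrightarrow> adjoint_op (generator S) x = Some y" for x y
  proof
    assume "generator Sa x = Some y"
    then have lim: "((\<lambda>t. (Sa t x - x) /\<^sub>R t) \<longlongrightarrow> y) (at_right 0)"
      by (simp add: adj.generator_iff)
    have "cinner (G w) x = cinner w y" if "w \<in> D" for w
    proof -
      have "((\<lambda>t. cinner ((S t w - w) /\<^sub>R t) x) \<longlongrightarrow> cinner (G w) x) (at_right 0)"
        by (intro cinner.tendsto generator_tendsto that tendsto_const)
      moreover have "\<forall>\<^sub>F t in at_right 0. cinner ((S t w - w) /\<^sub>R t) x = cinner w ((Sa t x - x) /\<^sub>R t)"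
        using eventually_at_right_pos
        by eventually_elim
          (simp add: cinner.scaleR_left cinner.scaleR_right cinner.diff_left cinner.diff_right
            cinner_bounded_adjoint[OF clin])
      ultimately have "((\<lambda>t. cinner w ((Sa t x - x) /\<^sub>R t)) \<longlongrightarrow> cinner (G w) x) (at_right 0)"
        by (rule Lim_transform_eventually)
      moreover have "((\<lambda>t. cinner w ((Sa t x - x) /\<^sub>R t)) \<longlongrightarrow> cinner w y) (at_right 0)"
        by (intro cinner.tendsto tendsto_const lim)
      ultimately show ?thesis
        using tendsto_unique[OF trivial_limit_at_right_real] by blast
    qed
    then show "adjoint_op (generator S) x = Some y" by (simp add: adjoint_iff)
  next
    assume A: "adjoint_op (generator S) x = Some y"
    have "Sa t x - x = adj.orbit_integral t y" if t: "t \<ge> 0" for t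
    proof (rule cinner_eqI)
      fix h
      have "cinner (orbit_integral t h) y = integral {0..t} ((\<lambda>v. cinner v y) \<circ> (\<lambda>s. S s h))"
        unfolding orbit_integral_def
        by (rule integral_linear[OF integrable_orbit cinner.bounded_linear_left, symmetric]) simp
      also have "\<dots> = integral {0..t} ((\<lambda>v. cinner h v) \<circ> (\<lambda>s. Sa s y))"
        by (intro integral_cong) (simp add: cinner_bounded_adjoint[OF clin])
      also have "\<dots> = cinner h (adj.orbit_integral t y)"
        unfolding adj.orbit_integral_def
        by (rule integral_linear[OF adj.integrable_orbit cinner.bounded_linear_right]) simp
      finally show "cinner h (Sa t x - x) = cinner h (adj.orbit_integral t y)"
        using adjoint_orbit_eq[OF A t] by simp
    qed
    then have "\<forall>\<^sub>F t in at_right 0. adj.orbit_integral t y /\<^sub>R t = (Sa t x - x) /\<^sub>R t"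
      using eventually_at_right_pos by (auto elim: eventually_mono)
    from Lim_transform_eventually[OF adj.average_tendsto this]
    show "generator Sa x = Some y" by (simp add: adj.generator_iff)
  qed
  then show ?thesis by (intro ext option_eqI)
qed

end

section \<open>Observation of semigroups\<close>

text \<open>Fubini's theorem for the integrand extended by zero from the triangle to the plane. It
  is phrased with gauge integrals because the output energies are.\<close>

lemma integral_swap_triangle:
  fixes \<phi> :: "real \<Rightarrow> real \<Rightarrow> real"
  assumes cont: "continuous_on {(t, s). 0 \<le> s \<and> s \<le> t \<and> t \<le> \<tau>} (\<lambda>(t, s). \<phi> t s)"
  shows "(\<lambda>t. integral {0..t} (\<phi> t)) integrable_on {0..\<tau>}"
    and "(\<lambda>s. integral {s..\<tau>} (\<lambda>t. \<phi> t s)) integrable_on {0..\<tau>}"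
    and "integral {0..\<tau>} (\<lambda>t. integral {0..t} (\<phi> t)) = integral {0..\<tau>} (\<lambda>s. integral {s..\<tau>} (\<lambda>t. \<phi> t s))"
proof -
  define X where "X = {(t, s). 0 \<le> s \<and> s \<le> t \<and> t \<le> \<tau>}"
  define f where "f t s = indicator X (t, s) *\<^sub>R \<phi> t s" for t s
  have "X = ({0..\<tau>} \<times> {0..\<tau>}) \<inter> {p. snd p \<le> fst p}" by (auto simp: X_def)
  moreover have "closed {p :: real \<times> real. snd p \<le> fst p}"
    by (intro closed_Collect_le continuous_intros)
  ultimately have "compact X"
    by (simp add: compact_Int_closed compact_Times)
  from borel_integrable_compact[OF this cont[folded X_def]]
  have int: "integrable (lborel \<Otimes>\<^sub>M lborel) (\<lambda>(t, s). f t s)"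
    by (simp add: lborel_prod f_def case_prod_unfold)
  have cont_t: "continuous_on {0..t} (\<phi> t)" if "t \<in> {0..\<tau>}" for t
  proof -
    have "continuous_on {0..t} (\<lambda>s. case (t, s) of (t, s) \<Rightarrow> \<phi> t s)"
      by (rule continuous_on_compose2[OF cont]) (use that in \<open>auto intro!: continuous_intros\<close>)
    then show ?thesis by simp
  qed
  have cont_s: "continuous_on {s..\<tau>} (\<lambda>t. \<phi> t s)" if "s \<in> {0..\<tau>}" for s
  proof -
    have "continuous_on {s..\<tau>} (\<lambda>t. case (t, s) of (t, s) \<Rightarrow> \<phi> t s)"
      by (rule continuous_on_compose2[OF cont]) (use that in \<open>auto intro!: continuous_intros\<close>)
    then show ?thesis by simp
  qed
  have set_int: "integral\<^sup>L lborel (\<lambda>x. indicator {a..b} x *\<^sub>R g x) = integral {a..b} g"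
    if "continuous_on {a..b} g" for a b and g :: "real \<Rightarrow> real"
    using set_borel_integral_eq_integral(2)[of "{a..b}" g] borel_integrable_compact[OF _ that]
    by (simp add: set_integrable_def set_lebesgue_integral_def)
  have inner_t: "integral\<^sup>L lborel (f t) = indicator {0..\<tau>} t *\<^sub>R integral {0..t} (\<phi> t)" for t
  proof (cases "t \<in> {0..\<tau>}")
    case True
    then have "f t = (\<lambda>s. indicator {0..t} s *\<^sub>R \<phi> t s)"
      by (auto simp: f_def X_def indicator_def)
    then show ?thesis using set_int[OF cont_t[OF True]] True by simp
  next
    case False
    then have "f t = (\<lambda>s. 0)" by (auto simp: f_def X_def indicator_def)
    then show ?thesis using False by simp
  qed
  have inner_s: "integral\<^sup>L lborel (\<lambda>t. f t s) = indicator {0..\<tau>} s *\<^sub>R integral {s..\<tau>} (\<lambda>t. \<phi> t s)" for s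
  proof (cases "s \<in> {0..\<tau>}")
    case True
    then have "(\<lambda>t. f t s) = (\<lambda>t. indicator {s..\<tau>} t *\<^sub>R \<phi> t s)"
      by (auto simp: f_def X_def indicator_def)
    then show ?thesis using set_int[OF cont_s[OF True]] True by simp
  next
    case False
    then have "(\<lambda>t. f t s) = (\<lambda>t. 0)" by (auto simp: f_def X_def indicator_def)
    then show ?thesis using False by simp
  qed
  have 1: "set_integrable lborel {0..\<tau>} (\<lambda>t. integral {0..t} (\<phi> t))"
    using lborel_pair.integrable_fst[OF int] by (simp add: inner_t set_integrable_def)
  have 2: "set_integrable lborel {0..\<tau>} (\<lambda>s. integral {s..\<tau>} (\<lambda>t. \<phi> t s))"
    using lborel_pair.integrable_snd[OF int] by (simp add: inner_s set_integrable_def)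
  show "(\<lambda>t. integral {0..t} (\<phi> t)) integrable_on {0..\<tau>}"
    "(\<lambda>s. integral {s..\<tau>} (\<lambda>t. \<phi> t s)) integrable_on {0..\<tau>}"
    using set_borel_integral_eq_integral(1) 1 2 by blast+
  show "integral {0..\<tau>} (\<lambda>t. integral {0..t} (\<phi> t)) = integral {0..\<tau>} (\<lambda>s. integral {s..\<tau>} (\<lambda>t. \<phi> t s))"
    using lborel_pair.Fubini_integral[OF int] set_borel_integral_eq_integral(2)[OF 1]
      set_borel_integral_eq_integral(2)[OF 2]
    by (simp add: inner_t inner_s set_lebesgue_integral_def)
qed

text \<open>The Cauchy-Schwarz inequality in time, obtained from the nonnegative variance of
  \<open>norm (f s)\<close> about its mean \<open>a / t\<close>.\<close>

lemma norm_integral_square_le: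
  fixes f :: "real \<Rightarrow> 'a::banach"
  assumes f: "continuous_on {0..t} f" and t: "t \<ge> 0"
  shows "(norm (integral {0..t} f))\<^sup>2 \<le> t * integral {0..t} (\<lambda>s. (norm (f s))\<^sup>2)"
proof (cases "t = 0")
  case False
  then have "t > 0" using t by simp
  define a where "a = integral {0..t} (\<lambda>s. norm (f s))"
  define b where "b = integral {0..t} (\<lambda>s. (norm (f s))\<^sup>2)"
  have int: "(\<lambda>s. norm (f s)) integrable_on {0..t}" "(\<lambda>s. (norm (f s))\<^sup>2) integrable_on {0..t}"
    by (intro integrable_continuous_interval continuous_intros f)+
  have "0 \<le> integral {0..t} (\<lambda>s. (norm (f s) - a / t)\<^sup>2)"
    by (intro integral_nonneg integrable_continuous_interval continuous_intros f) auto
  also have "\<dots> = integral {0..t} (\<lambda>s. (norm (f s))\<^sup>2 - (2 * a / t) * norm (f s) + (a / t)\<^sup>2)"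
    by (intro integral_cong) (simp add: power2_eq_square algebra_simps)
  also have "\<dots> = b - (2 * a / t) * a + (a / t)\<^sup>2 * t"
  proof (rule integral_unique)
    have "((\<lambda>s. norm (f s)) has_integral a) {0..t}" "((\<lambda>s. (norm (f s))\<^sup>2) has_integral b) {0..t}"
      using int by (simp_all add: a_def b_def integrable_integral)
    moreover have "((\<lambda>s. (a / t)\<^sup>2) has_integral (a / t)\<^sup>2 * t) {0..t}"
      using has_integral_const_real[of "(a / t)\<^sup>2" 0 t] t by (simp add: mult.commute)
    ultimately show "((\<lambda>s. (norm (f s))\<^sup>2 - (2 * a / t) * norm (f s) + (a / t)\<^sup>2) has_integral
        b - (2 * a / t) * a + (a / t)\<^sup>2 * t) {0..t}"
      by (intro has_integral_add has_integral_diff has_integral_mult_right)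
  qed
  also have "\<dots> = b - a\<^sup>2 / t"
    using \<open>t > 0\<close> by (simp add: field_simps power2_eq_square)
  finally have "a\<^sup>2 \<le> t * b"
    using \<open>t > 0\<close> by (simp add: field_simps)
  moreover have "norm (integral {0..t} f) \<le> a"
    unfolding a_def
    by (rule integral_norm_bound_integral[OF integrable_continuous_interval[OF f] int(1)]) simp
  then have "(norm (integral {0..t} f))\<^sup>2 \<le> a\<^sup>2" by (intro power_mono) auto
  ultimately show ?thesis by (simp add: b_def)
qed simp

lemma norm_add_square_le: "(norm (x + y))\<^sup>2 \<le> 2 * (norm x)\<^sup>2 + 2 * (norm (y :: 'a::real_normed_vector))\<^sup>2"
proof -
  have "(norm (x + y))\<^sup>2 \<le> (norm x + norm y)\<^sup>2"
    by (intro power_mono norm_triangle_ineq) simp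
  also have "\<dots> \<le> 2 * (norm x)\<^sup>2 + 2 * (norm y)\<^sup>2"
    using zero_le_power2[of "norm x - norm y"] by (simp add: power2_eq_square algebra_simps)
  finally show ?thesis .
qed

text \<open>\<open>C\<close> is a total function constrained only on the domain, where it is bounded
  for the graph norm; hence outputs are considered along orbits of domain vectors.\<close>

locale observation = c0_semigroup S for S :: "real \<Rightarrow> 'h::complex_hilbert \<Rightarrow> 'h" +
  fixes C :: "'h \<Rightarrow> 'u::complex_hilbert" and c :: real
  assumes C_add: "x \<in> D \<Longrightarrow> y \<in> D \<Longrightarrow> C (x + y) = C x + C y"
    and C_scaleC: "x \<in> D \<Longrightarrow> C (scaleC a x) = scaleC a (C x)"
    and C_bound: "x \<in> D \<Longrightarrow> norm (C x) \<le> c * (norm x + norm (G x))"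
    and c_nonneg: "c \<ge> 0"
begin

lemma C_scaleR: "x \<in> D \<Longrightarrow> C (r *\<^sub>R x) = r *\<^sub>R C x"
  by (simp add: scaleR_scaleC C_scaleC)

lemma C_diff: "x \<in> D \<Longrightarrow> y \<in> D \<Longrightarrow> C (x - y) = C x - C y"
  using C_add[of x "- 1 *\<^sub>R y"] C_scaleR[of y "- 1"] generator_scaleR(1)[of y "- 1"] by simp

lemma tendsto_C:
  assumes f: "(f \<longlongrightarrow> x) F" "((\<lambda>a. G (f a)) \<longlongrightarrow> G x) F" "\<forall>\<^sub>F a in F. f a \<in> D" "x \<in> D"
  shows "((\<lambda>a. C (f a)) \<longlongrightarrow> C x) F"
proof -
  have "((\<lambda>a. c * (norm (f a - x) + norm (G (f a) - G x))) \<longlongrightarrow> c * (0 + 0)) F"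
    using f(1,2) by (intro tendsto_mult tendsto_add tendsto_const tendsto_norm_zero LIM_zero)
  then have lim: "((\<lambda>a. c * (norm (f a - x) + norm (G (f a) - G x))) \<longlongrightarrow> 0) F" by simp
  have "\<forall>\<^sub>F a in F. norm (C (f a) - C x) \<le> c * (norm (f a - x) + norm (G (f a) - G x))"
    using f(3)
  proof eventually_elim
    case (elim a)
    then show ?case
      using C_bound[OF generator_diff(1)[OF elim f(4)]] C_diff[OF elim f(4)] generator_diff(2)[OF elim f(4)]
      by simp
  qed
  then have "((\<lambda>a. C (f a) - C x) \<longlongrightarrow> 0) F"
    by (rule Lim_null_comparison[OF _ lim])
  then show ?thesis by (simp add: LIM_zero_iff)
qed

lemma continuous_on_C:
  assumes "continuous_on X f" "continuous_on X (\<lambda>a. G (f a))" "\<And>a. a \<in> X \<Longrightarrow> f a \<in> D"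
  shows "continuous_on X (\<lambda>a. C (f a))"
  using assms unfolding continuous_on_def
  by (auto intro!: tendsto_C simp: eventually_at_filter)

lemma continuous_on_output:
  assumes "x \<in> D"
  shows "continuous_on {0..} (\<lambda>t. C (S t x))"
proof (rule continuous_on_C)
  have "continuous_on {0..} (\<lambda>t. S t (G x))" by (rule continuous_on_orbit)
  then show "continuous_on {0..} (\<lambda>t. G (S t x))"
    by (rule continuous_on_eq) (simp add: generator_S assms)
qed (use assms generator_S continuous_on_orbit in auto)

definition "energy \<tau> x = integral {0..\<tau>} (\<lambda>t. (norm (C (S t x)))\<^sup>2)"

lemma continuous_on_output_square:
  assumes "x \<in> D" "a \<ge> 0"
  shows "continuous_on {a..b} (\<lambda>t. (norm (C (S t x)))\<^sup>2)"
  by (intro continuous_intros continuous_on_subset[OF continuous_on_output[OF assms(1)]]) (use assms in auto)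

lemma integrable_output:
  "x \<in> D \<Longrightarrow> a \<ge> 0 \<Longrightarrow> (\<lambda>t. (norm (C (S t x)))\<^sup>2) integrable_on {a..b}"
  by (rule integrable_continuous_interval[OF continuous_on_output_square])

lemma energy_nonneg: "0 \<le> energy \<tau> x"
  unfolding energy_def by (cases "(\<lambda>t. (norm (C (S t x)))\<^sup>2) integrable_on {0..\<tau>}")
    (auto intro: integral_nonneg simp: not_integrable_integral)

lemma energy_split:
  assumes x: "x \<in> D" and a: "a \<ge> 0" and b: "b \<ge> 0"
  shows "energy (a + b) x = energy a x + energy b (S a x)"
proof -
  let ?f = "\<lambda>t. (norm (C (S t x)))\<^sup>2"
  have "energy (a + b) x = integral {0..a} ?f + integral {a..a + b} ?f"
    unfolding energy_def
    by (rule Henstock_Kurzweil_Integration.integral_combine[symmetric])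
      (use a b x in \<open>auto intro: integrable_output\<close>)
  also have "integral {a..a + b} ?f = integral {0..b} (\<lambda>t. ?f (t + a))"
    using integral_shift_real_ivl[of a a "a + b" ?f] by (simp add: add.commute)
  also have "\<dots> = energy b (S a x)"
    unfolding energy_def using a by (intro integral_cong) (simp add: S_add)
  finally show ?thesis by (simp add: energy_def)
qed

lemma energy_mono:
  assumes "x \<in> D" "0 \<le> \<sigma>" "\<sigma> \<le> \<tau>"
  shows "energy \<sigma> x \<le> energy \<tau> x"
  using energy_split[OF assms(1,2), of "\<tau> - \<sigma>"] energy_nonneg[of "\<tau> - \<sigma>" "S \<sigma> x"] assms by simp

lemma energy_S_le:
  assumes "x \<in> D" "0 \<le> t" "t \<le> \<tau>"
  shows "energy (\<tau> - t) (S t x) \<le> energy \<tau> x"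
  using energy_split[OF assms(1,2), of "\<tau> - t"] energy_nonneg[of t x] assms by simp

lemma energy_add:
  assumes x: "x \<in> D" and y: "y \<in> D"
  shows "energy \<tau> (x + y) \<le> 2 * energy \<tau> x + 2 * energy \<tau> y"
proof -
  have "energy \<tau> (x + y) \<le> integral {0..\<tau>} (\<lambda>t. 2 * (norm (C (S t x)))\<^sup>2 + 2 * (norm (C (S t y)))\<^sup>2)"
    unfolding energy_def
  proof (rule integral_le)
    show "(norm (C (S t (x + y))))\<^sup>2 \<le> 2 * (norm (C (S t x)))\<^sup>2 + 2 * (norm (C (S t y)))\<^sup>2"
      if "t \<in> {0..\<tau>}" for t
      using that norm_add_square_le[of "C (S t x)" "C (S t y)"] generator_S(1)[OF x] generator_S(1)[OF y]
      by (simp add: plus C_add)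
    show "(\<lambda>t. (norm (C (S t (x + y))))\<^sup>2) integrable_on {0..\<tau>}"
      by (intro integrable_output generator_add x y order_refl)
    show "(\<lambda>t. 2 * (norm (C (S t x)))\<^sup>2 + 2 * (norm (C (S t y)))\<^sup>2) integrable_on {0..\<tau>}"
      by (intro integrable_continuous_interval continuous_on_add continuous_on_mult_left
          continuous_on_output_square x y order_refl)
  qed
  also have "\<dots> = 2 * energy \<tau> x + 2 * energy \<tau> y"
    using integrable_output[OF x order_refl] integrable_output[OF y order_refl]
    by (simp add: energy_def integral_add integrable_on_cmult_left)
  finally show ?thesis .
qed

lemma energy_scaleC:
  assumes x: "x \<in> D"
  shows "energy \<tau> (scaleC a x) = (cmod a)\<^sup>2 * energy \<tau> x"
proof -
  have "energy \<tau> (scaleC a x) = integral {0..\<tau>} (\<lambda>t. (cmod a)\<^sup>2 * (norm (C (S t x)))\<^sup>2)"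
    unfolding energy_def using generator_S(1)[OF x]
    by (intro integral_cong) (simp add: scaleC C_scaleC norm_scaleC power_mult_distrib)
  then show ?thesis by (simp add: energy_def)
qed

lemma energy_scaleR: "x \<in> D \<Longrightarrow> energy \<tau> (r *\<^sub>R x) = r\<^sup>2 * energy \<tau> x"
  using energy_scaleC[of x \<tau> "of_real r"] by (simp add: scaleR_scaleC)

lemma energy_diff:
  assumes x: "x \<in> D" and y: "y \<in> D"
  shows "energy \<tau> (x - y) \<le> 2 * energy \<tau> x + 2 * energy \<tau> y"
  using energy_add[OF x generator_scaleR(1)[OF y, of "- 1"], of \<tau>] energy_scaleR[OF y, of \<tau> "- 1"] by simp

text \<open>A long interval is cut into pieces of length \<open>\<tau>0\<close>; the energy on each
  piece is bounded through the state at its beginning.\<close>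

lemma admissible_all_times:
  assumes t0: "\<tau>0 > 0" and m: "\<And>x. x \<in> D \<Longrightarrow> energy \<tau>0 x \<le> m * (norm x)\<^sup>2"
  shows "\<exists>m'\<ge>0. \<forall>x\<in>D. energy \<tau> x \<le> m' * (norm x)\<^sup>2"
proof -
  have m': "energy \<tau>0 x \<le> \<bar>m\<bar> * (norm x)\<^sup>2" if "x \<in> D" for x
    using m[OF that] by (meson abs_ge_self mult_right_mono order_trans zero_le_power2)
  have *: "\<exists>m'\<ge>0. \<forall>x\<in>D. energy (real n * \<tau>0) x \<le> m' * (norm x)\<^sup>2" for n
  proof (induction n)
    case 0
    show ?case by (intro exI[of _ 0]) (simp add: energy_def)
  next
    case (Suc n)
    then obtain q where q: "q \<ge> 0" "\<And>x. x \<in> D \<Longrightarrow> energy (real n * \<tau>0) x \<le> q * (norm x)\<^sup>2" by blast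
    obtain M where M: "M \<ge> 1" "\<And>s y. 0 \<le> s \<Longrightarrow> s \<le> \<tau>0 \<Longrightarrow> norm (S s y) \<le> M * norm y"
      using local_bound[of \<tau>0] by metis
    have "energy (real (Suc n) * \<tau>0) x \<le> (\<bar>m\<bar> + q * M\<^sup>2) * (norm x)\<^sup>2" if x: "x \<in> D" for x
    proof -
      have "energy (real (Suc n) * \<tau>0) x = energy \<tau>0 x + energy (real n * \<tau>0) (S \<tau>0 x)"
        using energy_split[OF x, of \<tau>0 "real n * \<tau>0"] t0 by (simp add: algebra_simps)
      also have "\<dots> \<le> \<bar>m\<bar> * (norm x)\<^sup>2 + q * (norm (S \<tau>0 x))\<^sup>2"
        using t0 x by (intro add_mono m' q generator_S) auto
      also have "\<dots> \<le> \<bar>m\<bar> * (norm x)\<^sup>2 + q * (M * norm x)\<^sup>2"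
        using t0 q(1) by (intro add_mono mult_left_mono power_mono M) auto
      finally show ?thesis by (simp add: algebra_simps power_mult_distrib)
    qed
    then show ?case using q(1) by (intro exI[of _ "\<bar>m\<bar> + q * M\<^sup>2"]) auto
  qed
  obtain n where "\<tau> / \<tau>0 \<le> real n" using real_arch_simple by blast
  then have n: "\<tau> \<le> real n * \<tau>0" using t0 by (simp add: field_simps)
  obtain q where q: "q \<ge> 0" "\<And>x. x \<in> D \<Longrightarrow> energy (real n * \<tau>0) x \<le> q * (norm x)\<^sup>2" using * by blast
  show ?thesis
  proof (cases "\<tau> \<ge> 0")
    case True
    then show ?thesis using q energy_mono[OF _ True n] by (meson order_trans)
  next
    case False
    then show ?thesis by (intro exI[of _ 0]) (simp add: energy_def)
  qed
qed

end

section \<open>Regularisation by orbit averages\<close>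

context c0_semigroup
begin

definition "average h x = orbit_integral h x /\<^sub>R h"

lemma average_in_D: "h > 0 \<Longrightarrow> average h x \<in> D"
  unfolding average_def by (intro generator_scaleR generator_orbit_integral) simp

lemma generator_average: "h > 0 \<Longrightarrow> G (average h x) = (S h x - x) /\<^sub>R h"
  by (simp add: average_def generator_scaleR generator_orbit_integral)

lemma generator_average': "h > 0 \<Longrightarrow> x \<in> D \<Longrightarrow> G (average h x) = average h (G x)"
  by (simp add: generator_average orbit_integral_generator average_def[of h "G x"])

lemma average_S: "r \<ge> 0 \<Longrightarrow> average h (S r x) = S r (average h x)"
  by (simp add: average_def orbit_integral_S scaleR)

lemma average_add: "average h (x + y) = average h x + average h y"
  by (simp add: average_def orbit_integral_add scaleR_add_right)

lemma average_scaleR: "average h (r *\<^sub>R x) = r *\<^sub>R average h x"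
  by (simp add: average_def orbit_integral_scaleR)

lemma norm_average_le:
  assumes "0 < h" "h \<le> \<tau>" "\<And>s y. 0 \<le> s \<Longrightarrow> s \<le> \<tau> \<Longrightarrow> norm (S s y) \<le> M * norm y"
  shows "norm (average h x) \<le> M * norm x"
  using norm_orbit_integral_le[of h \<tau> M x] assms by (simp add: average_def field_simps)

lemma average_sequence_tendsto: "(\<lambda>n. average (1 / Suc n) x) \<longlonglongrightarrow> x"
  unfolding average_def
  by (rule filterlim_compose[OF average_tendsto])
    (auto simp: filterlim_at simp del: of_nat_Suc intro!: lim_1_over_n[THEN LIMSEQ_Suc])

end

context observation
begin

text \<open>The average lies in the domain, and the generator sends it to
  \<open>(S h x - x) /\<^sub>R h\<close>, which is bounded in \<open>x\<close>. The bound
  deteriorates like \<open>1 / h\<close>, so it serves only for continuity and for exchanging the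
  operator with integrals.\<close>

lemma bounded_linear_C_average:
  assumes h: "h > 0"
  shows "bounded_linear (\<lambda>x. C (average h x))"
proof -
  obtain M where M: "M \<ge> 1" "\<And>s y. 0 \<le> s \<Longrightarrow> s \<le> h \<Longrightarrow> norm (S s y) \<le> M * norm y"
    using local_bound[of h] by metis
  have "norm (C (average h x)) \<le> norm x * (c * (M + (M + 1) / h))" for x
  proof -
    have "norm (S h x - x) \<le> M * norm x + norm x"
      using norm_triangle_ineq4[of "S h x" x] M(2)[of h x] h by simp
    then have "norm (S h x - x) / h \<le> (M + 1) * norm x / h"
      using h by (intro divide_right_mono) (auto simp: algebra_simps)
    moreover have "norm (G (average h x)) = norm (S h x - x) / h"
      using h by (simp add: generator_average divide_inverse mult.commute)
    ultimately have "norm (G (average h x)) \<le> (M + 1) / h * norm x"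
      by simp
    then have "norm (average h x) + norm (G (average h x)) \<le> (M + (M + 1) / h) * norm x"
      using norm_average_le[OF h order_refl M(2)] unfolding distrib_right by (intro add_mono)
    then have "c * (norm (average h x) + norm (G (average h x))) \<le> c * ((M + (M + 1) / h) * norm x)"
      by (rule mult_left_mono[OF _ c_nonneg])
    then show ?thesis
      using C_bound[OF average_in_D[OF h], of x] by (simp add: mult_ac)
  qed
  then show ?thesis
    using h by (intro bounded_linear_intro) (auto simp: average_add average_scaleR C_add C_scaleR average_in_D)
qed

end

section \<open>Outputs of a perturbed semigroup\<close>

locale perturbed_observation = observation S C c
  for S :: "real \<Rightarrow> 'h::complex_hilbert \<Rightarrow> 'h" and C :: "'h \<Rightarrow> 'u::complex_hilbert" and c +
  fixes T :: "real \<Rightarrow> 'h \<Rightarrow> 'h" and K :: "'h \<Rightarrow> 'h"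
  assumes T_C0: "C0_semigroup T"
    and gen_T: "generator T = perturb (generator S) K"
    and K: "bounded_linear K"
begin

sublocale T: c0_semigroup T by unfold_locales (rule T_C0)

lemma T_D: "T.D = D" by (simp add: gen_T)

lemma T_G: "x \<in> D \<Longrightarrow> T.G x = G x + K x" by (simp add: gen_T the_perturb)

sublocale T: observation T C "c * (1 + onorm K)"
proof
  fix x assume "x \<in> T.D"
  then have x: "x \<in> D" by (simp add: T_D)
  \<comment> \<open>\<open>G x\<close> is the perturbed generator minus \<open>K x\<close>, which is
    where the factor \<open>1 + onorm K\<close> comes from.\<close>
  have "norm (G x) \<le> norm (T.G x) + onorm K * norm x"
    using norm_triangle_ineq4[of "T.G x" "K x"] onorm[OF K, of x] by (simp add: T_G[OF x])
  then have "norm x + norm (G x) \<le> (1 + onorm K) * (norm x + norm (T.G x))"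
    using mult_nonneg_nonneg[OF onorm_pos_le[OF K] norm_ge_zero[of "T.G x"]]
    by (simp add: algebra_simps)
  then have "c * (norm x + norm (G x)) \<le> c * ((1 + onorm K) * (norm x + norm (T.G x)))"
    by (rule mult_left_mono[OF _ c_nonneg])
  then show "norm (C x) \<le> c * (1 + onorm K) * (norm x + norm (T.G x))"
    using C_bound[OF x] by (simp add: mult.assoc)
qed (use c_nonneg onorm_pos_le[OF K] in \<open>auto simp: T_D C_add C_scaleC intro!: mult_nonneg_nonneg\<close>)

text \<open>The integrand of the Duhamel formula need not lie in the domain of \<open>C\<close>, so \<open>C\<close> is first
  replaced by the bounded operator \<open>x \<mapsto> C (average h x)\<close>, uniformly in \<open>h\<close>.\<close>

lemma perturbation_estimate:
  assumes \<tau>: "\<tau> \<ge> 0" and m: "m \<ge> 0" "\<And>x. x \<in> D \<Longrightarrow> energy \<tau> x \<le> m * (norm x)\<^sup>2"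
  shows "\<exists>N\<ge>0. \<forall>x\<in>D. integral {0..\<tau>} (\<lambda>t. (norm (C (T t x - S t x)))\<^sup>2)
    \<le> N * integral {0..\<tau>} (\<lambda>s. (norm (K (T s x)))\<^sup>2)"
proof -
  obtain M where M: "M \<ge> 1" "\<And>s y. 0 \<le> s \<Longrightarrow> s \<le> max \<tau> 1 \<Longrightarrow> norm (S s y) \<le> M * norm y"
    using local_bound[of "max \<tau> 1"] by metis
  \<comment> \<open>\<open>\<tau>\<close> comes from Cauchy-Schwarz in time, \<open>m\<close> from
    admissibility, and \<open>M\<^sup>2\<close> from the norm of the averages; none of them depends
    on \<open>h\<close>.\<close>
  define N where "N = \<tau> * (m * M\<^sup>2)"
  have "integral {0..\<tau>} (\<lambda>t. (norm (C (T t x - S t x)))\<^sup>2) \<le> N * integral {0..\<tau>} (\<lambda>s. (norm (K (T s x)))\<^sup>2)"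
    if x: "x \<in> D" for x
  proof -
    define g where "g s = K (T s x)" for s
    define y where "y t = T t x - S t x" for t
    have g: "continuous_on {0..} g"
      unfolding g_def by (intro bounded_linear.continuous_on[OF K] T.continuous_on_orbit)
    have g_sq: "(\<lambda>s. (norm (g s))\<^sup>2) integrable_on {0..\<tau>}"
      by (intro integrable_continuous_interval continuous_intros continuous_on_subset[OF g]) auto
    have y_int: "y t = integral {0..t} (\<lambda>s. S (t - s) (g s))" if "t \<ge> 0" for t
      using duhamel[OF T.c0_semigroup_axioms gen_T K x that] by (simp add: y_def g_def)
    have y_D: "y t \<in> D" if "t \<ge> 0" for t
      unfolding y_def
      by (rule generator_diff(1)) (use generator_S(1)[OF x that] T.generator_S(1)[of x t] x that T_D in simp_all)
    have y_cont: "continuous_on {0..} y"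
      unfolding y_def by (intro continuous_intros T.continuous_on_orbit continuous_on_orbit)
    have Gy: "G (y t) = T t (T.G x) - g t - S t (G x)" if "t \<ge> 0" for t
    proof -
      have Ttx: "T t x \<in> D" using T.generator_S(1)[of x t] x that by (simp add: T_D)
      have "G (T t x) = T t (T.G x) - g t"
        using T_G[OF Ttx] T.generator_S(2)[of x t] x that by (simp add: T_D g_def)
      then show ?thesis
        using generator_diff(2)[OF Ttx generator_S(1)[OF x that]] generator_S(2)[OF x that]
        by (simp add: y_def)
    qed
    have Gy_cont: "continuous_on {0..} (\<lambda>t. G (y t))"
    proof -
      have "continuous_on {0..} (\<lambda>t. T t (T.G x) - g t - S t (G x))"
        by (intro continuous_intros T.continuous_on_orbit continuous_on_orbit g)
      then show ?thesis by (rule continuous_on_eq) (simp add: Gy)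
    qed
    have avg: "integral {0..\<tau>} (\<lambda>t. (norm (C (average h (y t))))\<^sup>2) \<le> N * integral {0..\<tau>} (\<lambda>s. (norm (g s))\<^sup>2)"
      if h: "0 < h" "h \<le> 1" for h
    proof -
      define A where "A v = C (average h v)" for v
      have A: "bounded_linear A" unfolding A_def by (rule bounded_linear_C_average[OF h(1)])
      define \<phi> where "\<phi> t s = (norm (A (S (t - s) (g s))))\<^sup>2" for t s
      have cont: "continuous_on {(t, s). 0 \<le> s \<and> s \<le> t \<and> t \<le> \<tau>} (\<lambda>(t, s). \<phi> t s)"
        unfolding \<phi>_def case_prod_unfold
        by (intro continuous_intros bounded_linear.continuous_on[OF A] continuous_on_compose2[OF g])
          auto
      note swap = integral_swap_triangle[OF cont]
      have A_y: "(norm (A (y t)))\<^sup>2 \<le> \<tau> * integral {0..t} (\<phi> t)" if t: "t \<in> {0..\<tau>}" for t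
      proof -
        have Sg: "continuous_on {0..t} (\<lambda>s. S (t - s) (g s))"
          by (intro continuous_intros continuous_on_subset[OF g]) auto
        have "A (y t) = integral {0..t} (\<lambda>s. A (S (t - s) (g s)))"
          using integral_linear[OF integrable_continuous_interval[OF Sg] A] y_int[of t] t by (simp add: comp_def)
        then have "(norm (A (y t)))\<^sup>2 \<le> t * integral {0..t} (\<phi> t)"
          unfolding \<phi>_def
          using norm_integral_square_le[OF bounded_linear.continuous_on[OF A Sg]] t by simp
        also have "\<dots> \<le> \<tau> * integral {0..t} (\<phi> t)"
          unfolding \<phi>_def using t
          by (intro mult_right_mono integral_nonneg integrable_continuous_interval continuous_intros
              bounded_linear.continuous_on[OF A Sg]) auto
        finally show ?thesis .
      qed
      \<comment> \<open>For fixed \<open>s\<close> the integral over \<open>t\<close> is the energy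
        of the vector \<open>average h (g s)\<close>, because averages commute with the semigroup.
        This is where admissibility enters.\<close>
      have \<phi>_le: "integral {s..\<tau>} (\<lambda>t. \<phi> t s) \<le> m * M\<^sup>2 * (norm (g s))\<^sup>2" if s: "s \<in> {0..\<tau>}" for s
      proof -
        have "integral {s..\<tau>} (\<lambda>t. \<phi> t s) = integral {0..\<tau> - s} (\<lambda>r. \<phi> (r + s) s)"
          using integral_shift_real_ivl[of s s \<tau> "\<lambda>t. \<phi> t s"] by simp
        also have "\<dots> = energy (\<tau> - s) (average h (g s))"
          unfolding energy_def \<phi>_def A_def by (intro integral_cong) (simp add: average_S)
        also have "\<dots> \<le> energy \<tau> (average h (g s))"
          using s by (intro energy_mono average_in_D h) auto
        also have "\<dots> \<le> m * (norm (average h (g s)))\<^sup>2"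
          by (intro m average_in_D h)
        also have "\<dots> \<le> m * (M * norm (g s))\<^sup>2"
          using h M(2) by (intro mult_left_mono power_mono m norm_average_le[where \<tau>=1]) auto
        finally show ?thesis by (simp add: power_mult_distrib)
      qed
      have "integral {0..\<tau>} (\<lambda>t. (norm (A (y t)))\<^sup>2) \<le> integral {0..\<tau>} (\<lambda>t. \<tau> * integral {0..t} (\<phi> t))"
      proof (rule integral_le)
        show "(\<lambda>t. (norm (A (y t)))\<^sup>2) integrable_on {0..\<tau>}"
          by (intro integrable_continuous_interval continuous_intros bounded_linear.continuous_on[OF A]
              continuous_on_subset[OF y_cont]) auto
        show "(\<lambda>t. \<tau> * integral {0..t} (\<phi> t)) integrable_on {0..\<tau>}"
          using integrable_on_mult_right[OF swap(1), of \<tau>] .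
      qed (rule A_y)
      also have "\<dots> = \<tau> * integral {0..\<tau>} (\<lambda>s. integral {s..\<tau>} (\<lambda>t. \<phi> t s))"
        by (simp add: swap(3))
      also have "\<dots> \<le> \<tau> * integral {0..\<tau>} (\<lambda>s. m * M\<^sup>2 * (norm (g s))\<^sup>2)"
        by (intro mult_left_mono \<tau> integral_le swap(2) \<phi>_le integrable_on_mult_right g_sq)
      also have "\<dots> = N * integral {0..\<tau>} (\<lambda>s. (norm (g s))\<^sup>2)"
        by (simp add: N_def mult.assoc)
      finally show ?thesis by (simp add: A_def)
    qed
    \<comment> \<open>A bound on the graph norm of \<open>y t\<close> gives a majorant independent
      of \<open>h\<close>: on the domain the generator commutes with averages, so
      \<open>C_bound\<close> applies without a factor \<open>1 / h\<close>.\<close>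
    have "bounded ((\<lambda>t. norm (y t) + norm (G (y t))) ` {0..\<tau>})"
      by (intro compact_imp_bounded compact_continuous_image continuous_intros
          continuous_on_subset[OF y_cont] continuous_on_subset[OF Gy_cont]) auto
    then obtain B where B: "\<And>t. t \<in> {0..\<tau>} \<Longrightarrow> norm (y t) + norm (G (y t)) \<le> B"
      unfolding bounded_iff by force
    define F where "F n t = (norm (C (average (1 / Suc n) (y t))))\<^sup>2" for n t
    have "(\<lambda>n. integral {0..\<tau>} (F n)) \<longlonglongrightarrow> integral {0..\<tau>} (\<lambda>t. (norm (C (y t)))\<^sup>2)"
    proof (rule dominated_convergence(2))
      show "F n integrable_on {0..\<tau>}" for n
        unfolding F_def
        by (intro integrable_continuous_interval continuous_intros continuous_on_subset[OF y_cont]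
            bounded_linear.continuous_on[OF bounded_linear_C_average]) auto
      show "(\<lambda>t. (c * (M * B))\<^sup>2) integrable_on {0..\<tau>}" by (rule integrable_const_ivl)
      show "norm (F n t) \<le> (c * (M * B))\<^sup>2" if t: "t \<in> {0..\<tau>}" for n t
      proof -
        let ?h = "1 / real (Suc n)"
        have h: "?h > 0" "?h \<le> 1" by auto
        have avg_le: "norm (average ?h v) \<le> M * norm v" for v
          using h M(2) by (intro norm_average_le[where \<tau>=1]) auto
        have yD: "y t \<in> D" using y_D t by simp
        have "norm (C (average ?h (y t))) \<le> c * (norm (average ?h (y t)) + norm (average ?h (G (y t))))"
          using C_bound[OF average_in_D[OF h(1)], of "y t"] by (simp only: generator_average'[OF h(1) yD])
        also have "\<dots> \<le> c * (M * norm (y t) + M * norm (G (y t)))"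
          by (intro mult_left_mono add_mono avg_le c_nonneg)
        also have "\<dots> \<le> c * (M * B)"
          using B[OF t] M(1) by (intro mult_left_mono c_nonneg) (simp flip: distrib_left)
        finally show ?thesis by (simp add: F_def power_mono)
      qed
      show "(\<lambda>n. F n t) \<longlonglongrightarrow> (norm (C (y t)))\<^sup>2" if t: "t \<in> {0..\<tau>}" for t
      proof -
        have yD: "y t \<in> D" using y_D t by simp
        have "(\<lambda>n. C (average (1 / Suc n) (y t))) \<longlonglongrightarrow> C (y t)"
        proof (rule tendsto_C)
          show "(\<lambda>n. G (average (1 / Suc n) (y t))) \<longlonglongrightarrow> G (y t)"
            using average_sequence_tendsto[of "G (y t)"] by (simp add: generator_average'[OF _ yD])
        qed (use average_in_D yD average_sequence_tendsto in auto)
        then show ?thesis unfolding F_def by (intro tendsto_intros)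
      qed
    qed
    then have "integral {0..\<tau>} (\<lambda>t. (norm (C (y t)))\<^sup>2) \<le> N * integral {0..\<tau>} (\<lambda>s. (norm (g s))\<^sup>2)"
      by (rule LIMSEQ_le_const2) (use avg in \<open>auto simp: F_def[abs_def]\<close>)
    then show ?thesis by (simp add: y_def g_def)
  qed
  moreover have "N \<ge> 0" using \<tau> m(1) by (simp add: N_def)
  ultimately show ?thesis by blast
qed

text \<open>The first inequality transfers admissibility to the perturbed semigroup, the second
  transfers observability up to the term with \<open>K\<close>. The factor \<open>2\<close> comes
  from squaring the triangle inequality.\<close>

lemma energy_comparison:
  assumes \<tau>: "\<tau> \<ge> 0" and m: "m \<ge> 0" "\<And>x. x \<in> D \<Longrightarrow> energy \<tau> x \<le> m * (norm x)\<^sup>2"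
  shows "\<exists>N\<ge>0. \<forall>x\<in>D.
    T.energy \<tau> x \<le> 2 * energy \<tau> x + N * integral {0..\<tau>} (\<lambda>s. (norm (K (T s x)))\<^sup>2) \<and>
    energy \<tau> x \<le> 2 * T.energy \<tau> x + N * integral {0..\<tau>} (\<lambda>s. (norm (K (T s x)))\<^sup>2)"
proof -
  obtain N where N: "N \<ge> 0" "\<And>x. x \<in> D \<Longrightarrow> integral {0..\<tau>} (\<lambda>t. (norm (C (T t x - S t x)))\<^sup>2)
    \<le> N * integral {0..\<tau>} (\<lambda>s. (norm (K (T s x)))\<^sup>2)"
    using perturbation_estimate[OF assms] by blast
  have "T.energy \<tau> x \<le> 2 * energy \<tau> x + 2 * N * integral {0..\<tau>} (\<lambda>s. (norm (K (T s x)))\<^sup>2) \<and>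
    energy \<tau> x \<le> 2 * T.energy \<tau> x + 2 * N * integral {0..\<tau>} (\<lambda>s. (norm (K (T s x)))\<^sup>2)"
    if x: "x \<in> D" for x
  proof -
    have xT: "x \<in> T.D" using x by (simp add: T_D)
    have in_D: "S t x \<in> D" "T t x \<in> D" if "t \<ge> 0" for t
      using generator_S(1)[OF x that] T.generator_S(1)[OF xT that] by (simp_all add: T_D)
    let ?d = "\<lambda>t. (norm (C (T t x - S t x)))\<^sup>2"
    have d_eq: "C (T t x - S t x) = C (T t x) - C (S t x)" if "t \<ge> 0" for t
      using in_D[OF that] by (simp add: C_diff)
    have "continuous_on {0..\<tau>} (\<lambda>t. (norm (C (T t x) - C (S t x)))\<^sup>2)"
      by (intro continuous_intros continuous_on_subset[OF continuous_on_output[OF x]]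
          continuous_on_subset[OF T.continuous_on_output[OF xT]]) auto
    then have d_cont: "continuous_on {0..\<tau>} ?d"
      by (rule continuous_on_eq) (simp add: d_eq)
    note cS = continuous_on_output_square[OF x order_refl, of \<tau>]
    note cT = T.continuous_on_output_square[OF xT order_refl, of \<tau>]
    note int = integrable_continuous_interval
    have sum: "integral {0..\<tau>} (\<lambda>t. 2 * f t + 2 * ?d t) = 2 * integral {0..\<tau>} f + 2 * integral {0..\<tau>} ?d"
      if "continuous_on {0..\<tau>} f" for f
      using int[OF that] int[OF d_cont]
      by (subst integral_add) (auto intro!: integrable_on_mult_right)
    have "T.energy \<tau> x \<le> integral {0..\<tau>} (\<lambda>t. 2 * (norm (C (S t x)))\<^sup>2 + 2 * ?d t)"
      unfolding T.energy_def
    proof (rule integral_le)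
      show "(norm (C (T t x)))\<^sup>2 \<le> 2 * (norm (C (S t x)))\<^sup>2 + 2 * ?d t" if "t \<in> {0..\<tau>}" for t
        using norm_add_square_le[of "C (S t x)" "C (T t x) - C (S t x)"] d_eq that by simp
    qed (intro int cS cT d_cont continuous_intros)+
    moreover have "energy \<tau> x \<le> integral {0..\<tau>} (\<lambda>t. 2 * (norm (C (T t x)))\<^sup>2 + 2 * ?d t)"
      unfolding energy_def
    proof (rule integral_le)
      show "(norm (C (S t x)))\<^sup>2 \<le> 2 * (norm (C (T t x)))\<^sup>2 + 2 * ?d t" if "t \<in> {0..\<tau>}" for t
        using norm_add_square_le[of "C (T t x)" "C (S t x) - C (T t x)"] d_eq that
        by (simp add: norm_minus_commute)
    qed (intro int cS cT d_cont continuous_intros)+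
    ultimately show ?thesis
      using N(2)[OF x] unfolding sum[OF cS] sum[OF cT] energy_def T.energy_def by linarith
  qed
  then show ?thesis using N(1) by (intro exI[of _ "2 * N"]) auto
qed

lemma K_orbit_bound:
  assumes \<tau>: "\<tau> \<ge> 0"
  shows "\<exists>q\<ge>0. \<forall>x. integral {0..\<tau>} (\<lambda>s. (norm (K (T s x)))\<^sup>2) \<le> q * (norm x)\<^sup>2"
proof -
  obtain M where M: "M \<ge> 1" "\<And>s y. 0 \<le> s \<Longrightarrow> s \<le> \<tau> \<Longrightarrow> norm (T s y) \<le> M * norm y"
    using T.local_bound[of \<tau>] by metis
  define q where "q = (onorm K * M)\<^sup>2 * \<tau>"
  have "integral {0..\<tau>} (\<lambda>s. (norm (K (T s x)))\<^sup>2) \<le> q * (norm x)\<^sup>2" for x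
  proof -
    have "integral {0..\<tau>} (\<lambda>s. (norm (K (T s x)))\<^sup>2) \<le> integral {0..\<tau>} (\<lambda>s. (onorm K * (M * norm x))\<^sup>2)"
    proof (rule integral_le)
      show "(\<lambda>s. (norm (K (T s x)))\<^sup>2) integrable_on {0..\<tau>}"
        by (intro integrable_continuous_interval continuous_intros bounded_linear.continuous_on[OF K]
            continuous_on_subset[OF T.continuous_on_orbit]) auto
      show "(norm (K (T s x)))\<^sup>2 \<le> (onorm K * (M * norm x))\<^sup>2" if "s \<in> {0..\<tau>}" for s
        using that onorm_pos_le[OF K]
        by (intro power_mono order_trans[OF onorm[OF K]] mult_left_mono M(2)) auto
    qed (rule integrable_const_ivl)
    also have "\<dots> = q * (norm x)\<^sup>2"
      using \<tau> by (simp add: q_def power_mult_distrib)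
    finally show ?thesis .
  qed
  moreover have "q \<ge> 0" using \<tau> by (simp add: q_def)
  ultimately show ?thesis by blast
qed

lemma T_admissible:
  assumes \<tau>: "\<tau> \<ge> 0" and m: "m \<ge> 0" "\<And>x. x \<in> D \<Longrightarrow> energy \<tau> x \<le> m * (norm x)\<^sup>2"
  shows "\<exists>m'\<ge>0. \<forall>x\<in>D. T.energy \<tau> x \<le> m' * (norm x)\<^sup>2"
proof -
  obtain N where N: "N \<ge> 0" "\<And>x. x \<in> D \<Longrightarrow>
    T.energy \<tau> x \<le> 2 * energy \<tau> x + N * integral {0..\<tau>} (\<lambda>s. (norm (K (T s x)))\<^sup>2)"
    using energy_comparison[OF assms] by blast
  obtain q where q: "q \<ge> 0" "\<And>x. integral {0..\<tau>} (\<lambda>s. (norm (K (T s x)))\<^sup>2) \<le> q * (norm x)\<^sup>2"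
    using K_orbit_bound[OF \<tau>] by blast
  have "T.energy \<tau> x \<le> (2 * m + N * q) * (norm x)\<^sup>2" if "x \<in> D" for x
    using N(2)[OF that] m(2)[OF that] mult_left_mono[OF q(2)[of x] N(1)] by (simp add: algebra_simps)
  then show ?thesis using N(1) q(1) m(1) by (intro exI[of _ "2 * m + N * q"]) auto
qed

end

subsection \<open>The compactness-uniqueness argument\<close>

text \<open>The difference between the integral and its projection onto \<open>V\<close> is
  orthogonal to every value of \<open>f\<close>, hence to the integral.\<close>

lemma closed_subspace_integral:
  fixes f :: "real \<Rightarrow> 'a::{real_inner,banach}"
  assumes V: "subspace V" "closed V" and f: "f integrable_on X" "\<And>t. t \<in> X \<Longrightarrow> f t \<in> V"
  shows "integral X f \<in> V"
proof -
  obtain p where p: "p \<in> V" "\<And>w. w \<in> V \<Longrightarrow> inner (integral X f - p) w = 0"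
    using projection_exists[OF V(1)] closure_closed[OF V(2)] by metis
  let ?d = "integral X f - p"
  have "inner ?d (integral X f) = integral X (inner ?d \<circ> f)"
    by (rule integral_linear[OF f(1) bounded_linear_inner_right, symmetric])
  also have "\<dots> = integral X (\<lambda>t. 0)"
    by (intro integral_cong) (simp add: p(2) f(2))
  finally have "inner ?d ?d = 0"
    using p by (simp add: inner_diff_right)
  then show ?thesis using p(1) by simp
qed

section \<open>Unobservable subspaces\<close>

context observation
begin

text \<open>For admissible \<open>C\<close>, this is the null space of the continuous extension to the whole space of
  the output map \<open>x \<mapsto> C (S t x)\<close>, \<open>t \<in> {0..\<tau>}\<close>, which is only defined for \<open>x \<in> D\<close>.\<close>

definition "unobservable \<tau> = {x. \<forall>e>0. \<exists>z\<in>D. norm (z - x) < e \<and> energy \<tau> z < e}"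

lemma unobservableI: "(\<And>e. e > 0 \<Longrightarrow> \<exists>z\<in>D. norm (z - x) < e \<and> energy \<tau> z < e) \<Longrightarrow> x \<in> unobservable \<tau>"
  by (simp add: unobservable_def)

lemma unobservableD:
  "x \<in> unobservable \<tau> \<Longrightarrow> e > 0 \<Longrightarrow> \<exists>z\<in>D. norm (z - x) < e \<and> energy \<tau> z < e"
  by (simp add: unobservable_def)

lemma unobservable_add:
  assumes "x \<in> unobservable \<tau>" "y \<in> unobservable \<tau>"
  shows "x + y \<in> unobservable \<tau>"
proof (rule unobservableI)
  fix e :: real assume e: "e > 0"
  obtain z where z: "z \<in> D" "norm (z - x) < e / 4" "energy \<tau> z < e / 4"
    using unobservableD[OF assms(1), of "e / 4"] e by auto
  obtain w where w: "w \<in> D" "norm (w - y) < e / 4" "energy \<tau> w < e / 4"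
    using unobservableD[OF assms(2), of "e / 4"] e by auto
  have "norm (z + w - (x + y)) \<le> norm (z - x) + norm (w - y)"
    using norm_triangle_ineq[of "z - x" "w - y"] by (simp add: algebra_simps)
  then have "norm (z + w - (x + y)) < e" using z w e by linarith
  moreover have "energy \<tau> (z + w) < e"
    using energy_add[OF z(1) w(1), of \<tau>] z(3) w(3) by linarith
  ultimately show "\<exists>v\<in>D. norm (v - (x + y)) < e \<and> energy \<tau> v < e"
    using generator_add(1)[OF z(1) w(1)] by blast
qed

lemma unobservable_scaleC:
  assumes "x \<in> unobservable \<tau>"
  shows "scaleC a x \<in> unobservable \<tau>"
proof (rule unobservableI)
  fix e :: real assume e: "e > 0"
  define k where "k = 1 + cmod a + (cmod a)\<^sup>2"
  have k: "k > 0" "cmod a \<le> k" "(cmod a)\<^sup>2 \<le> k"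
    using norm_ge_zero[of a] zero_le_power2[of "cmod a"] unfolding k_def by linarith+
  obtain z where z: "z \<in> D" "norm (z - x) < e / k" "energy \<tau> z < e / k"
    using unobservableD[OF assms, of "e / k"] e k(1) by auto
  have "norm (scaleC a z - scaleC a x) = cmod a * norm (z - x)"
    by (simp add: norm_scaleC flip: scaleC_diff_right)
  also have "\<dots> \<le> k * norm (z - x)" using k by (intro mult_right_mono) auto
  also have "\<dots> < k * (e / k)" using k z by (intro mult_strict_left_mono) auto
  finally have "norm (scaleC a z - scaleC a x) < e" using k by simp
  moreover have "energy \<tau> (scaleC a z) = (cmod a)\<^sup>2 * energy \<tau> z"
    by (rule energy_scaleC[OF z(1)])
  moreover have "(cmod a)\<^sup>2 * energy \<tau> z \<le> k * energy \<tau> z"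
    using k energy_nonneg by (intro mult_right_mono) auto
  moreover have "k * energy \<tau> z < k * (e / k)" using k z by (intro mult_strict_left_mono) auto
  ultimately show "\<exists>v\<in>D. norm (v - scaleC a x) < e \<and> energy \<tau> v < e"
    using generator_scaleC(1)[OF z(1), of a] k by (intro bexI[of _ "scaleC a z"]) auto
qed

lemma subspace_unobservable: "subspace (unobservable \<tau>)"
proof (rule subspaceI)
  show "0 \<in> unobservable \<tau>"
  proof (rule unobservableI)
    have "0 \<in> D" using subspace_D subspace_0 by blast
    then have "energy \<tau> 0 = 0" using energy_scaleR[of 0 \<tau> 0] by simp
    then show "\<exists>z\<in>D. norm (z - 0) < e \<and> energy \<tau> z < e" if "e > 0" for e
      using that \<open>0 \<in> D\<close> by (intro bexI[of _ 0]) auto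
  qed
qed (use unobservable_add unobservable_scaleC[of _ _ "of_real _"] in \<open>auto simp: scaleR_scaleC\<close>)

lemma closed_unobservable: "closed (unobservable \<tau>)"
proof -
  have "x \<in> unobservable \<tau>" if x: "x \<in> closure (unobservable \<tau>)" for x
  proof (rule unobservableI)
    fix e :: real assume e: "e > 0"
    obtain y where y: "y \<in> unobservable \<tau>" "norm (y - x) < e / 2"
      using x e unfolding closure_approachable dist_norm by (meson half_gt_zero)
    obtain z where z: "z \<in> D" "norm (z - y) < e / 2" "energy \<tau> z < e / 2"
      using unobservableD[OF y(1), of "e / 2"] e by auto
    have "norm (z - x) < e"
      using norm_triangle_ineq[of "z - y" "y - x"] y(2) z(2) by simp
    then show "\<exists>z\<in>D. norm (z - x) < e \<and> energy \<tau> z < e"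
      using z e by (intro bexI[of _ z]) auto
  qed
  then show ?thesis by (metis closure_subset closure_closed closed_closure subsetI subset_antisym)
qed

lemma unobservable_antimono:
  assumes "0 \<le> \<sigma>" "\<sigma> \<le> \<tau>"
  shows "unobservable \<tau> \<subseteq> unobservable \<sigma>"
proof
  fix x assume x: "x \<in> unobservable \<tau>"
  show "x \<in> unobservable \<sigma>"
    by (rule unobservableI) (use unobservableD[OF x] energy_mono[OF _ assms] in \<open>meson le_less_trans\<close>)
qed

text \<open>Advancing the state by \<open>t\<close> discards the output on \<open>{0..t}\<close>, so
  the remaining observation time shrinks; the approximating domain vectors are advanced as
  well.\<close>

lemma unobservable_S:
  assumes x: "x \<in> unobservable \<tau>" and t: "0 \<le> t" "t \<le> \<tau>"
  shows "S t x \<in> unobservable (\<tau> - t)"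
proof (rule unobservableI)
  fix e :: real assume e: "e > 0"
  obtain M where M: "M \<ge> 1" "\<And>s y. 0 \<le> s \<Longrightarrow> s \<le> t \<Longrightarrow> norm (S s y) \<le> M * norm y"
    using local_bound[of t] by metis
  have "e / M > 0" using e M by simp
  obtain z where z: "z \<in> D" "norm (z - x) < e / M" "energy \<tau> z < e / M"
    using unobservableD[OF x \<open>e / M > 0\<close>] by auto
  have "norm (S t z - S t x) \<le> M * norm (z - x)"
    using M(2)[of t "z - x"] t by (simp add: minus)
  also have "\<dots> < M * (e / M)" using M(1) z(2) by (intro mult_strict_left_mono) auto
  finally have "norm (S t z - S t x) < e" using M by simp
  moreover have "e / M \<le> e" using M(1) e by (simp add: divide_le_eq mult_le_cancel_left1)
  then have "energy (\<tau> - t) (S t z) < e"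
    using energy_S_le[OF z(1) t] z(3) by linarith
  ultimately show "\<exists>v\<in>D. norm (v - S t x) < e \<and> energy (\<tau> - t) v < e"
    using generator_S(1)[OF z(1) t(1)] by blast
qed

text \<open>Admissibility makes the energy continuous for the norm, so a domain vector approximated
  with vanishing energies has energy zero itself; its continuous output then vanishes, and takes the
  value \<open>C x\<close> at time zero.\<close>

lemma unobservable_domain:
  assumes x: "x \<in> unobservable \<tau>" "x \<in> D" and \<tau>: "\<tau> > 0"
    and m: "m \<ge> 0" "\<And>x. x \<in> D \<Longrightarrow> energy \<tau> x \<le> m * (norm x)\<^sup>2"
  shows "C x = 0"
proof -
  have "energy \<tau> x \<le> 0 + e" if e: "e > 0" for e
  proof -
    \<comment> \<open>With errors below \<open>d\<close> the energy is at most
      \<open>2 * m * d\<^sup>2 + 2 * d\<close>, which is at most \<open>(2 * m + 2) * d\<close> for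
      \<open>d \<le> 1\<close>.\<close>
    define d where "d = min 1 (e / (2 * m + 2))"
    have d: "d > 0" "d \<le> 1" "(2 * m + 2) * d \<le> e"
    proof -
      show "d > 0" using e m(1) by (simp add: d_def)
      have "(2 * m + 2) * d \<le> (2 * m + 2) * (e / (2 * m + 2))"
        using m(1) by (intro mult_left_mono) (auto simp: d_def)
      also have "\<dots> = e" using m(1) by (simp add: nonzero_mult_div_cancel_left add_nonneg_eq_0_iff)
      finally show "(2 * m + 2) * d \<le> e" .
    qed (simp add: d_def)
    obtain z where z: "z \<in> D" "norm (z - x) < d" "energy \<tau> z < d"
      using unobservableD[OF x(1) d(1)] by auto
    have xz: "x - z \<in> D" using generator_diff(1) x(2) z(1) by blast
    have "(norm (x - z))\<^sup>2 \<le> d\<^sup>2" using z(2) by (intro power_mono) (auto simp: norm_minus_commute)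
    also have "\<dots> \<le> d" using d by (simp add: power2_eq_square mult_left_le)
    finally have "m * (norm (x - z))\<^sup>2 \<le> m * d" using m(1) by (rule mult_left_mono)
    then have "energy \<tau> (x - z) \<le> m * d" using m(2)[OF xz] by simp
    moreover have "energy \<tau> x \<le> 2 * energy \<tau> (x - z) + 2 * energy \<tau> z"
      using energy_add[OF xz z(1), of \<tau>] by simp
    ultimately have "energy \<tau> x \<le> (2 * m + 2) * d"
      using z(3) by (simp add: algebra_simps)
    then show ?thesis using d(3) by simp
  qed
  then have "energy \<tau> x \<le> 0" by (rule field_le_epsilon)
  then have "energy \<tau> x = 0" using energy_nonneg[of \<tau> x] by simp
  then have "\<forall>t\<in>{0..\<tau>}. (norm (C (S t x)))\<^sup>2 = 0"
    unfolding energy_def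
    using integral_eq_0_iff[OF continuous_on_output_square[OF x(2) order_refl] \<tau>] by simp
  then show ?thesis using \<tau> by force
qed

end

text \<open>The orbit of \<open>K\<close> stands for the compact remainder of a perturbation.\<close>

locale weakly_coercive_observation = observation S C c
  for S :: "real \<Rightarrow> 'h::complex_hilbert \<Rightarrow> 'h" and C :: "'h \<Rightarrow> 'u::complex_hilbert" and c +
  fixes K :: "'h \<Rightarrow> 'h" and \<tau>0 q :: real
  assumes K: "bounded_linear K"
    and K_compact: "\<And>x l M. (\<And>n. norm (x n) \<le> M) \<Longrightarrow> (\<And>y. (\<lambda>n. inner (x n) y) \<longlonglongrightarrow> inner l y) \<Longrightarrow>
      (\<lambda>n. K (x n)) \<longlonglongrightarrow> K l"
    and \<tau>0: "\<tau>0 > 0"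
    and adm: "\<And>\<tau>. \<exists>m\<ge>0. \<forall>x\<in>D. energy \<tau> x \<le> m * (norm x)\<^sup>2"
    and coercive: "\<And>x. x \<in> D \<Longrightarrow>
      (norm x)\<^sup>2 \<le> q * energy \<tau>0 x + q * integral {0..\<tau>0} (\<lambda>s. (norm (K (S s x)))\<^sup>2)"
    and q_nonneg: "q \<ge> 0"
    and test: "\<And>z l. z \<in> D \<Longrightarrow> G z = scaleC l z \<Longrightarrow> C z = 0 \<Longrightarrow> z = 0"
begin

text \<open>The weak limit \<open>l\<close> may lie outside the domain, so \<open>coercive\<close>
  is applied to the differences \<open>x (r n) - x (r k)\<close>; \<open>l\<close> serves to make
  the terms with \<open>K\<close> tend to zero, by weak convergence at each time and dominated
  convergence in time.\<close>

lemma convergent_subseq: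
  assumes x: "\<And>n. x n \<in> D" "\<And>n. norm (x n) \<le> B" and E: "(\<lambda>n. energy \<tau>0 (x n)) \<longlonglongrightarrow> 0"
  shows "\<exists>l r. strict_mono (r :: nat \<Rightarrow> nat) \<and> (\<lambda>n. x (r n)) \<longlonglongrightarrow> l"
proof -
  obtain l r where r: "strict_mono (r :: nat \<Rightarrow> nat)" and wk: "\<And>y. (\<lambda>n. inner (x (r n)) y) \<longlonglongrightarrow> inner l y"
    by (rule bounded_weakly_convergent_subseq[of x B, OF x(2)]) blast
  obtain M where M: "M \<ge> 1" "\<And>s y. 0 \<le> s \<Longrightarrow> s \<le> \<tau>0 \<Longrightarrow> norm (S s y) \<le> M * norm y"
    using local_bound[of \<tau>0] by metis
  define F where "F n s = (norm (K (S s (x (r n) - l))))\<^sup>2" for n s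
  have K_cont: "continuous_on {0..\<tau>0} (\<lambda>s. (norm (K (S s y)))\<^sup>2)" for y
    by (intro continuous_intros bounded_linear.continuous_on[OF K] continuous_on_subset[OF continuous_on_orbit]) auto
  have F_int: "F n integrable_on {0..\<tau>0}" for n
    unfolding F_def by (rule integrable_continuous_interval[OF K_cont])
  have "(\<lambda>n. integral {0..\<tau>0} (F n)) \<longlonglongrightarrow> integral {0..\<tau>0} (\<lambda>s. 0)"
  proof (rule dominated_convergence(2)[OF F_int])
    show "(\<lambda>s. (onorm K * (M * (B + norm l)))\<^sup>2) integrable_on {0..\<tau>0}" by (rule integrable_const_ivl)
    show "norm (F n s) \<le> (onorm K * (M * (B + norm l)))\<^sup>2" if s: "s \<in> {0..\<tau>0}" for n s
    proof -
      have "norm (K (S s (x (r n) - l))) \<le> onorm K * norm (S s (x (r n) - l))"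
        by (rule onorm[OF K])
      also have "\<dots> \<le> onorm K * (M * norm (x (r n) - l))"
        using s onorm_pos_le[OF K] by (intro mult_left_mono M(2)) auto
      also have "\<dots> \<le> onorm K * (M * (B + norm l))"
        using onorm_pos_le[OF K] M(1) norm_triangle_ineq4[of "x (r n)" l] x(2)[of "r n"]
        by (intro mult_left_mono) auto
      finally show ?thesis by (simp add: F_def power_mono)
    qed
    show "(\<lambda>n. F n s) \<longlonglongrightarrow> 0" if s: "s \<in> {0..\<tau>0}" for s
    proof -
      have "(\<lambda>n. K (S s (x (r n)))) \<longlonglongrightarrow> K (S s l)"
      proof (rule K_compact)
        show "norm (S s (x (r n))) \<le> M * B" for n
          by (rule order_trans[OF M(2) mult_left_mono[OF x(2)]]) (use s M(1) in auto)
        show "(\<lambda>n. inner (S s (x (r n))) y) \<longlonglongrightarrow> inner (S s l) y" for y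
          using wk[of "bounded_adjoint (S s) y"] s by (simp add: inner_bounded_adjoint[OF clin])
      qed
      then have "(\<lambda>n. (norm (K (S s (x (r n))) - K (S s l)))\<^sup>2) \<longlonglongrightarrow> 0\<^sup>2"
        by (intro tendsto_power tendsto_norm_zero LIM_zero)
      then show ?thesis
        using s by (simp add: F_def minus linear_diff[OF bounded_linear.linear[OF K]])
    qed
  qed
  then have F0: "(\<lambda>n. integral {0..\<tau>0} (F n)) \<longlonglongrightarrow> 0" by simp
  define b where "b n = q * (2 * energy \<tau>0 (x (r n))) + q * (2 * integral {0..\<tau>0} (F n))" for n
  have "b \<longlonglongrightarrow> q * (2 * 0) + q * (2 * 0)"
    unfolding b_def using LIMSEQ_subseq_LIMSEQ[OF E r]
    by (intro tendsto_add tendsto_mult tendsto_const F0) (simp_all add: comp_def)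
  then have b: "b \<longlonglongrightarrow> 0" by simp
  have le: "(norm (x (r n) - x (r k)))\<^sup>2 \<le> b n + b k" for n k
  proof -
    let ?d = "x (r n) - x (r k)"
    have d: "?d \<in> D" by (intro generator_diff x)
    have "integral {0..\<tau>0} (\<lambda>s. (norm (K (S s ?d)))\<^sup>2) \<le> integral {0..\<tau>0} (\<lambda>s. 2 * F n s + 2 * F k s)"
    proof (rule integral_le)
      show "(\<lambda>s. (norm (K (S s ?d)))\<^sup>2) integrable_on {0..\<tau>0}"
        by (rule integrable_continuous_interval[OF K_cont])
      show "(\<lambda>s. 2 * F n s + 2 * F k s) integrable_on {0..\<tau>0}"
        by (intro integrable_add integrable_on_mult_right F_int)
      fix s assume s: "s \<in> {0..\<tau>0}"
      have "K (S s ?d) = K (S s (x (r n) - l)) + - K (S s (x (r k) - l))"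
        using s by (simp add: minus linear_diff[OF bounded_linear.linear[OF K]])
      then show "(norm (K (S s ?d)))\<^sup>2 \<le> 2 * F n s + 2 * F k s"
        using norm_add_square_le[of "K (S s (x (r n) - l))" "- K (S s (x (r k) - l))"]
        by (simp add: F_def)
    qed
    also have "\<dots> = 2 * integral {0..\<tau>0} (F n) + 2 * integral {0..\<tau>0} (F k)"
      by (subst integral_add) (auto intro!: integrable_on_mult_right F_int)
    finally have 1: "integral {0..\<tau>0} (\<lambda>s. (norm (K (S s ?d)))\<^sup>2) \<le> 2 * integral {0..\<tau>0} (F n) + 2 * integral {0..\<tau>0} (F k)" .
    have 2: "energy \<tau>0 ?d \<le> 2 * energy \<tau>0 (x (r n)) + 2 * energy \<tau>0 (x (r k))"
      by (rule energy_diff[OF x(1) x(1)])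
    show ?thesis
      using coercive[OF d] mult_left_mono[OF 1 q_nonneg] mult_left_mono[OF 2 q_nonneg]
      by (simp add: b_def algebra_simps)
  qed
  have "Cauchy (\<lambda>n. x (r n))"
  proof (rule CauchyI)
    fix e :: real assume e: "e > 0"
    have "e\<^sup>2 / 2 > 0" using e by simp
    from LIMSEQ_D[OF b this] obtain N where N: "\<And>n. n \<ge> N \<Longrightarrow> b n < e\<^sup>2 / 2" by fastforce
    have "norm (x (r m) - x (r n)) < e" if "m \<ge> N" "n \<ge> N" for m n
      using le[of m n] N[OF that(1)] N[OF that(2)] e by (intro power2_less_imp_less[of _ e]) auto
    then show "\<exists>M. \<forall>m\<ge>M. \<forall>n\<ge>M. norm (x (r m) - x (r n)) < e" by blast
  qed
  then show ?thesis
    using r Cauchy_convergent convergent_def by blast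
qed

text \<open>Unobservable vectors may lie outside the domain; each is replaced by a domain vector of
  small energy, at a distance that tends to zero along the sequence.\<close>

lemma unobservable_compact:
  assumes y: "\<And>n. y n \<in> unobservable \<tau>0" "\<And>n. norm (y n) \<le> 1"
  shows "\<exists>l r. strict_mono (r :: nat \<Rightarrow> nat) \<and> (\<lambda>n. y (r n)) \<longlonglongrightarrow> l"
proof -
  have "\<exists>z. \<forall>n. z n \<in> D \<and> norm (z n - y n) < 1 / Suc n \<and> energy \<tau>0 (z n) < 1 / Suc n"
  proof (intro choice allI)
    fix n
    show "\<exists>z. z \<in> D \<and> norm (z - y n) < 1 / Suc n \<and> energy \<tau>0 z < 1 / Suc n"
      using unobservableD[OF y(1)[of n], of "1 / Suc n"] by auto
  qed
  then obtain z where z: "\<And>n. z n \<in> D" "\<And>n. norm (z n - y n) < 1 / Suc n"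
    "\<And>n. energy \<tau>0 (z n) < 1 / Suc n" by auto
  note lim0 = lim_1_over_n[THEN LIMSEQ_Suc]
  have "norm (z n) \<le> 2" for n
  proof -
    have "1 / real (Suc n) \<le> 1" by simp
    then show ?thesis
      using norm_triangle_ineq[of "z n - y n" "y n"] z(2)[of n] y(2)[of n]
      unfolding diff_add_cancel by linarith
  qed
  moreover have "(\<lambda>n. energy \<tau>0 (z n)) \<longlonglongrightarrow> 0"
    by (rule Lim_null_comparison[OF _ lim0]) (use z(3) energy_nonneg in \<open>auto intro!: always_eventually less_imp_le simp del: of_nat_Suc\<close>)
  ultimately obtain l r where r: "strict_mono (r :: nat \<Rightarrow> nat)" "(\<lambda>n. z (r n)) \<longlonglongrightarrow> l"
    using convergent_subseq z(1) by blast
  have "(\<lambda>n. z n - y n) \<longlonglongrightarrow> 0"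
    by (rule Lim_null_comparison[OF _ lim0]) (use z(2) in \<open>auto intro!: always_eventually less_imp_le simp del: of_nat_Suc\<close>)
  then have "(\<lambda>n. z (r n) - y (r n)) \<longlonglongrightarrow> 0"
    using LIMSEQ_subseq_LIMSEQ[OF _ r(1)] by (force simp: comp_def)
  from tendsto_diff[OF r(2) this] have "(\<lambda>n. y (r n)) \<longlonglongrightarrow> l" by simp
  then show ?thesis using r(1) by blast
qed

text \<open>If the decreasing family \<open>unobservable\<close> were nowhere constant, unit vectors of successive
  orthogonal complements would contradict the compactness of the unit ball.\<close>

lemma unobservable_constant:
  assumes \<tau>: "\<tau> > \<tau>0"
  shows "\<exists>a b. \<tau>0 \<le> a \<and> a < b \<and> b \<le> \<tau> \<and> unobservable a = unobservable b"
proof (rule ccontr)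
  assume contra: "\<not> ?thesis"
  \<comment> \<open>Times that increase strictly from \<open>t 0 = \<tau>0\<close> towards
    \<open>\<tau>\<close>, so that all the spaces sit inside
    \<open>unobservable \<tau>0\<close>.\<close>
  define t where "t n = \<tau> - (\<tau> - \<tau>0) / real (Suc n)" for n
  have t_ge: "\<tau>0 \<le> t n" for n
  proof -
    have "(\<tau> - \<tau>0) / real (Suc n) \<le> (\<tau> - \<tau>0) / 1"
      using \<tau> by (intro divide_left_mono) auto
    then show ?thesis by (simp add: t_def)
  qed
  have t_le: "t n \<le> \<tau>" for n using \<tau> by (simp add: t_def)
  have t_less: "t n < t (Suc n)" for n
    using \<tau> unfolding t_def by (intro diff_strict_left_mono divide_strict_left_mono) auto
  have t_mono: "t m \<le> t n" if "m \<le> n" for m n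
    by (rule lift_Suc_mono_le[of t, OF less_imp_le[OF t_less] that])
  have t_pos: "t n \<ge> 0" for n using t_ge[of n] \<tau>0 by linarith
  have "\<exists>e\<in>unobservable (t n). norm e = 1 \<and> (\<forall>w\<in>unobservable (t (Suc n)). inner e w = 0)" for n
  proof -
    have sub: "unobservable (t (Suc n)) \<subseteq> unobservable (t n)"
      using t_pos t_less by (intro unobservable_antimono) (auto intro: less_imp_le)
    have "unobservable (t n) \<noteq> unobservable (t (Suc n))"
      using contra t_ge t_less t_le by blast
    then obtain y where y: "y \<in> unobservable (t n)" "y \<notin> unobservable (t (Suc n))"
      using sub by blast
    obtain p where p: "p \<in> unobservable (t (Suc n))" "\<And>w. w \<in> unobservable (t (Suc n)) \<Longrightarrow> inner (y - p) w = 0"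
      using projection_exists[OF subspace_unobservable] closure_closed[OF closed_unobservable] by metis
    have ne: "y - p \<noteq> 0" using y p by auto
    have "y - p \<in> unobservable (t n)"
      using y(1) p(1) sub subspace_diff[OF subspace_unobservable] by blast
    then have "(1 / norm (y - p)) *\<^sub>R (y - p) \<in> unobservable (t n)"
      by (rule subspace_scale[OF subspace_unobservable])
    then show ?thesis
      using ne p(2) by (intro bexI[of _ "(1 / norm (y - p)) *\<^sub>R (y - p)"]) auto
  qed
  then obtain e where e: "\<And>n. e n \<in> unobservable (t n)" "\<And>n. norm (e n) = 1"
    "\<And>n w. w \<in> unobservable (t (Suc n)) \<Longrightarrow> inner (e n) w = 0" by metis
  have orth: "inner (e m) (e n) = 0" if "m < n" for m n
  proof (rule e(3))
    have "unobservable (t n) \<subseteq> unobservable (t (Suc m))"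
      using that t_pos t_mono by (intro unobservable_antimono) auto
    then show "e n \<in> unobservable (t (Suc m))" using e(1) by blast
  qed
  have "unobservable (t n) \<subseteq> unobservable \<tau>0" for n
    using \<tau>0 t_ge by (intro unobservable_antimono) auto
  then have "\<exists>l r. strict_mono (r :: nat \<Rightarrow> nat) \<and> (\<lambda>n. e (r n)) \<longlonglongrightarrow> l"
    using e by (intro unobservable_compact) auto
  then show False
    using orthonormal_no_convergent_subseq[of e, OF e(2) orth] by blast
qed

lemma unobservable_trivial:
  assumes \<tau>: "\<tau> > \<tau>0"
  shows "unobservable \<tau> = {0}"
proof (rule ccontr)
  assume contra: "unobservable \<tau> \<noteq> {0}"
  obtain a b where ab: "\<tau>0 \<le> a" "a < b" "b \<le> \<tau>" and eq: "unobservable a = unobservable b"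
    using unobservable_constant[OF \<tau>] by blast
  define V where "V = unobservable b"
  have b_pos: "b > 0" using ab \<tau>0 by linarith
  note V = subspace_unobservable[of b, folded V_def] closed_unobservable[of b, folded V_def]
    unobservable_scaleC[of _ b, folded V_def]
  have "unobservable \<tau> \<subseteq> V"
    unfolding V_def using ab b_pos by (intro unobservable_antimono) auto
  then obtain x0 where x0: "x0 \<in> V" "x0 \<noteq> 0"
    using contra subspace_0[OF subspace_unobservable] by blast
  \<comment> \<open>Invariance for short times is enough, because averages and the generator are
    limits at time zero.\<close>
  have V_S: "S t x \<in> V" if x: "x \<in> V" and t: "0 \<le> t" "t \<le> b - a" for x t
  proof -
    have "S t x \<in> unobservable (b - t)"
      using x t ab \<tau>0 unfolding V_def by (intro unobservable_S) auto
    moreover have "unobservable (b - t) \<subseteq> unobservable a"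
      using t ab \<tau>0 by (intro unobservable_antimono) auto
    ultimately show ?thesis by (auto simp: V_def eq)
  qed
  have "V \<subseteq> unobservable \<tau>0"
    unfolding V_def using ab \<tau>0 by (intro unobservable_antimono) auto
  then have "\<exists>B. finite B \<and> B \<subseteq> V \<and> V \<subseteq> span B"
    using unobservable_compact by (intro sequentially_compact_ball_imp_finite_dim V(1)) blast
  then obtain B where B: "finite B" "V \<subseteq> span B" by blast
  have V_avg: "orbit_integral h x /\<^sub>R h \<in> V \<inter> D" if x: "x \<in> V" and h: "0 < h" "h \<le> b - a" for x h
  proof -
    have "orbit_integral h x \<in> V"
      unfolding orbit_integral_def
      by (rule closed_subspace_integral[OF V(1,2) integrable_orbit]) (use V_S x h in auto)
    then show ?thesis
      using V(1) subspace_scale generator_scaleR(1) generator_orbit_integral(1)[of h x] h by auto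
  qed
  \<comment> \<open>Averages over short times lie in \<open>D\<close> and approximate every vector
    of \<open>V\<close>; in finite dimension the dense subspace \<open>V \<inter> D\<close> is all
    of \<open>V\<close>.\<close>
  have V_D: "V \<subseteq> D"
  proof -
    have "V \<subseteq> closure (V \<inter> D)"
    proof
      fix x assume x: "x \<in> V"
      have "\<forall>\<^sub>F h in at_right 0. h < b - a"
        by (rule order_tendstoD(2)[OF tendsto_ident_at]) (use ab in simp)
      with eventually_at_right_pos
      have "\<forall>\<^sub>F h in at_right 0. orbit_integral h x /\<^sub>R h \<in> closure (V \<inter> D)"
      proof eventually_elim
        case (elim h)
        then show ?case using V_avg[OF x, of h] closure_subset by fastforce
      qed
      then show "x \<in> closure (V \<inter> D)"
        by (intro Lim_in_closed_set[OF closed_closure _ _ average_tendsto]) auto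
    qed
    moreover have "subspace (V \<inter> D)" by (intro subspace_inter V(1) subspace_D)
    moreover have "V \<inter> D \<subseteq> span B" using B(2) by blast
    ultimately have "V \<subseteq> V \<inter> D"
      using dense_subspace_of_finite_dim B(1) by metis
    then show ?thesis by blast
  qed
  have V_G: "G x \<in> V" if x: "x \<in> V" for x
  proof (rule Lim_in_closed_set[OF V(2) _ _ generator_tendsto])
    have "\<forall>\<^sub>F h in at_right 0. h < b - a"
      by (rule order_tendstoD(2)[OF tendsto_ident_at]) (use ab in simp)
    with eventually_at_right_pos show "\<forall>\<^sub>F h in at_right 0. (S h x - x) /\<^sub>R h \<in> V"
    proof eventually_elim
      case (elim h)
      then show ?case using V_S[OF x, of h] x V(1) by (intro subspace_scale subspace_diff) auto
    qed
  qed (use x V_D in auto)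
  have "\<exists>z\<in>V. \<exists>l. z \<noteq> 0 \<and> G z = scaleC l z"
    by (rule eigenvector_exists[OF V(1) V(3) B V_G generator_add(2) generator_scaleC(2) x0])
      (use V_D in auto)
  then obtain z l where z: "z \<in> V" "z \<noteq> 0" "G z = scaleC l z" by blast
  obtain m where m: "m \<ge> 0" "\<And>x. x \<in> D \<Longrightarrow> energy b x \<le> m * (norm x)\<^sup>2" using adm by blast
  have "z \<in> D" using z V_D by blast
  moreover have "C z = 0"
    using z(1) \<open>z \<in> D\<close> b_pos m unfolding V_def by (rule unobservable_domain)
  ultimately show False using test z by blast
qed

text \<open>If no constant works, there are unit vectors whose energies over
  \<open>{0..\<tau>}\<close>, and a fortiori over \<open>{0..\<tau>0}\<close>, tend to zero. A
  subsequence converges in norm, and its limit is an unobservable vector of norm one.\<close>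

theorem observability:
  assumes \<tau>: "\<tau> > \<tau>0"
  shows "\<exists>k. \<forall>x\<in>D. (norm x)\<^sup>2 \<le> k * energy \<tau> x"
proof (rule ccontr)
  assume contra: "\<not> ?thesis"
  have "\<exists>x\<in>D. norm x = 1 \<and> energy \<tau> x < 1 / Suc n" for n
  proof -
    obtain x where x: "x \<in> D" "(norm x)\<^sup>2 > real (Suc n) * energy \<tau> x"
      using contra by (meson not_le)
    have nx: "norm x > 0"
      using x(2) energy_nonneg[of \<tau> x] by (cases "x = 0") (auto simp: mult_less_0_iff)
    let ?y = "(1 / norm x) *\<^sub>R x"
    have "energy \<tau> ?y = energy \<tau> x / (norm x)\<^sup>2"
      by (simp add: energy_scaleR[OF x(1)] power_divide)
    also have "\<dots> < 1 / Suc n"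
      using x(2) nx by (simp add: field_simps)
    finally show ?thesis
      using generator_scaleR(1)[OF x(1)] nx by (intro bexI[of _ ?y]) auto
  qed
  then obtain x where x: "\<And>n. x n \<in> D" "\<And>n. norm (x n) = 1" "\<And>n. energy \<tau> (x n) < 1 / Suc n"
    by metis
  have E: "(\<lambda>n. energy \<tau> (x n)) \<longlonglongrightarrow> 0"
    by (rule Lim_null_comparison[OF _ lim_1_over_n[THEN LIMSEQ_Suc]])
      (use x(3) energy_nonneg in \<open>auto intro!: always_eventually less_imp_le simp del: of_nat_Suc\<close>)
  have "(\<lambda>n. energy \<tau>0 (x n)) \<longlonglongrightarrow> 0"
    by (rule Lim_null_comparison[OF _ E])
      (use energy_mono[OF x(1), of \<tau>0 \<tau>] \<tau>0 \<tau> energy_nonneg in auto)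
  then obtain l r where r: "strict_mono (r :: nat \<Rightarrow> nat)" "(\<lambda>n. x (r n)) \<longlonglongrightarrow> l"
    using convergent_subseq[of x 1] x by auto
  have "norm l = 1"
    using LIMSEQ_unique[OF tendsto_norm[OF r(2)]] x(2) by simp
  moreover have "l \<in> unobservable \<tau>"
  proof (rule unobservableI)
    fix e :: real assume e: "e > 0"
    have "\<forall>\<^sub>F n in sequentially. norm (x (r n) - l) < e"
      using tendstoD[OF r(2) e] by (simp add: dist_norm)
    moreover have "\<forall>\<^sub>F n in sequentially. energy \<tau> (x (r n)) < e"
      using order_tendstoD(2)[OF LIMSEQ_subseq_LIMSEQ[OF E r(1)] e] by (simp add: comp_def)
    ultimately have "\<forall>\<^sub>F n in sequentially. norm (x (r n) - l) < e \<and> energy \<tau> (x (r n)) < e"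
      by (rule eventually_conj)
    then show "\<exists>z\<in>D. norm (z - l) < e \<and> energy \<tau> z < e"
      using eventually_happens'[OF sequentially_bot] x(1) by blast
  qed
  ultimately show False using unobservable_trivial[OF \<tau>] by auto
qed

end

section \<open>Square-integrable controls\<close>

text \<open>Completeness of Lebesgue measure admits limits almost everywhere. The lemma is applied
  to scalar functions obtained from vector-valued ones, which keeps separability out of the
  argument.\<close>

lemma AE_limit_measurable:
  fixes f :: "'a::euclidean_space \<Rightarrow> 'b::euclidean_space"
  assumes I: "I \<in> sets lebesgue" and F: "\<And>n. F n \<in> borel_measurable (lebesgue_on I)"
    and lim: "AE t in lebesgue_on I. (\<lambda>n. F n t) \<longlonglongrightarrow> f t"
  shows "f \<in> borel_measurable (lebesgue_on I)"
proof -
  define H where "H n t = (if t \<in> I then F n t else 0)" for n t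
  have H: "H n \<in> borel_measurable lebesgue" for n
    unfolding H_def by (rule borel_measurable_if_I[OF F I])
  have "AE t in lebesgue. t \<in> I \<longrightarrow> (\<lambda>n. F n t) \<longlonglongrightarrow> f t"
    using lim I by (simp add: AE_restrict_space_iff)
  then have "AE t in lebesgue. lim (\<lambda>n. H n t) = (if t \<in> I then f t else 0)"
    by eventually_elim (auto simp: H_def intro: limI)
  then have "(\<lambda>t. if t \<in> I then f t else 0) \<in> borel_measurable lebesgue"
    by (rule borel_measurable_AE[rotated]) (intro borel_measurable_lim_metric H)
  then show ?thesis by (rule borel_measurable_if_D)
qed

lemma integrable_lebesgue_on_iff:
  fixes f :: "'a::euclidean_space \<Rightarrow> real"
  shows "I \<in> sets lebesgue \<Longrightarrow> integrable (lebesgue_on I) f \<longleftrightarrow> set_integrable lebesgue I f"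
  by (simp add: integrable_restrict_space set_integrable_def)

lemma strongly_measurable_on_subset:
  assumes u: "strongly_measurable_on I u" and J: "J \<subseteq> I" "J \<in> sets lebesgue" "I \<in> sets lebesgue"
  shows "strongly_measurable_on J u"
proof -
  obtain s where s: "\<And>n::nat. simple_function (lebesgue_on I) (s n)"
    "AE t in lebesgue_on I. (\<lambda>n. s n t) \<longlonglongrightarrow> u t"
    using u unfolding strongly_measurable_on_def by blast
  have "simple_function (lebesgue_on J) (s n)" for n
    unfolding simple_function_def
  proof (intro conjI ballI)
    show "finite (s n ` space (lebesgue_on J))"
      using simple_functionD(1)[OF s(1)[of n]] J(1) by (auto intro: finite_subset[OF image_mono])
    fix x assume "x \<in> s n ` space (lebesgue_on J)"
    have "s n -` {x} \<inter> space (lebesgue_on I) \<in> sets (lebesgue_on I)"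
      by (rule simple_functionD(2)[OF s(1)])
    then have "s n -` {x} \<inter> I \<in> sets lebesgue"
      using J by (auto simp: sets_restrict_space)
    then have "J \<inter> (s n -` {x} \<inter> I) \<in> sets (lebesgue_on J)"
      using J by (auto simp: sets_restrict_space)
    moreover have "J \<inter> (s n -` {x} \<inter> I) = s n -` {x} \<inter> space (lebesgue_on J)"
      using J by auto
    ultimately show "s n -` {x} \<inter> space (lebesgue_on J) \<in> sets (lebesgue_on J)" by simp
  qed
  moreover have "AE t in lebesgue_on J. (\<lambda>n. s n t) \<longlonglongrightarrow> u t"
    using s(2) J by (simp add: AE_restrict_space_iff) (auto elim: eventually_mono)
  ultimately show ?thesis unfolding strongly_measurable_on_def by blast
qed

lemma L2_subset:
  assumes u: "u \<in> L2 I" and J: "J \<subseteq> I" "J \<in> sets lebesgue" "I \<in> sets lebesgue"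
  shows "u \<in> L2 J"
proof -
  have "integrable (lebesgue_on I) (\<lambda>t. (norm (u t))\<^sup>2)" "strongly_measurable_on I u"
    using u by (simp_all add: L2_def)
  then show ?thesis
    using set_integrable_subset[of lebesgue I _ J] strongly_measurable_on_subset[OF _ J] J
    unfolding L2_def integrable_lebesgue_on_iff[OF J(2)] integrable_lebesgue_on_iff[OF J(3)] by blast
qed

text \<open>\<open>admissible\<close> quantifies over controls on the half line, whereas the
  controls obtained as limits live on \<open>{0..T}\<close>; the extension links the two.\<close>

lemma L2_extend_zero:
  assumes u: "u \<in> L2 I" and J: "I \<subseteq> J" "J \<in> sets lebesgue" "I \<in> sets lebesgue"
  shows "(\<lambda>t. if t \<in> I then u t else 0) \<in> L2 J"
proof -
  let ?v = "\<lambda>t. if t \<in> I then u t else 0"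
  obtain s where s: "\<And>n::nat. simple_function (lebesgue_on I) (s n)"
    "AE t in lebesgue_on I. (\<lambda>n. s n t) \<longlonglongrightarrow> u t"
    using u unfolding L2_def strongly_measurable_on_def by blast
  define r where "r n t = (if t \<in> I then s n t else 0)" for n t
  have "simple_function (lebesgue_on J) (r n)" for n
    unfolding simple_function_def
  proof (intro conjI ballI)
    have "r n ` space (lebesgue_on J) \<subseteq> insert 0 (s n ` space (lebesgue_on I))"
      by (auto simp: r_def)
    then show "finite (r n ` space (lebesgue_on J))"
      using simple_functionD(1)[OF s(1)[of n]] by (auto intro: finite_subset)
    fix x assume "x \<in> r n ` space (lebesgue_on J)"
    have "s n -` {x} \<inter> space (lebesgue_on I) \<in> sets (lebesgue_on I)"
      by (rule simple_functionD(2)[OF s(1)])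
    then have "s n -` {x} \<inter> I \<in> sets lebesgue"
      using J by (auto simp: sets_restrict_space)
    moreover have "J - I \<in> sets lebesgue" using J by auto
    ultimately have "(s n -` {x} \<inter> I) \<union> (if x = 0 then J - I else {}) \<in> sets lebesgue" by auto
    moreover have "r n -` {x} \<inter> space (lebesgue_on J) = (s n -` {x} \<inter> I) \<union> (if x = 0 then J - I else {})"
      using J by (auto simp: r_def split: if_splits)
    ultimately show "r n -` {x} \<inter> space (lebesgue_on J) \<in> sets (lebesgue_on J)"
      using J by (auto simp: sets_restrict_space_iff)
  qed
  moreover have "AE t in lebesgue_on J. (\<lambda>n. r n t) \<longlonglongrightarrow> ?v t"
    using s(2) J by (simp add: AE_restrict_space_iff r_def) (auto elim: eventually_mono)
  ultimately have "strongly_measurable_on J ?v" unfolding strongly_measurable_on_def by blast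
  moreover have "(\<lambda>x. indicator J x *\<^sub>R (norm (?v x))\<^sup>2) = (\<lambda>x. indicator I x *\<^sub>R (norm (u x))\<^sup>2)"
    using J by (intro ext) (auto simp: indicator_def)
  then have "integrable (lebesgue_on J) (\<lambda>t. (norm (?v t))\<^sup>2)"
    using u J by (simp add: L2_def integrable_restrict_space)
  ultimately show ?thesis by (simp add: L2_def)
qed

text \<open>A simple function has finitely many values, so the pairing is a finite sum of continuous
  scalar functions on measurable pieces.\<close>

lemma simple_cinner_measurable:
  fixes s c :: "real \<Rightarrow> 'u::complex_hilbert"
  assumes s: "simple_function (lebesgue_on {0..T}) s" and c: "continuous_on {0..T} c"
  shows "(\<lambda>t. cinner (s t) (c t)) \<in> borel_measurable (lebesgue_on {0..T})"
proof -
  let ?M = "lebesgue_on {0..T}"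
  have meas: "(\<lambda>t. \<Sum>y\<in>s ` {0..T}. indicator (s -` {y} \<inter> {0..T}) t *\<^sub>R cinner y (c t)) \<in> borel_measurable ?M"
  proof (intro borel_measurable_sum borel_measurable_scaleR)
    fix y
    show "indicator (s -` {y} \<inter> {0..T}) \<in> borel_measurable ?M"
      using simple_functionD(2)[OF s, of "{y}"] by (intro borel_measurable_indicator) simp
    show "(\<lambda>t. cinner y (c t)) \<in> borel_measurable ?M"
      by (intro continuous_imp_measurable_on_sets_lebesgue cinner.continuous_on continuous_on_const c) simp
  qed
  have fin: "finite (s ` {0..T})" using simple_functionD(1)[OF s] by simp
  have eq: "cinner (s t) (c t) = (\<Sum>y\<in>s ` {0..T}. indicator (s -` {y} \<inter> {0..T}) t *\<^sub>R cinner y (c t))"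
    if t: "t \<in> {0..T}" for t
  proof -
    have "(\<Sum>y\<in>s ` {0..T}. indicator (s -` {y} \<inter> {0..T}) t *\<^sub>R cinner y (c t)) =
        (\<Sum>y\<in>s ` {0..T}. if y = s t then cinner y (c t) else 0)"
      using t by (intro sum.cong) (auto simp: indicator_def)
    also have "\<dots> = cinner (s t) (c t)" using fin t by simp
    finally show ?thesis ..
  qed
  show ?thesis
    by (subst measurable_cong[OF eq]) (use meas in auto)
qed

lemma norm_cinner_le_squares: "cmod (cinner x y) \<le> ((norm x)\<^sup>2 + (norm y)\<^sup>2) / 2"
proof -
  have "2 * (norm x * norm y) \<le> (norm x)\<^sup>2 + (norm y)\<^sup>2"
    using sum_squares_bound[of "norm x" "norm y"] by (simp add: mult.assoc)
  then show ?thesis using norm_cinner_le[of x y] by simp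
qed

text \<open>Half the sum of the squares replaces the Cauchy-Schwarz inequality. The bound is not
  homogeneous; later uses restore homogeneity by scaling to unit norm or unit energy.\<close>

lemma pairing_integrable:
  fixes u c :: "real \<Rightarrow> 'u::complex_hilbert"
  assumes u: "u \<in> L2 {0..T}" and c: "continuous_on {0..T} c"
  shows "integrable (lebesgue_on {0..T}) (\<lambda>t. cinner (u t) (c t))"
    and "cmod (LINT t|lebesgue_on {0..T}. cinner (u t) (c t)) \<le>
      ((LINT t|lebesgue_on {0..T}. (norm (u t))\<^sup>2) + integral {0..T} (\<lambda>t. (norm (c t))\<^sup>2)) / 2"
proof -
  let ?M = "lebesgue_on {0..T}"
  obtain s where s: "\<And>n::nat. simple_function ?M (s n)" "AE t in ?M. (\<lambda>n. s n t) \<longlonglongrightarrow> u t"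
    using u unfolding L2_def strongly_measurable_on_def by blast
  have meas: "(\<lambda>t. cinner (u t) (c t)) \<in> borel_measurable ?M"
  proof (rule AE_limit_measurable)
    show "(\<lambda>t. cinner (s n t) (c t)) \<in> borel_measurable ?M" for n
      by (rule simple_cinner_measurable[OF s(1) c])
    show "AE t in ?M. (\<lambda>n. cinner (s n t) (c t)) \<longlonglongrightarrow> cinner (u t) (c t)"
      using s(2) by eventually_elim (intro cinner.tendsto tendsto_const)
  qed simp
  have c2: "integrable ?M (\<lambda>t. (norm (c t))\<^sup>2)"
    by (intro continuous_imp_integrable_real continuous_intros c)
  have u2: "integrable ?M (\<lambda>t. (norm (u t))\<^sup>2)"
    using u by (simp add: L2_def)
  have sum: "integrable ?M (\<lambda>t. ((norm (u t))\<^sup>2 + (norm (c t))\<^sup>2) / 2)"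
    using c2 u2 by simp
  show int: "integrable ?M (\<lambda>t. cinner (u t) (c t))"
    by (rule Bochner_Integration.integrable_bound[OF sum meas])
      (use norm_cinner_le_squares in \<open>auto intro!: always_eventually order_trans[OF norm_cinner_le_squares]\<close>)
  have "cmod (LINT t|?M. cinner (u t) (c t)) \<le> (LINT t|?M. ((norm (u t))\<^sup>2 + (norm (c t))\<^sup>2) / 2)"
    by (rule Bochner_Integration.integral_norm_bound_integral[OF int sum]) (rule norm_cinner_le_squares)
  also have "\<dots> = ((LINT t|?M. (norm (u t))\<^sup>2) + (LINT t|?M. (norm (c t))\<^sup>2)) / 2"
    using c2 u2 by simp
  also have "(LINT t|?M. (norm (c t))\<^sup>2) = integral {0..T} (\<lambda>t. (norm (c t))\<^sup>2)"
    by (rule lebesgue_integral_eq_integral[OF c2]) simp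
  finally show "cmod (LINT t|?M. cinner (u t) (c t)) \<le>
      ((LINT t|?M. (norm (u t))\<^sup>2) + integral {0..T} (\<lambda>t. (norm (c t))\<^sup>2)) / 2" .
qed

text \<open>\<open>f\<close> is sampled at the grid point below \<open>t\<close>, with half the mesh
  allowed by uniform continuity. Rounding down keeps the samples inside
  \<open>{0..T}\<close>.\<close>

lemma continuous_simple_approximation:
  fixes f :: "real \<Rightarrow> 'a::real_normed_vector"
  assumes f: "continuous_on {0..T} f" and e: "e > 0"
  shows "\<exists>s. simple_function (lebesgue_on {0..T}) s \<and> (\<forall>t\<in>{0..T}. norm (s t - f t) < e)"
proof -
  have "uniformly_continuous_on {0..T} f"
    by (rule compact_uniformly_continuous[OF f]) simp
  then obtain d where d: "d > 0" "\<And>x y. x \<in> {0..T} \<Longrightarrow> y \<in> {0..T} \<Longrightarrow> dist y x < d \<Longrightarrow> dist (f y) (f x) < e"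
    using e unfolding uniformly_continuous_on_def by metis
  define r where "r = d / 2"
  have r: "r > 0" "r < d" using d(1) by (auto simp: r_def)
  define h where "h t = real_of_int \<lfloor>t / r\<rfloor>" for t
  have h_le: "r * h t \<le> t" "t < r * h t + r" for t
  proof -
    have "h t \<le> t / r" "t / r < h t + 1" unfolding h_def by linarith+
    then show "r * h t \<le> t" "t < r * h t + r" using r(1) by (simp_all add: field_simps)
  qed
  have h_nonneg: "h t \<ge> 0" if "t \<ge> 0" for t using that r(1) by (simp add: h_def)
  have "h \<in> borel_measurable lborel"
    unfolding h_def by measurable
  then have "h \<in> borel_measurable lebesgue" by (rule measurable_completion)
  then have h_meas: "h \<in> borel_measurable (lebesgue_on {0..T})"
    by (rule measurable_restrict_space1)
  have "h ` {0..T} \<subseteq> real_of_int ` {0..\<lfloor>T / r\<rfloor>}"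
    using r(1) by (auto simp: h_def intro!: imageI floor_mono divide_right_mono)
  then have "finite (h ` {0..T})" by (rule finite_subset) simp
  then have "simple_function (lebesgue_on {0..T}) h"
    using h_meas by (intro simple_function_borel_measurable) auto
  then have "simple_function (lebesgue_on {0..T}) ((\<lambda>y. f (r * y)) \<circ> h)"
    by (rule simple_function_compose)
  moreover have "norm (f (r * h t) - f t) < e" if t: "t \<in> {0..T}" for t
  proof -
    have "r * h t \<in> {0..T}" using h_le(1)[of t] h_nonneg[of t] t r(1) by auto
    moreover have "dist (r * h t) t < d" using h_le[of t] r(2) by (simp add: dist_real_def)
    ultimately show ?thesis using d(2)[OF t] by (simp add: dist_norm)
  qed
  ultimately show ?thesis by (intro exI[of _ "(\<lambda>y. f (r * y)) \<circ> h"]) auto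
qed

text \<open>The Cauchy-Schwarz inequality with the weights \<open>sqrt (1/2) ^ k\<close> and
  \<open>sqrt 2 ^ k\<close>; the squares of the former sum to at most \<open>2\<close>.\<close>

lemma sum_square_le_weighted:
  fixes d :: "nat \<Rightarrow> real"
  shows "(\<Sum>k<n. d k)\<^sup>2 \<le> 2 * (\<Sum>k<n. 2 ^ k * (d k)\<^sup>2)"
proof -
  have sq: "(sqrt a ^ k)\<^sup>2 = a ^ k" if "a \<ge> 0" for a :: real and k
    using that by (metis mult.commute power_mult real_sqrt_pow2)
  have "sqrt (1/2) * sqrt 2 = 1" by (simp flip: real_sqrt_mult)
  then have "sqrt (1/2) ^ k * (sqrt 2 ^ k * x) = x" for k x
    by (metis mult.assoc mult_1 power_mult_distrib power_one)
  then have "(\<Sum>k<n. d k)\<^sup>2 = (\<Sum>k<n. sqrt (1/2) ^ k * (sqrt 2 ^ k * d k))\<^sup>2"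
    by (simp only:)
  also have "\<dots> \<le> (\<Sum>k<n. (sqrt (1/2) ^ k)\<^sup>2) * (\<Sum>k<n. (sqrt 2 ^ k * d k)\<^sup>2)"
    by (rule Cauchy_Schwarz_ineq_sum)
  also have "\<dots> = (\<Sum>k<n. (1/2) ^ k) * (\<Sum>k<n. 2 ^ k * (d k)\<^sup>2)"
    unfolding power_mult_distrib by (subst (1 2) sq) simp_all
  also have "(\<Sum>k<n. (1/2::real) ^ k) * (\<Sum>k<n. 2 ^ k * (d k)\<^sup>2) \<le> 2 * (\<Sum>k<n. 2 ^ k * (d k)\<^sup>2)"
    by (intro mult_right_mono sum_nonneg) (auto simp: sum_gp_strict)
  finally show ?thesis .
qed

text \<open>As in the Riesz-Fischer theorem; the weights \<open>2 ^ k\<close> produce an integrable majorant of all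
  \<open>\<parallel>u\<^sub>n\<parallel>\<^sup>2\<close>.\<close>

lemma L2_limit:
  fixes u :: "nat \<Rightarrow> real \<Rightarrow> 'u::complex_hilbert"
  assumes cont: "\<And>n. continuous_on {0..T} (u n)"
    and fast: "\<And>n. integral {0..T} (\<lambda>t. (norm (u (Suc n) t - u n t))\<^sup>2) \<le> Q * (1/4) ^ n"
  shows "\<exists>v\<in>L2 {0..T}. \<forall>c. continuous_on {0..T} c \<longrightarrow>
    (\<lambda>n. LINT t|lebesgue_on {0..T}. cinner (u n t) (c t)) \<longlonglongrightarrow> (LINT t|lebesgue_on {0..T}. cinner (v t) (c t))"
proof -
  let ?M = "lebesgue_on {0..T}"
  define d where "d n t = norm (u (Suc n) t - u n t)" for n t
  define f where "f n t = 2 ^ n * (d n t)\<^sup>2" for n t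
  have d_cont: "continuous_on {0..T} (d n)" for n
    unfolding d_def by (intro continuous_intros cont)
  have f_int: "integrable ?M (f n)" for n
    unfolding f_def by (intro continuous_imp_integrable_real continuous_intros d_cont)
  have f_nonneg: "f n t \<ge> 0" for n t by (simp add: f_def)
  \<comment> \<open>The weight \<open>2 ^ n\<close> against the decay \<open>(1/4) ^ n\<close> still
    leaves a summable \<open>(1/2) ^ n\<close>.\<close>
  have f_le: "(LINT t|?M. f n t) \<le> Q * (1/2) ^ n" for n
  proof -
    have "(LINT t|?M. f n t) = integral {0..T} (f n)"
      by (rule lebesgue_integral_eq_integral[OF f_int]) simp
    also have "\<dots> = 2 ^ n * integral {0..T} (\<lambda>t. (d n t)\<^sup>2)"
      unfolding f_def by simp
    also have "\<dots> \<le> 2 ^ n * (Q * (1/4) ^ n)"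
      using fast[of n] unfolding d_def by (intro mult_left_mono) auto
    also have "\<dots> = Q * (2 * (1/4)) ^ n" by (simp only: power_mult_distrib mult_ac)
    finally show ?thesis by simp
  qed
  have summ: "summable (\<lambda>n. LINT t|?M. norm (f n t))"
  proof (rule summable_comparison_test'[where N=0])
    show "summable (\<lambda>n. Q * (1/2) ^ n)" by (intro summable_mult summable_geometric) simp
    show "norm (LINT t|?M. norm (f n t)) \<le> Q * (1/2) ^ n" for n
      using f_le[of n] f_nonneg by (simp add: abs_of_nonneg)
  qed
  have AE_sum: "AE t in ?M. summable (\<lambda>n. norm (f n t))"
  proof -
    have "(\<integral>\<^sup>+t. (\<Sum>n. ennreal (f n t)) \<partial>?M) = (\<Sum>n. \<integral>\<^sup>+t. ennreal (f n t) \<partial>?M)"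
      using f_int by (intro nn_integral_suminf) auto
    also have "\<dots> = (\<Sum>n. ennreal (LINT t|?M. f n t))"
      by (intro suminf_cong nn_integral_eq_integral f_int) (simp add: f_nonneg)
    also have "\<dots> \<noteq> \<infinity>"
      using summ f_nonneg by (subst suminf_ennreal2) auto
    finally have "AE t in ?M. (\<Sum>n. ennreal (f n t)) \<noteq> \<infinity>"
      using f_int by (intro nn_integral_PInf_AE) auto
    then show ?thesis
      using f_nonneg by (auto elim!: eventually_mono intro!: summable_suminf_not_top)
  qed
  \<comment> \<open>The factor \<open>4\<close> is the \<open>2\<close> of
    \<open>norm_add_square_le\<close> times the \<open>2\<close> of
    \<open>sum_square_le_weighted\<close>.\<close>
  define w where "w t = 2 * (norm (u 0 t))\<^sup>2 + 4 * (\<Sum>n. f n t)" for t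
  have w_int: "integrable ?M w"
  proof -
    have "integrable ?M (\<lambda>t. 2 * (norm (u 0 t))\<^sup>2)"
      by (intro continuous_imp_integrable_real continuous_intros cont)
    moreover have "integrable ?M (\<lambda>t. \<Sum>n. f n t)"
      by (rule integrable_suminf[OF f_int AE_sum summ])
    ultimately show ?thesis unfolding w_def by simp
  qed
  have u_le: "(norm (u n t))\<^sup>2 \<le> w t" if t: "summable (\<lambda>n. f n t)" for n t
  proof -
    have "norm (u n t - u 0 t) \<le> (\<Sum>k<n. d k t)"
      using norm_sum[of "\<lambda>k. u (Suc k) t - u k t" "{..<n}"]
      unfolding sum_lessThan_telescope[of "\<lambda>k. u k t" n] by (simp add: d_def)
    then have "(norm (u n t - u 0 t))\<^sup>2 \<le> (\<Sum>k<n. d k t)\<^sup>2" by (intro power_mono) auto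
    also have "\<dots> \<le> 2 * (\<Sum>k<n. f k t)" unfolding f_def by (rule sum_square_le_weighted)
    also have "\<dots> \<le> 2 * (\<Sum>k. f k t)"
      using t f_nonneg by (intro mult_left_mono sum_le_suminf) auto
    finally show ?thesis
      using norm_add_square_le[of "u 0 t" "u n t - u 0 t"] by (simp add: w_def)
  qed
  define v where "v t = lim (\<lambda>n. u n t)" for t
  have u_lim: "(\<lambda>n. u n t) \<longlonglongrightarrow> v t" if t: "summable (\<lambda>n. f n t)" for t
  proof -
    \<comment> \<open>An increment above \<open>(1/2) ^ n\<close> is dominated by its weighted
      square, so summability of \<open>f\<close> yields absolute convergence of the
      increments.\<close>
    have d_le: "d n t \<le> (1/2) ^ n + f n t" for n
    proof (cases "d n t \<le> (1/2) ^ n")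
      case True
      then show ?thesis using f_nonneg[of n t] by linarith
    next
      case False
      then have "1 \<le> 2 ^ n * d n t" by (simp add: power_one_over field_simps)
      then have "d n t * 1 \<le> d n t * (2 ^ n * d n t)"
        by (intro mult_left_mono) (auto simp: d_def)
      then have "d n t \<le> f n t" by (simp add: f_def power2_eq_square mult_ac)
      then show ?thesis using zero_le_power[of "1/2::real" n] by linarith
    qed
    have "summable (\<lambda>n. u (Suc n) t - u n t)"
    proof (rule summable_comparison_test'[where N=0])
      show "summable (\<lambda>n. (1/2) ^ n + f n t)" by (intro summable_add summable_geometric t) simp
      show "norm (u (Suc n) t - u n t) \<le> (1/2) ^ n + f n t" for n
        using d_le[of n] by (simp add: d_def)
    qed
    then have "(\<lambda>n. (\<Sum>k<n. u (Suc k) t - u k t) + u 0 t) \<longlonglongrightarrow> (\<Sum>k. u (Suc k) t - u k t) + u 0 t"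
      by (intro tendsto_add tendsto_const summable_LIMSEQ)
    then have "convergent (\<lambda>n. u n t)"
      unfolding sum_lessThan_telescope[of "\<lambda>k. u k t"] by (auto simp: convergent_def)
    then show ?thesis by (simp add: v_def convergent_LIMSEQ_iff)
  qed
  have AE_f: "AE t in ?M. summable (\<lambda>n. f n t)"
    using AE_sum f_nonneg by simp
  have v_L2: "v \<in> L2 {0..T}"
    unfolding L2_def
  proof (intro CollectI conjI)
    \<comment> \<open>The continuous \<open>u n\<close> are replaced by simple functions within
      \<open>1 / Suc n\<close>, which have the same limit \<open>v\<close>, as strong measurability
      demands.\<close>
    have "\<exists>s. \<forall>n. simple_function ?M (s n) \<and> (\<forall>t\<in>{0..T}. norm (s n t - u n t) < 1 / Suc n)"
      by (intro choice allI continuous_simple_approximation cont) simp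
    then obtain s where s: "\<And>n. simple_function ?M (s n)" "\<And>n t. t \<in> {0..T} \<Longrightarrow> norm (s n t - u n t) < 1 / Suc n"
      by blast
    have "AE t in ?M. (\<lambda>n. s n t) \<longlonglongrightarrow> v t"
      using AE_f AE_space
    proof eventually_elim
      case (elim t)
      have "(\<lambda>n. s n t - u n t) \<longlonglongrightarrow> 0"
        by (rule Lim_null_comparison[OF _ lim_1_over_n[THEN LIMSEQ_Suc]])
          (use s(2) elim in \<open>auto intro!: always_eventually less_imp_le simp del: of_nat_Suc\<close>)
      from tendsto_add[OF this u_lim[OF elim(1)]] show ?case by simp
    qed
    then show "strongly_measurable_on {0..T} v"
      using s(1) unfolding strongly_measurable_on_def by blast
    have meas: "(\<lambda>t. (norm (v t))\<^sup>2) \<in> borel_measurable ?M"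
    proof (rule AE_limit_measurable)
      show "(\<lambda>t. (norm (u n t))\<^sup>2) \<in> borel_measurable ?M" for n
        by (intro continuous_imp_measurable_on_sets_lebesgue continuous_intros cont) simp
      show "AE t in ?M. (\<lambda>n. (norm (u n t))\<^sup>2) \<longlonglongrightarrow> (norm (v t))\<^sup>2"
        using AE_f by eventually_elim (intro tendsto_intros u_lim)
    qed simp
    have "AE t in ?M. norm ((norm (v t))\<^sup>2) \<le> norm (w t)"
      using AE_f
    proof eventually_elim
      case (elim t)
      have "(norm (v t))\<^sup>2 \<le> w t"
        by (rule LIMSEQ_le_const2[where X="\<lambda>n. (norm (u n t))\<^sup>2"])
          (use u_le[OF elim] in \<open>auto intro!: tendsto_intros u_lim elim\<close>)
      then show ?case by simp
    qed
    then show "integrable ?M (\<lambda>t. (norm (v t))\<^sup>2)"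
      by (rule Bochner_Integration.integrable_bound[OF w_int meas])
  qed
  have "(\<lambda>n. LINT t|?M. cinner (u n t) (c t)) \<longlonglongrightarrow> (LINT t|?M. cinner (v t) (c t))"
    if c: "continuous_on {0..T} c" for c
  proof (rule integral_dominated_convergence)
    show "(\<lambda>t. cinner (v t) (c t)) \<in> borel_measurable ?M"
      using pairing_integrable(1)[OF v_L2 c] by (rule borel_measurable_integrable)
    show "(\<lambda>t. cinner (u n t) (c t)) \<in> borel_measurable ?M" for n
      by (intro continuous_imp_measurable_on_sets_lebesgue cinner.continuous_on cont c) simp
    show "integrable ?M (\<lambda>t. (w t + (norm (c t))\<^sup>2) / 2)"
    proof -
      have "integrable ?M (\<lambda>t. (norm (c t))\<^sup>2)"
        by (intro continuous_imp_integrable_real continuous_intros c)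
      then show ?thesis using w_int by simp
    qed
    show "AE t in ?M. (\<lambda>n. cinner (u n t) (c t)) \<longlonglongrightarrow> cinner (v t) (c t)"
      using AE_f by eventually_elim (intro cinner.tendsto tendsto_const u_lim)
    show "AE t in ?M. norm (cinner (u n t) (c t)) \<le> (w t + (norm (c t))\<^sup>2) / 2" for n
      using AE_f
    proof eventually_elim
      case (elim t)
      show ?case
        using norm_cinner_le_squares[of "u n t" "c t"] u_le[OF elim, of n] by (simp add: field_simps)
    qed
  qed
  then show ?thesis using v_L2 by blast
qed

section \<open>Duality\<close>

lemma integral_reverse:
  fixes f :: "real \<Rightarrow> real"
  shows "integral {0..T} (\<lambda>s. f (T - s)) = integral {0..T} f"
proof -
  have "integral {0..T} (\<lambda>s. f (T - s)) = integral {- T - (- T)..0 - (- T)} (\<lambda>s. f (- (s + - T)))"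
    by simp
  also have "\<dots> = integral {- T..- 0} (\<lambda>s. f (- s))"
    by (subst integral_shift_real_ivl) simp
  also have "\<dots> = integral {0..T} f" using Henstock_Kurzweil_Integration.integral_reflect_real[of T 0 f] by simp
  finally show ?thesis .
qed

locale control_system =
  fixes A :: "('h::complex_hilbert, 'h) unbounded_op" and B :: "'u::complex_hilbert \<Rightarrow> 'h \<Rightarrow> complex"
  assumes gen: "generates_C0_semigroup A" and ctrl: "control_operator A B"
begin

abbreviation "S \<equiv> semigroup_of A"

lemma C0_S: "C0_semigroup S" and generator_S [simp]: "generator S = A"
  using someI_ex[OF gen[unfolded generates_C0_semigroup_def]] by (simp_all add: semigroup_of_def)

sublocale primal: c0_semigroup S by unfold_locales (rule C0_S)

abbreviation "Sa t \<equiv> bounded_adjoint (S t)"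
abbreviation "Da \<equiv> dom (adjoint_op A)"

lemma generator_Sa [simp]: "generator (\<lambda>t. Sa t) = adjoint_op A"
  using primal.generator_adjoint by simp

sublocale dual: c0_semigroup "\<lambda>t. Sa t" by unfold_locales (rule primal.C0_adjoint)

definition "Bstar x = the (control_adjoint A B x)"

lemma ctrl_bound: obtains C where "C \<ge> 0"
  "\<And>v x. x \<in> Da \<Longrightarrow> cmod (B v x) \<le> C * norm v * (norm x + norm (the (adjoint_op A x)))"
proof -
  obtain C where C: "\<And>v x. x \<in> Da \<Longrightarrow> cmod (B v x) \<le> C * norm v * graph_norm (adjoint_op A) x"
    using ctrl unfolding control_operator_def by blast
  have "cmod (B v x) \<le> \<bar>C\<bar> * norm v * (norm x + norm (the (adjoint_op A x)))" if x: "x \<in> Da" for v x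
  proof -
    have "C * norm v * graph_norm (adjoint_op A) x \<le> \<bar>C\<bar> * norm v * graph_norm (adjoint_op A) x"
      by (intro mult_right_mono) (auto simp: graph_norm_def)
    also have "\<dots> \<le> \<bar>C\<bar> * norm v * (norm x + norm (the (adjoint_op A x)))"
      unfolding graph_norm_def by (intro mult_left_mono sqrt_sum_squares_le_sum) auto
    finally show ?thesis using C[OF x, of v] by linarith
  qed
  then show thesis by (intro that[of "\<bar>C\<bar>"]) auto
qed

text \<open>By the Riesz theorem for \<open>v \<mapsto> B v x\<close>, the definite description in
  \<open>control_adjoint\<close> has the intended value.\<close>

lemma control_adjoint_eq:
  assumes x: "x \<in> Da"
  shows "control_adjoint A B x = Some (Bstar x)" and "B v x = cinner v (Bstar x)"
proof -
  obtain C where C: "C \<ge> 0"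
    "\<And>v x. x \<in> Da \<Longrightarrow> cmod (B v x) \<le> C * norm v * (norm x + norm (the (adjoint_op A x)))"
    by (rule ctrl_bound) blast
  have add: "B (v + w) x = B v x + B w x" and sc: "B (scaleC a v) x = a * B v x" for v w a
    using ctrl by (auto simp: control_operator_def)
  have "bounded_linear (\<lambda>v. B v x)"
    by (rule bounded_linear_intro[where K="C * (norm x + norm (the (adjoint_op A x)))"])
      (use C(2)[OF x] in \<open>auto simp: add sc scaleR_scaleC mult_ac scaleC_complex_def\<close>)
  then have "bounded_clinear (\<lambda>v. B v x)"
    by (simp add: bounded_clinear_def sc scaleC_complex_def)
  then obtain w where w: "\<forall>v. B v x = cinner v w" using riesz_representation by blast
  then have "(THE w. \<forall>v. B v x = cinner v w) = w"
    by (intro the_equality) (auto intro: cinner_eqI)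
  then have "control_adjoint A B x = Some w" using x by (simp add: control_adjoint_def domIff)
  then show "control_adjoint A B x = Some (Bstar x)" "B v x = cinner v (Bstar x)"
    using w by (auto simp: Bstar_def)
qed

text \<open>A particular constant is fixed because the locale \<open>observation\<close> takes it as
  a parameter.\<close>

definition "Bstar_bound = (SOME c. c \<ge> 0 \<and> (\<forall>x\<in>Da. norm (Bstar x) \<le> c * (norm x + norm (the (adjoint_op A x)))))"

lemma Bstar_bound:
  "Bstar_bound \<ge> 0" "x \<in> Da \<Longrightarrow> norm (Bstar x) \<le> Bstar_bound * (norm x + norm (the (adjoint_op A x)))"
proof -
  obtain C where C: "C \<ge> 0"
    "\<And>v x. x \<in> Da \<Longrightarrow> cmod (B v x) \<le> C * norm v * (norm x + norm (the (adjoint_op A x)))"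
    by (rule ctrl_bound) blast
  have "norm (Bstar x) \<le> C * (norm x + norm (the (adjoint_op A x)))" if x: "x \<in> Da" for x
  proof -
    have "norm (Bstar x) * norm (Bstar x) = cmod (cinner (Bstar x) (Bstar x))"
      by (simp add: cinner_self power2_eq_square norm_mult)
    also have "\<dots> \<le> (C * (norm x + norm (the (adjoint_op A x)))) * norm (Bstar x)"
      using C(2)[OF x, of "Bstar x"] by (simp add: control_adjoint_eq[OF x] mult_ac)
    finally show ?thesis
      using C(1) by (cases "Bstar x = 0") (auto simp: mult_le_cancel_right)
  qed
  then have "\<exists>c. c \<ge> 0 \<and> (\<forall>x\<in>Da. norm (Bstar x) \<le> c * (norm x + norm (the (adjoint_op A x))))"
    using C(1) by blast
  from someI_ex[OF this] show "Bstar_bound \<ge> 0"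
    "x \<in> Da \<Longrightarrow> norm (Bstar x) \<le> Bstar_bound * (norm x + norm (the (adjoint_op A x)))"
    unfolding Bstar_bound_def by blast+
qed

lemma Da_closed:
  "x \<in> Da \<Longrightarrow> y \<in> Da \<Longrightarrow> x + y \<in> Da" "x \<in> Da \<Longrightarrow> y \<in> Da \<Longrightarrow> x - y \<in> Da"
  "x \<in> Da \<Longrightarrow> scaleC a x \<in> Da" "x \<in> Da \<Longrightarrow> r *\<^sub>R x \<in> Da" "x \<in> Da \<Longrightarrow> t \<ge> 0 \<Longrightarrow> Sa t x \<in> Da"
  using dual.generator_add(1)[of x y] dual.generator_diff(1)[of x y] dual.generator_scaleC(1)[of x a]
    dual.generator_scaleR(1)[of x r] dual.generator_S(1)[of x t] by simp_all

sublocale dual: observation "\<lambda>t. Sa t" Bstar Bstar_bound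
proof
  have dual_dom: "B v \<in> dual_adjoint_domain A" for v using ctrl by (simp add: control_operator_def)
  show "Bstar (x + y) = Bstar x + Bstar y" if "x \<in> dual.D" "y \<in> dual.D" for x y
  proof (rule cinner_eqI)
    fix v
    have "B v (x + y) = B v x + B v y"
      using dual_dom[of v] that unfolding dual_adjoint_domain_def by simp
    then show "cinner v (Bstar (x + y)) = cinner v (Bstar x + Bstar y)"
      using that Da_closed(1)[of x y]
      by (simp only: generator_Sa control_adjoint_eq(2)[symmetric] cinner_add_right)
  qed
  show "Bstar (scaleC a x) = scaleC a (Bstar x)" if "x \<in> dual.D" for a x
  proof (rule cinner_eqI)
    fix v
    have "B v (scaleC a x) = cnj a * B v x"
      using dual_dom[of v] that unfolding dual_adjoint_domain_def by simp
    then show "cinner v (Bstar (scaleC a x)) = cinner v (scaleC a (Bstar x))"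
      using that Da_closed(3)[of x a]
      by (simp only: generator_Sa control_adjoint_eq(2)[symmetric] cinner_scaleC_right)
  qed
qed (use Bstar_bound in auto)

text \<open>The output of the adjoint semigroup in reversed time. Its L2 pairing with a control is
  the value of the input map at \<open>x\<close>, so that the input map is the adjoint of this
  output map.\<close>

definition "out T x s = Bstar (Sa (T - s) x)"

lemma continuous_on_out:
  assumes "x \<in> Da"
  shows "continuous_on {0..T} (out T x)"
  unfolding out_def
  by (rule continuous_on_compose2[OF dual.continuous_on_output, of x "{0..T}" "\<lambda>s. T - s"])
    (use assms in \<open>auto intro!: continuous_intros\<close>)

lemma integral_out_square: "integral {0..T} (\<lambda>s. (norm (out T x s))\<^sup>2) = dual.energy T x"
  unfolding dual.energy_def out_def by (rule integral_reverse)

lemma out_linear: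
  assumes "x \<in> Da" "y \<in> Da" "s \<le> T"
  shows "out T (x + y) s = out T x s + out T y s" "out T (x - y) s = out T x s - out T y s"
    "out T (scaleC a x) s = scaleC a (out T x s)" "out T (r *\<^sub>R x) s = r *\<^sub>R out T x s"
  using assms Da_closed(5)[of _ "T - s"]
  by (simp_all add: out_def dual.plus dual.minus dual.scaleC dual.scaleR dual.C_add dual.C_diff
      dual.C_scaleC dual.C_scaleR)

definition "pairing T u x = (LINT s|lebesgue_on {0..T}. cinner (u s) (out T x s))"

lemma input_map_eq:
  assumes x: "x \<in> Da"
  shows "input_map A B T u x = pairing T u x"
  unfolding input_map_def pairing_def
proof (rule Bochner_Integration.integral_cong[OF refl])
  fix s assume "s \<in> space (lebesgue_on {0..T})"
  then have "Sa (T - s) x \<in> Da" using Da_closed(5)[OF x, of "T - s"] by simp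
  then show "semigroup_ext A (T - s) (B (u s)) x = cinner (u s) (out T x s)"
    using x by (simp add: semigroup_ext_def control_adjoint_eq(2) out_def)
qed

lemma input_map_outside: "x \<notin> Da \<Longrightarrow> input_map A B T u x = 0"
  by (simp add: input_map_def semigroup_ext_def)

lemma pairing_linear:
  assumes u: "u \<in> L2 {0..T}" and x: "x \<in> Da" and y: "y \<in> Da"
  shows "pairing T u (x + y) = pairing T u x + pairing T u y"
    and "pairing T u (scaleC a x) = cnj a * pairing T u x"
proof -
  note int = pairing_integrable(1)[OF u continuous_on_out]
  have "pairing T u (x + y) = (LINT s|lebesgue_on {0..T}. cinner (u s) (out T x s) + cinner (u s) (out T y s))"
    unfolding pairing_def
    by (intro Bochner_Integration.integral_cong refl) (simp add: out_linear x y cinner_add_right)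
  then show "pairing T u (x + y) = pairing T u x + pairing T u y"
    by (simp add: pairing_def int x y)
  have "pairing T u (scaleC a x) = (LINT s|lebesgue_on {0..T}. cnj a * cinner (u s) (out T x s))"
    unfolding pairing_def
    by (intro Bochner_Integration.integral_cong refl) (simp add: out_linear[of x x] x cinner_scaleC_right)
  then show "pairing T u (scaleC a x) = cnj a * pairing T u x"
    by (simp add: pairing_def)
qed

lemma pairing_bound:
  assumes u: "u \<in> L2 {0..T}" and x: "x \<in> Da"
  shows "cmod (pairing T u x) \<le> ((LINT s|lebesgue_on {0..T}. (norm (u s))\<^sup>2) + dual.energy T x) / 2"
  using pairing_integrable(2)[OF u continuous_on_out[OF x]] unfolding pairing_def integral_out_square .

text \<open>The real bilinear form of the controllability Gramian on \<open>Da\<close>: outputs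
  appear both as controls and as test functions.\<close>

definition "form T x y = integral {0..T} (\<lambda>s. inner (out T x s) (out T y s))"

lemma form_integrable:
  "x \<in> Da \<Longrightarrow> y \<in> Da \<Longrightarrow> (\<lambda>s. inner (out T x s) (out T y s)) integrable_on {0..T}"
  by (intro integrable_continuous_interval continuous_intros continuous_on_out)

lemma form_self: "form T x x = dual.energy T x"
  by (simp add: form_def integral_out_square flip: power2_norm_eq_inner)

lemma form_pairing:
  assumes x: "x \<in> Da" and y: "y \<in> Da"
  shows "form T x y = Re (pairing T (out T x) y)"
proof -
  have int: "integrable (lebesgue_on {0..T}) (\<lambda>s. cinner (out T x s) (out T y s))"
    by (intro continuous_imp_integrable_real cinner.continuous_on continuous_on_out x y)
  have "Re (pairing T (out T x) y) = (LINT s|lebesgue_on {0..T}. Re (cinner (out T x s) (out T y s)))"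
    unfolding pairing_def using int by simp
  also have "\<dots> = integral {0..T} (\<lambda>s. Re (cinner (out T x s) (out T y s)))"
    using int by (intro lebesgue_integral_eq_integral) auto
  finally show ?thesis by (simp add: form_def Re_cinner)
qed

lemma subspace_Da: "subspace Da"
  using primal.subspace_Da by simp

lemma semi_inner_form: "semi_inner Da (form T)"
proof
  show "subspace Da" by (rule subspace_Da)
  show "form T x y = form T y x" for x y by (simp add: form_def inner_commute)
  show "form T (x + y) z = form T x z + form T y z" if "x \<in> Da" "y \<in> Da" "z \<in> Da" for x y z
  proof -
    have "form T (x + y) z = integral {0..T} (\<lambda>s. inner (out T x s) (out T z s) + inner (out T y s) (out T z s))"
      unfolding form_def by (intro integral_cong) (simp add: out_linear that inner_add_left)
    then show ?thesis using that by (simp add: form_def integral_add form_integrable)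
  qed
  show "form T (r *\<^sub>R x) z = r * form T x z" if "x \<in> Da" "z \<in> Da" for r x z
  proof -
    have "form T (r *\<^sub>R x) z = integral {0..T} (\<lambda>s. r * inner (out T x s) (out T z s))"
      unfolding form_def by (intro integral_cong) (simp add: out_linear[of x x] that)
    then show ?thesis by (simp add: form_def)
  qed
  show "0 \<le> form T x x" for x by (simp add: form_self dual.energy_nonneg)
qed

lemma energy_sqrt_scale: "x \<in> Da \<Longrightarrow> sqrt (dual.energy T (r *\<^sub>R x)) = \<bar>r\<bar> * sqrt (dual.energy T x)"
  using dual.energy_scaleR[of x T r] by (simp add: real_sqrt_mult)

text \<open>A sequence that is Cauchy in energy need not have a limit in \<open>Da\<close>, but its
  outputs converge to a control. This control stands for the missing limit when uniform boundedness
  and \<open>riesz_sequence\<close> are applied to \<open>form\<close>.\<close>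

lemma out_limit:
  assumes z: "\<And>n. z n \<in> Da" and fast: "\<And>n. dual.energy T (z (Suc n) - z n) \<le> Q * (1/4) ^ n"
  shows "\<exists>u\<in>L2 {0..T}. \<forall>x\<in>Da. (\<lambda>n. form T (z n) x) \<longlonglongrightarrow> Re (pairing T u x)"
proof -
  have "integral {0..T} (\<lambda>s. (norm (out T (z (Suc n)) s - out T (z n) s))\<^sup>2) = dual.energy T (z (Suc n) - z n)" for n
    unfolding integral_out_square[symmetric] by (intro integral_cong) (simp add: out_linear z)
  then obtain u where u: "u \<in> L2 {0..T}"
    "\<And>c. continuous_on {0..T} c \<Longrightarrow> (\<lambda>n. LINT s|lebesgue_on {0..T}. cinner (out T (z n) s) (c s))
      \<longlonglongrightarrow> (LINT s|lebesgue_on {0..T}. cinner (u s) (c s))"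
    using L2_limit[of T "\<lambda>n. out T (z n)" Q] continuous_on_out[OF z] fast by auto
  have "(\<lambda>n. form T (z n) x) \<longlonglongrightarrow> Re (pairing T u x)" if x: "x \<in> Da" for x
    unfolding form_pairing[OF z x] using u(2)[OF continuous_on_out[OF x]]
    unfolding pairing_def by (rule tendsto_Re)
  then show ?thesis using u(1) by blast
qed

subsection \<open>Admissibility\<close>

text \<open>The energy estimate makes the pairing with a fixed control bounded for the norm of the
  pivot space. The inhomogeneous \<open>pairing_bound\<close> is applied to unit vectors and
  scaled.\<close>

lemma pivot_range:
  assumes u: "u \<in> L2 {0..T}" and m: "\<And>x. x \<in> Da \<Longrightarrow> dual.energy T x \<le> m * (norm x)\<^sup>2"
  shows "\<exists>h. pivot_embed A h = input_map A B T u"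
proof -
  define U where "U = (LINT s|lebesgue_on {0..T}. (norm (u s))\<^sup>2)"
  have "\<exists>h. \<forall>x\<in>Da. pairing T u x = cinner h x"
  proof (rule cinner_representation[OF subspace_Da])
    show "cmod (pairing T u x) \<le> (U + m) / 2 * norm x" if x: "x \<in> Da" for x
    proof (cases "x = 0")
      case True
      then show ?thesis using pairing_linear(2)[OF u x x, of 0] by simp
    next
      case False
      define y where "y = (1 / norm x) *\<^sub>R x"
      have y: "y \<in> Da" "norm y = 1" using Da_closed(4)[OF x] False by (auto simp: y_def)
      have "x = scaleC (of_real (norm x)) y" using False by (simp add: y_def flip: scaleR_scaleC)
      then have "pairing T u x = of_real (norm x) * pairing T u y"
        using pairing_linear(2)[OF u y(1) y(1), of "of_real (norm x)"] by simp
      then have "cmod (pairing T u x) = norm x * cmod (pairing T u y)" by (simp add: norm_mult)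
      also have "\<dots> \<le> norm x * ((U + m) / 2)"
        using pairing_bound[OF u y(1)] m[OF y(1)] y(2) by (intro mult_left_mono) (auto simp: U_def)
      finally show ?thesis by (simp add: mult.commute)
    qed
  qed (use pairing_linear[OF u] Da_closed in auto)
  then obtain h where h: "\<And>x. x \<in> Da \<Longrightarrow> pairing T u x = cinner h x" by blast
  have "pivot_embed A h = input_map A B T u"
    using h input_map_eq input_map_outside by (auto simp: pivot_embed_def)
  then show ?thesis by blast
qed

lemma pivot_embed_eq_iff:
  "pivot_embed A h = input_map A B T u \<longleftrightarrow> (\<forall>x\<in>Da. cinner h x = pairing T u x)"
proof
  assume eq: "pivot_embed A h = input_map A B T u"
  show "\<forall>x\<in>Da. cinner h x = pairing T u x"
  proof
    fix x assume x: "x \<in> Da"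
    then show "cinner h x = pairing T u x"
      using fun_cong[OF eq, of x] input_map_eq[OF x] by (simp add: pivot_embed_def)
  qed
next
  assume "\<forall>x\<in>Da. cinner h x = pairing T u x"
  then show "pivot_embed A h = input_map A B T u"
    using input_map_eq input_map_outside by (auto simp: pivot_embed_def)
qed

lemma pivot_embed_inject:
  assumes "\<forall>x\<in>Da. cinner h x = cinner k x"
  shows "h = k"
proof -
  have "inner (h - k) x = 0" if "x \<in> Da" for x
    using assms that by (metis Re_cinner inner_diff_left diff_self)
  then have "inner (h - k) (h - k) = 0"
    using orthogonal_closure[of Da "h - k" "h - k"] primal.closure_Da by auto
  then show ?thesis by simp
qed

text \<open>Uniform boundedness on \<open>Da\<close>, with the seminorm
  \<open>sqrt (dual.energy T z)\<close>, for the functionals \<open>form T z x\<close> with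
  \<open>norm x \<le> 1\<close>. Along a fast Cauchy sequence they approach the pairing of a limit
  control with \<open>x\<close>; admissibility represents this pairing by a vector \<open>h\<close>,
  so \<open>norm h\<close> bounds the limits. Taking \<open>z = x\<close> in the conclusion gives
  the estimate.\<close>

lemma admissible_imp_energy_bound:
  assumes "admissible A B"
  shows "\<exists>T>0. \<exists>m. \<forall>x\<in>Da. dual.energy T x \<le> m * (norm x)\<^sup>2"
proof -
  obtain T where T: "T > 0" "input_map A B T ` L2 {0..} \<subseteq> range (pivot_embed A)"
    using assms unfolding admissible_def by blast
  interpret form: semi_inner Da "form T" by (rule semi_inner_form)
  define F where "F = (\<lambda>x z. \<bar>form T z x\<bar>) ` {x \<in> Da. norm x \<le> 1}"
  have "\<exists>M. \<forall>f\<in>F. \<forall>z\<in>Da. f z \<le> M * sqrt (dual.energy T z)"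
  proof (rule uniform_boundedness_seminorms[OF subspace_Da])
    fix z :: "nat \<Rightarrow> 'h"
    assume z: "\<And>n. z n \<in> Da" "\<And>n. sqrt (dual.energy T (z (Suc n) - z n)) \<le> (1/3) ^ n"
    \<comment> \<open>Squaring turns the ratio \<open>1/3\<close> into \<open>1/9\<close>, below the
      ratio \<open>1/4\<close> of \<open>out_limit\<close>.\<close>
    have "dual.energy T (z (Suc n) - z n) \<le> 1 * (1/4) ^ n" for n
    proof -
      have "dual.energy T (z (Suc n) - z n) \<le> ((1/3) ^ n)\<^sup>2"
        using z(2)[of n] by (simp add: real_sqrt_le_iff sqrt_le_D)
      also have "\<dots> = (1/9) ^ n" by (simp add: power2_eq_square flip: power_mult_distrib)
      also have "\<dots> \<le> (1/4) ^ n" by (intro power_mono) auto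
      finally show ?thesis by simp
    qed
    from out_limit[OF z(1) this]
    obtain u where u: "u \<in> L2 {0..T}" "\<And>x. x \<in> Da \<Longrightarrow> (\<lambda>n. form T (z n) x) \<longlonglongrightarrow> Re (pairing T u x)"
      by blast
    let ?v = "\<lambda>s. if s \<in> {0..T} then u s else 0"
    have "?v \<in> L2 {0..}" by (rule L2_extend_zero[OF u(1)]) auto
    then have "input_map A B T ?v \<in> range (pivot_embed A)" using T(2) by blast
    then obtain h where "pivot_embed A h = input_map A B T ?v" by (metis rangeE)
    moreover have "pairing T ?v x = pairing T u x" for x
      unfolding pairing_def by (intro Bochner_Integration.integral_cong) auto
    ultimately have h: "cinner h x = pairing T u x" if "x \<in> Da" for x
      using that by (simp add: pivot_embed_eq_iff)
    have "\<forall>\<^sub>F n in sequentially. \<bar>form T (z n) x\<bar> \<le> norm h + 1" if x: "x \<in> Da" "norm x \<le> 1" for x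
    proof -
      have "\<bar>Re (pairing T u x)\<bar> \<le> norm h * norm x"
        using order_trans[OF abs_Re_le_cmod norm_cinner_le] h[OF x(1)] by metis
      also have "\<dots> \<le> norm h" using x(2) by (simp add: mult_left_le)
      finally have "\<bar>Re (pairing T u x)\<bar> < norm h + 1" by simp
      then have "\<forall>\<^sub>F n in sequentially. \<bar>form T (z n) x\<bar> < norm h + 1"
        by (rule order_tendstoD(2)[OF tendsto_rabs[OF u(2)[OF x(1)]]])
      then show ?thesis by (rule eventually_mono) simp
    qed
    then show "\<exists>M. \<forall>f\<in>F. \<forall>\<^sub>F n in sequentially. f (z n) \<le> M"
      unfolding F_def by blast
  next
    fix f assume "f \<in> F"
    then obtain x where x: "x \<in> Da" "f = (\<lambda>z. \<bar>form T z x\<bar>)" by (auto simp: F_def)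
    have "\<bar>form T z x\<bar> \<le> sqrt (dual.energy T x) * sqrt (dual.energy T z)" if "z \<in> Da" for z
      using real_sqrt_le_mono[OF form.Cauchy_Schwarz[OF that x(1)]]
      by (simp add: form_self real_sqrt_mult mult.commute)
    then show "\<exists>c. \<forall>z\<in>Da. f z \<le> c * sqrt (dual.energy T z)" using x by blast
  next
    fix f y z r assume f: "f \<in> F" and yz: "y \<in> Da" "z \<in> Da"
    obtain x where x: "x \<in> Da" "f = (\<lambda>z. \<bar>form T z x\<bar>)" using f by (auto simp: F_def)
    show "f (y + z) \<le> f y + f z"
      using form.add[OF yz x(1)] abs_triangle_ineq by (simp add: x(2))
  next
    fix f z and r :: real assume f: "f \<in> F" and z: "z \<in> Da"
    obtain x where x: "x \<in> Da" "f = (\<lambda>z. \<bar>form T z x\<bar>)" using f by (auto simp: F_def)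
    show "f (r *\<^sub>R z) = \<bar>r\<bar> * f z"
      using form.scale[OF z x(1), of r] by (simp add: x(2) abs_mult)
  qed (simp_all only: energy_sqrt_scale real_sqrt_ge_zero dual.energy_nonneg)
  then obtain M where M0: "\<And>f z. f \<in> F \<Longrightarrow> z \<in> Da \<Longrightarrow> f z \<le> M * sqrt (dual.energy T z)"
    by blast
  have M: "\<bar>form T z x\<bar> \<le> M * sqrt (dual.energy T z)" if "x \<in> Da" "norm x \<le> 1" "z \<in> Da" for x z
    by (rule M0[of "\<lambda>z. \<bar>form T z x\<bar>"]) (use that in \<open>auto simp: F_def\<close>)
  have unit: "dual.energy T x \<le> M\<^sup>2" if x: "x \<in> Da" "norm x \<le> 1" for x
  proof -
    let ?s = "sqrt (dual.energy T x)"
    have le: "?s * ?s \<le> M * ?s"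
      using M[OF x x(1)] dual.energy_nonneg[of T x] by (simp add: form_self)
    have "?s \<le> \<bar>M\<bar>"
    proof (cases "?s = 0")
      case False
      then have "?s > 0" using dual.energy_nonneg[of T x] by simp
      from mult_right_le_imp_le[OF le this] show ?thesis by simp
    qed simp
    then show ?thesis using dual.energy_nonneg[of T x] by (metis real_sqrt_abs real_sqrt_le_iff)
  qed
  have "dual.energy T x \<le> M\<^sup>2 * (norm x)\<^sup>2" if x: "x \<in> Da" for x
  proof (cases "x = 0")
    case True
    then show ?thesis using dual.energy_scaleR[of x T 0] x by simp
  next
    case False
    have "dual.energy T ((1 / norm x) *\<^sub>R x) \<le> M\<^sup>2"
      using Da_closed(4)[OF x] False by (intro unit) auto
    then show ?thesis
      using dual.energy_scaleR[of x T "1 / norm x"] x False by (simp add: field_simps power_divide)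
  qed
  then show ?thesis using T(1) by blast
qed

lemma energy_bound_imp_admissible:
  assumes T: "T > 0" and m: "\<And>x. x \<in> Da \<Longrightarrow> dual.energy T x \<le> m * (norm x)\<^sup>2"
  shows "admissible A B"
  unfolding admissible_def
proof (intro exI conjI subsetI)
  fix f assume "f \<in> input_map A B T ` L2 {0..}"
  then obtain u where u: "u \<in> L2 {0..}" "f = input_map A B T u" by blast
  have "u \<in> L2 {0..T}" by (rule L2_subset[OF u(1)]) auto
  then obtain h where "pivot_embed A h = input_map A B T u"
    using pivot_range[of u T m] m by blast
  then show "f \<in> range (pivot_embed A)" using u(2) by (metis rangeI)
qed (rule T)

subsection \<open>Exact controllability\<close>

lemma solution_eq_iff:
  assumes u: "u \<in> L2 {0..T}" and m: "\<And>x. x \<in> Da \<Longrightarrow> dual.energy T x \<le> m * (norm x)\<^sup>2"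
  shows "solution A B y0 u T = y1 \<longleftrightarrow> (\<forall>x\<in>Da. cinner (y1 - S T y0) x = pairing T u x)"
proof -
  obtain h where h: "pivot_embed A h = input_map A B T u" using pivot_range[OF u m] by blast
  have "(THE h. pivot_embed A h = input_map A B T u) = h"
    using h
  proof (rule the_equality)
    fix k assume "pivot_embed A k = input_map A B T u"
    then show "k = h" using h by (intro pivot_embed_inject) (simp add: pivot_embed_eq_iff)
  qed
  then have "solution A B y0 u T = y1 \<longleftrightarrow> h = y1 - S T y0"
    by (auto simp: solution_def)
  also have "\<dots> \<longleftrightarrow> pivot_embed A (y1 - S T y0) = input_map A B T u"
    using h by (metis pivot_embed_eq_iff pivot_embed_inject)
  finally show ?thesis by (simp add: pivot_embed_eq_iff)
qed

text \<open>Uniform boundedness for the functionals \<open>inner y x\<close> over all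
  \<open>x\<close> of energy at most one. Every limit \<open>l\<close> is reached from zero by some
  control \<open>u\<close>, and \<open>cinner l x\<close> is the pairing of \<open>u\<close> with an
  output of energy at most one, which bounds it independently of \<open>x\<close>.\<close>

lemma exactly_controllable_imp_observable:
  assumes T: "T \<ge> 0" and m: "\<And>x. x \<in> Da \<Longrightarrow> dual.energy T x \<le> m * (norm x)\<^sup>2"
    and exact: "exactly_controllable A B T"
  shows "\<exists>k\<ge>0. \<forall>x\<in>Da. (norm x)\<^sup>2 \<le> k * dual.energy T x"
proof -
  define F where "F = (\<lambda>x (y::'h). \<bar>inner y x\<bar>) ` {x \<in> Da. dual.energy T x \<le> 1}"
  have "\<exists>M. \<forall>f\<in>F. \<forall>y\<in>UNIV. f y \<le> M * norm y"
  proof (rule uniform_boundedness_seminorms)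
    fix z :: "nat \<Rightarrow> 'h" assume "\<And>n. norm (z (Suc n) - z n) \<le> (1/3) ^ n"
    then obtain l where l: "z \<longlonglongrightarrow> l"
      using convergent_geometric_steps convergent_def by blast
    obtain u where "u \<in> L2 {0..T}" "solution A B 0 u T = l"
      using exact unfolding exactly_controllable_def by blast
    then have u: "u \<in> L2 {0..T}" "\<And>x. x \<in> Da \<Longrightarrow> cinner l x = pairing T u x"
      using solution_eq_iff[OF _ m] T by (auto simp: primal.zero)
    define U where "U = (LINT s|lebesgue_on {0..T}. (norm (u s))\<^sup>2)"
    have "\<forall>\<^sub>F n in sequentially. \<bar>inner (z n) x\<bar> \<le> (U + 1) / 2 + 1"
      if x: "x \<in> Da" "dual.energy T x \<le> 1" for x
    proof -
      have "\<bar>inner l x\<bar> \<le> cmod (cinner l x)"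
        using abs_Re_le_cmod[of "cinner l x"] by (simp add: Re_cinner)
      also have "\<dots> = cmod (pairing T u x)" by (simp add: u(2)[OF x(1)])
      also have "\<dots> \<le> (U + 1) / 2"
        using pairing_bound[OF u(1) x(1)] x(2) by (simp add: U_def)
      finally have "\<bar>inner l x\<bar> < (U + 1) / 2 + 1" by linarith
      then have "\<forall>\<^sub>F n in sequentially. \<bar>inner (z n) x\<bar> < (U + 1) / 2 + 1"
        by (intro order_tendstoD(2)[OF tendsto_rabs[OF tendsto_inner[OF l tendsto_const]]])
      then show ?thesis by (rule eventually_mono) simp
    qed
    then show "\<exists>M. \<forall>f\<in>F. \<forall>\<^sub>F n in sequentially. f (z n) \<le> M"
      unfolding F_def by blast
  next
    fix f assume "f \<in> F"
    then obtain x where "f = (\<lambda>y. \<bar>inner y x\<bar>)" by (auto simp: F_def)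
    then show "\<exists>c. \<forall>y\<in>UNIV. f y \<le> c * norm y"
      using Cauchy_Schwarz_ineq2[of _ x] by (intro exI[of _ "norm x"]) (simp add: mult.commute)
  qed (auto simp: F_def inner_add_left abs_mult)
  then obtain M where M0: "\<And>f y. f \<in> F \<Longrightarrow> f y \<le> M * norm y"
    by blast
  have M: "\<bar>inner y x\<bar> \<le> M * norm y" if "x \<in> Da" "dual.energy T x \<le> 1" for x y
    by (rule M0[of "\<lambda>y. \<bar>inner y x\<bar>"]) (use that in \<open>auto simp: F_def\<close>)
  have unit: "norm x \<le> \<bar>M\<bar>" if x: "x \<in> Da" "dual.energy T x \<le> 1" for x
  proof -
    have "norm x * norm x \<le> M * norm x"
      using M[OF x, of x] by (simp flip: power2_norm_eq_inner power2_eq_square)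
    then show ?thesis by (cases "x = 0") (auto simp: mult_le_cancel_right)
  qed
  have "(norm x)\<^sup>2 \<le> M\<^sup>2 * dual.energy T x" if x: "x \<in> Da" for x
  proof (cases "dual.energy T x = 0")
    case True
    \<comment> \<open>Nonzero vectors of zero energy could be scaled at will without leaving the set
      of energy at most one, on which the norm is bounded.\<close>
    have "x = 0"
    proof (rule ccontr)
      assume "x \<noteq> 0"
      have "norm (((\<bar>M\<bar> + 1) / norm x) *\<^sub>R x) \<le> \<bar>M\<bar>"
        using Da_closed(4)[OF x] dual.energy_scaleR[of x T] x True by (intro unit) auto
      then show False using \<open>x \<noteq> 0\<close> by simp
    qed
    then show ?thesis using True by simp
  next
    case False
    define e where "e = sqrt (dual.energy T x)"
    have e: "e > 0" "e\<^sup>2 = dual.energy T x" using False dual.energy_nonneg[of T x] by (auto simp: e_def)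
    have "norm ((1 / e) *\<^sub>R x) \<le> \<bar>M\<bar>"
      using Da_closed(4)[OF x] dual.energy_scaleR[of x T "1 / e"] x e by (intro unit) (auto simp: power_divide)
    then have "norm x \<le> \<bar>M\<bar> * e" using e(1) by (simp add: field_simps)
    then have "(norm x)\<^sup>2 \<le> (\<bar>M\<bar> * e)\<^sup>2" by (intro power_mono) auto
    then show ?thesis by (simp add: power_mult_distrib e(2))
  qed
  then show ?thesis by (intro exI[of _ "M\<^sup>2"]) auto
qed

text \<open>Observability bounds \<open>inner y\<close> by the energy form, so approximate
  representers exist in \<open>Da\<close>. Their outputs converge to a control whose pairing with
  every \<open>w\<close> is \<open>cinner y w\<close>, where \<open>y\<close> is what the free
  evolution leaves to be reached.\<close>

lemma observable_imp_exactly_controllable: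
  assumes m: "\<And>x. x \<in> Da \<Longrightarrow> dual.energy T x \<le> m * (norm x)\<^sup>2"
    and k: "\<And>x. x \<in> Da \<Longrightarrow> (norm x)\<^sup>2 \<le> k * dual.energy T x"
  shows "exactly_controllable A B T"
  unfolding exactly_controllable_def
proof (intro allI)
  fix y0 y1
  define y where "y = y1 - S T y0"
  interpret form: semi_inner Da "form T" by (rule semi_inner_form)
  have bound: "(inner y x)\<^sup>2 \<le> ((norm y)\<^sup>2 * k) * form T x x" if x: "x \<in> Da" for x
  proof -
    have "(inner y x)\<^sup>2 \<le> (norm y)\<^sup>2 * (norm x)\<^sup>2"
      using Cauchy_Schwarz_ineq[of y x] by (simp add: power2_norm_eq_inner)
    also have "\<dots> \<le> (norm y)\<^sup>2 * (k * dual.energy T x)"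
      by (intro mult_left_mono k x) simp
    finally show ?thesis by (simp add: form_self mult.assoc)
  qed
  obtain x where x: "\<And>n. x n \<in> Da"
    "\<And>n w. w \<in> Da \<Longrightarrow> \<bar>form T (x n) w - inner y w\<bar> \<le> (1/2)^n * sqrt (form T w w)"
    by (rule form.riesz_sequence[of "inner y" "(norm y)\<^sup>2 * k"]) (use bound in \<open>auto simp: inner_add_right\<close>)
  \<comment> \<open>\<open>(1/2) ^ Suc n + (1/2) ^ n\<close> is at most
    \<open>2 * (1/2) ^ n\<close>, whose square is the right-hand side.\<close>
  have "dual.energy T (x (Suc n) - x n) \<le> 4 * (1/4) ^ n" for n
  proof -
    have "sqrt (dual.energy T (x (Suc n) - x n)) \<le> 2 * (1/2) ^ n"
      using form.riesz_sequence_Cauchy[OF x, of "Suc n" n] zero_le_power[of "1/2::real" n]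
      unfolding form_self power_Suc by linarith
    then have "dual.energy T (x (Suc n) - x n) \<le> (2 * (1/2) ^ n)\<^sup>2" by (rule sqrt_le_D)
    also have "\<dots> = 4 * (1/4) ^ n" by (simp add: power2_eq_square flip: power_mult_distrib)
    finally show ?thesis .
  qed
  from out_limit[OF x(1) this]
  obtain u where u: "u \<in> L2 {0..T}" "\<And>w. w \<in> Da \<Longrightarrow> (\<lambda>n. form T (x n) w) \<longlonglongrightarrow> Re (pairing T u w)"
    by blast
  have Re_eq: "Re (pairing T u w) = Re (cinner y w)" if w: "w \<in> Da" for w
  proof -
    have "(\<lambda>n. (1/2)^n * sqrt (form T w w)) \<longlonglongrightarrow> 0"
      by (intro tendsto_mult_left_zero LIMSEQ_realpow_zero) auto
    then have "(\<lambda>n. form T (x n) w - inner y w) \<longlonglongrightarrow> 0"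
      by (rule Lim_null_comparison[rotated]) (use x(2)[OF w] in auto)
    then have "(\<lambda>n. form T (x n) w) \<longlonglongrightarrow> inner y w" by (simp add: LIM_zero_iff)
    then show ?thesis using LIMSEQ_unique[OF u(2)[OF w]] by (simp add: Re_cinner)
  qed
  \<comment> \<open>Only real parts have been matched so far; the vector
    \<open>scaleC \<i> w\<close> supplies the imaginary parts.\<close>
  have "cinner y w = pairing T u w" if w: "w \<in> Da" for w
    using Re_eq[OF w] Re_eq[OF Da_closed(3)[OF w, of \<i>]] pairing_linear(2)[OF u(1) w w, of \<i>]
    by (intro complex_eqI) (simp_all add: cinner_scaleC_right)
  then have "solution A B y0 u T = y1"
    using solution_eq_iff[OF u(1) m] by (simp add: y_def)
  then show "\<exists>u\<in>L2 {0..T}. solution A B y0 u T = y1" using u(1) by blast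
qed

lemma fattorini_hautusD:
  assumes FH: "fattorini_hautus A B"
    and z: "z \<in> Da" "the (adjoint_op A z) = scaleC l z" "Bstar z = 0"
  shows "z = 0"
proof -
  have "z \<in> kernel (shifted l (adjoint_op A))"
    using z(1,2) by (auto simp: kernel_def shifted_def)
  moreover have "z \<in> kernel (control_adjoint A B)"
    using control_adjoint_eq(1)[OF z(1)] z(3) by (simp add: kernel_def)
  ultimately show ?thesis using FH unfolding fattorini_hautus_def by blast
qed

end

section \<open>Transfer to the perturbed control system\<close>

lemma control_operator_perturb:
  assumes dense: "closure (dom A) = UNIV" and K: "bounded_clinear K" and B: "control_operator A B"
  shows "control_operator (perturb A K) B"
proof -
  note adj = adjoint_perturb[OF dense K]
  have dom: "dom (adjoint_op (perturb A K)) = dom (adjoint_op A)" by (simp add: adj)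
  obtain k where k: "k \<ge> 0" "\<And>x. norm (bounded_adjoint K x) \<le> norm x * k"
    using bounded_linear.nonneg_bounded[OF bounded_clinearD(1)[OF bounded_clinear_bounded_adjoint[OF K]]]
    by blast
  \<comment> \<open>The two adjoints share their domain and differ there by a bounded operator of
    norm at most \<open>k\<close>, so their graph norms are comparable.\<close>
  have gn: "graph_norm (adjoint_op A) x \<le> (2 + k) * graph_norm (adjoint_op (perturb A K)) x"
    if x: "x \<in> dom (adjoint_op A)" for x
  proof -
    let ?g = "graph_norm (adjoint_op (perturb A K)) x"
    let ?y = "the (adjoint_op (perturb A K) x)"
    have "graph_norm (adjoint_op A) x \<le> norm x + norm (the (adjoint_op A x))"
      unfolding graph_norm_def by (rule sqrt_sum_squares_le_sum) auto
    also have "the (adjoint_op A x) = ?y - bounded_adjoint K x"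
      using x by (simp add: adj the_perturb)
    also have "norm x + norm (?y - bounded_adjoint K x) \<le> (1 + k) * norm x + norm ?y"
      using norm_triangle_ineq4[of ?y "bounded_adjoint K x"] k(2)[of x] by (simp add: algebra_simps)
    also have "\<dots> \<le> (1 + k) * ?g + ?g"
      using k(1) unfolding graph_norm_def by (intro add_mono mult_left_mono) auto
    finally show ?thesis by (simp add: algebra_simps)
  qed
  \<comment> \<open>Used with constant \<open>p\<close> for each single functional
    \<open>B v\<close>, and with \<open>p = norm\<close> for the joint bound of
    \<open>B\<close>.\<close>
  have trans: "\<exists>C. \<forall>v. \<forall>x\<in>dom (adjoint_op A). cmod (f v x) \<le> C * p v * graph_norm (adjoint_op (perturb A K)) x"
    if f: "\<forall>v. \<forall>x\<in>dom (adjoint_op A). cmod (f v x) \<le> C * p v * graph_norm (adjoint_op A) x" and p: "\<And>v. p v \<ge> 0"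
    for f :: "'c \<Rightarrow> 'a \<Rightarrow> complex" and p C
  proof -
    have "cmod (f v x) \<le> (\<bar>C\<bar> * (2 + k)) * p v * graph_norm (adjoint_op (perturb A K)) x"
      if x: "x \<in> dom (adjoint_op A)" for v x
    proof -
      have "cmod (f v x) \<le> C * p v * graph_norm (adjoint_op A) x" using f x by blast
      also have "\<dots> \<le> \<bar>C\<bar> * p v * graph_norm (adjoint_op A) x"
        using p by (intro mult_right_mono) (auto simp: graph_norm_def)
      also have "\<dots> \<le> \<bar>C\<bar> * p v * ((2 + k) * graph_norm (adjoint_op (perturb A K)) x)"
        using p by (intro mult_left_mono gn x) auto
      finally show ?thesis by (simp add: mult_ac)
    qed
    then show ?thesis by blast
  qed
  have "B v \<in> dual_adjoint_domain (perturb A K)" for v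
  proof -
    have Bv: "B v \<in> dual_adjoint_domain A" using B by (simp add: control_operator_def)
    then obtain C where "\<forall>x\<in>dom (adjoint_op A). cmod (B v x) \<le> C * graph_norm (adjoint_op A) x"
      unfolding dual_adjoint_domain_def by blast
    then have "\<exists>C. \<forall>x\<in>dom (adjoint_op A). cmod (B v x) \<le> C * graph_norm (adjoint_op (perturb A K)) x"
      using trans[of "\<lambda>_. B v" C "\<lambda>_. 1"] by simp
    then show ?thesis using Bv unfolding dual_adjoint_domain_def dom by blast
  qed
  moreover have "\<exists>C. \<forall>v. \<forall>x\<in>dom (adjoint_op A). cmod (B v x) \<le> C * norm v * graph_norm (adjoint_op (perturb A K)) x"
  proof -
    obtain C where "\<forall>v. \<forall>x\<in>dom (adjoint_op A). cmod (B v x) \<le> C * norm v * graph_norm (adjoint_op A) x"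
      using B unfolding control_operator_def by blast
    then show ?thesis by (rule trans) simp
  qed
  ultimately show ?thesis using B unfolding control_operator_def dom by blast
qed

theorem corollary1p3:
  fixes A0 :: "('h::complex_hilbert, 'h) unbounded_op"
    and B :: "'u::complex_hilbert \<Rightarrow> ('h \<Rightarrow> complex)"
    and K :: "'h \<Rightarrow> 'h"
    and T0 :: real
  assumes "generates_C0_semigroup A0"
    and "control_operator A0 B"
    and "admissible A0 B"
    and "bounded_clinear K"
    and "T0 > 0"
    and "exactly_controllable A0 B T0"
    and "compact_operator K"
    and "fattorini_hautus (perturb A0 K) B"
  shows "generates_C0_semigroup (perturb A0 K) \<and>
         control_operator (perturb A0 K) B \<and>
         admissible (perturb A0 K) B \<and>
         (\<forall>T>T0. exactly_controllable (perturb A0 K) B T)"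
proof -
  interpret sys0: control_system A0 B by unfold_locales (rule assms)+
  let ?AK = "perturb A0 K" and ?Ka = "bounded_adjoint K"
  have dense: "closure (dom A0) = UNIV" using sys0.primal.closure_D by simp
  have gen: "generates_C0_semigroup ?AK" by (rule generates_perturb[OF assms(1,4)])
  have ctrl: "control_operator ?AK B" by (rule control_operator_perturb[OF dense assms(4,2)])
  interpret sysK: control_system ?AK B by unfold_locales (rule gen ctrl)+
  have adj: "adjoint_op ?AK = perturb (adjoint_op A0) ?Ka" by (rule adjoint_perturb[OF dense assms(4)])
  have Da: "dom (adjoint_op ?AK) = dom (adjoint_op A0)" by (simp add: adj)
  \<comment> \<open>The adjoints have the same domain and \<open>B\<close> is the same, so both
    systems are observed through one operator.\<close>
  have Bstar: "sysK.Bstar = sys0.Bstar"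
    by (simp add: sysK.Bstar_def[abs_def] sys0.Bstar_def[abs_def] control_adjoint_def Da)
  have Ka: "bounded_linear ?Ka"
    by (rule bounded_clinearD(1)[OF bounded_clinear_bounded_adjoint[OF assms(4)]])
  \<comment> \<open>Taking adjoints turns the perturbation by \<open>K\<close> into one by
    \<open>?Ka\<close>, so the two adjoint semigroups play the roles of \<open>S\<close> and
    \<open>T\<close>.\<close>
  interpret pert: perturbed_observation "\<lambda>t. sys0.Sa t" sys0.Bstar sys0.Bstar_bound "\<lambda>t. sysK.Sa t" ?Ka
    by (intro perturbed_observation.intro perturbed_observation_axioms.intro
        sys0.dual.observation_axioms sysK.dual.C0 Ka) (simp add: adj)
  have energy_eq: "pert.T.energy = sysK.dual.energy"
    by (intro ext) (simp add: pert.T.energy_def sysK.dual.energy_def Bstar)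
  have adm0: "\<exists>m\<ge>0. \<forall>x\<in>sys0.Da. sys0.dual.energy \<tau> x \<le> m * (norm x)\<^sup>2" for \<tau>
    using sys0.admissible_imp_energy_bound[OF assms(3)] sys0.dual.admissible_all_times[of _ _ \<tau>]
    by fastforce
  \<comment> \<open>The estimate is transferred at time \<open>1\<close> and extended from there to
    all times.\<close>
  have admK: "\<exists>m\<ge>0. \<forall>x\<in>sysK.Da. sysK.dual.energy \<tau> x \<le> m * (norm x)\<^sup>2" for \<tau>
  proof -
    obtain m where "m \<ge> 0" "\<And>x. x \<in> sys0.Da \<Longrightarrow> sys0.dual.energy 1 x \<le> m * (norm x)\<^sup>2"
      using adm0[of 1] by blast
    then obtain m' where m': "\<And>x. x \<in> sysK.Da \<Longrightarrow> sysK.dual.energy 1 x \<le> m' * (norm x)\<^sup>2"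
      using pert.T_admissible[of 1 m] by (auto simp: energy_eq Da)
    show ?thesis
      using sysK.dual.admissible_all_times[of 1 m' \<tau>] m' by simp
  qed
  have "admissible ?AK B"
    using admK[of 1] sysK.energy_bound_imp_admissible[of 1] by auto
  moreover have "exactly_controllable ?AK B T" if T: "T > T0" for T
  proof -
    obtain m where m: "m \<ge> 0" "\<And>x. x \<in> sys0.Da \<Longrightarrow> sys0.dual.energy T0 x \<le> m * (norm x)\<^sup>2"
      using adm0[of T0] by blast
    obtain k where k: "k \<ge> 0" "\<And>x. x \<in> sys0.Da \<Longrightarrow> (norm x)\<^sup>2 \<le> k * sys0.dual.energy T0 x"
      using sys0.exactly_controllable_imp_observable[OF _ m(2) assms(6)] assms(5) by auto
    obtain N where N: "N \<ge> 0" "\<And>x. x \<in> sys0.Da \<Longrightarrow> sys0.dual.energy T0 x \<le>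
        2 * sysK.dual.energy T0 x + N * integral {0..T0} (\<lambda>s. (norm (?Ka (sysK.Sa s x)))\<^sup>2)"
      using pert.energy_comparison[of T0 m] m assms(5) by (auto simp: energy_eq)
    \<comment> \<open>A single constant serves for both terms of \<open>coercive\<close>:
      \<open>k\<close> is the observability constant in time \<open>T0\<close>, and the coefficients
      \<open>2\<close> and \<open>N\<close> of the energy comparison are both enlarged to
      \<open>2 + N\<close>.\<close>
    define q where "q = k * (2 + N)"
    interpret weakly_coercive_observation "\<lambda>t. sysK.Sa t" sysK.Bstar sysK.Bstar_bound ?Ka T0 q
    proof (intro weakly_coercive_observation.intro weakly_coercive_observation_axioms.intro
        sysK.dual.observation_axioms Ka)
      show "(\<lambda>n. ?Ka (x n)) \<longlonglongrightarrow> ?Ka l"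
        if "\<And>n. norm (x n) \<le> M" "\<And>y. (\<lambda>n. inner (x n) y) \<longlonglongrightarrow> inner l y" for x l M
        using compact_operator_adjoint_weak_to_strong[OF assms(7)] that by blast
      show "(norm x)\<^sup>2 \<le> q * sysK.dual.energy T0 x + q * integral {0..T0} (\<lambda>s. (norm (?Ka (sysK.Sa s x)))\<^sup>2)"
        if "x \<in> sysK.dual.D" for x
      proof -
        let ?I = "integral {0..T0} (\<lambda>s. (norm (?Ka (sysK.Sa s x)))\<^sup>2)"
        have x: "x \<in> sys0.Da" using that by (simp add: Da)
        have "0 \<le> ?I"
          by (intro integral_nonneg integrable_continuous_interval continuous_intros
              bounded_linear.continuous_on[OF Ka] continuous_on_subset[OF sysK.dual.continuous_on_orbit]) auto
        have "(norm x)\<^sup>2 \<le> k * (2 * sysK.dual.energy T0 x + N * ?I)"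
          using k(2)[OF x] mult_left_mono[OF N(2)[OF x] k(1)] by linarith
        also have "\<dots> \<le> k * ((2 + N) * sysK.dual.energy T0 x + (2 + N) * ?I)"
          using N(1) k(1) \<open>0 \<le> ?I\<close> sysK.dual.energy_nonneg
          by (intro mult_left_mono add_mono mult_right_mono) auto
        finally show ?thesis by (simp add: q_def algebra_simps)
      qed
      show "z = 0" if "z \<in> sysK.dual.D" "sysK.dual.G z = scaleC l z" "sysK.Bstar z = 0" for z l
        using sysK.fattorini_hautusD[OF assms(8)] that by simp
    qed (use Ka admK assms(5) k N in \<open>auto simp: q_def\<close>)
    obtain k' where "\<And>x. x \<in> sysK.Da \<Longrightarrow> (norm x)\<^sup>2 \<le> k' * sysK.dual.energy T x"
      using observability[OF T] by auto
    then show ?thesis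
      using admK[of T] sysK.observable_imp_exactly_controllable[of T] by blast
  qed
  ultimately show ?thesis using gen ctrl by blast
qed

end
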